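(* Let $k=k(n)$ satisfy $1 \ll \log k \ll \log n$ as $n\to\infty$, and write $\kappa := k/\log n$. Consider either the simple random walk or the directed random walk, with entropic time $t_0$ and cutoff times $t_\alpha$, $\alpha\in\mathbb{R}$. There exist continuous functions $f,g:(0,\infty)\to(0,\infty)$ (whose values differ between the simple and the directed cases) such that, for all $\alpha\in\mathbb{R}$ and all $\lambda>0$, the following hold: \begin{itemize} \item if $k \ll \log n$, then $t_0 \sim k\, n^{2/k}/(2\pi e)$ and $t_\alpha - t_0 \sim \sqrt{2}\,\alpha\, t_0/\sqrt{k}$; \item if $k \sim \lambda\log n$, then $t_0 \sim k\, f(\lambda)$ and $t_\alpha - t_0 \sim g(\lambda)\,\alpha\, t_0/\sqrt{k}$; \item if $k \gg \log n$, then $t_0 \sim k/(\kappa\log\kappa)$ and $t_\alpha - t_0 \sim \sqrt{\kappa\log\kappa}\;\alpha\, t_0/\sqrt{k}$. \end{itemize} In particular, in all three cases, $t_\alpha \sim t_0$ for all $\alpha\in\mathbb{R}$.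
   Context: Asymptotic notation is as $n\to\infty$ with $k=k(n)$: $a\ll b$ (or $b \gg a$) means $a/b\to0$; $a\sim b$ means $a/b\to1$ (for $\alpha=0$ the relation $t_\alpha-t_0\sim 0$ is read as the trivial equality $0=0$). Logarithms are natural. The rate-1 simple random walk (SRW) on $\mathbb{Z}^k$ jumps at rate 1; at each jump it chooses a coordinate uniformly at random and adds $+1$ or $-1$ to it with probability $1/2$ each. The rate-1 directed random walk (DRW) is the same but always adds $+1$. Both start from $0$. Let $W=(W_1(t),\dots,W_k(t))_{t\ge0}$ be one of these walks; each $W_i$ is a rate-$1/k$ walk on $\mathbb{Z}$. Let $\nu_s$ be the law of $W_1(sk)$, i.e. the law at time $s$ of the rate-1 walk on $\mathbb{Z}$. Define $Q_i(t) := -\log \nu_{t/k}(W_i(t))$, so that $\mathbb{E}(Q_1(t))$ is the Shannon entropy of $W_1(t)$. For $\alpha\in\mathbb{R}$, $t_\alpha=t_\alpha(k,n)$ is defined by $$\mathbb{E}(Q_1(t_\alpha)) = \bigl(\log n + \alpha\sqrt{vk}\bigr)/k,\qquad v := \mathrm{Var}(Q_1(t_0)),$$ where $t_0$ is given by $\mathbb{E}(Q_1(t_0))=(\log n)/k$. The time $t_0$ is the entropic time and the $t_\alpha$ are the cutoff times. *)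

theory Defs
  imports "HOL-Probability.Probability" "HOL-Library.Landau_Symbols"
begin

datatype walk_type = Simple | Directed

fun jump_size :: "walk_type \<Rightarrow> int pmf" where
  "jump_size Simple = pmf_of_set {1, -1}"
| "jump_size Directed = return_pmf 1"

text \<open>A point of $\mathbf{Z}^k$ is a function \<open>nat \<Rightarrow> int\<close> that vanishes outside \<open>{1..k}\<close>.
  The value of \<open>jump w 0\<close> is irrelevant.\<close>

definition jump :: "walk_type \<Rightarrow> nat \<Rightarrow> (nat \<Rightarrow> int) pmf" where
  "jump w k = map_pmf (\<lambda>(i, d). (\<lambda>j. if j = i then d else 0))
     (pair_pmf (pmf_of_set {1..k}) (jump_size w))"

primrec walk_after :: "walk_type \<Rightarrow> nat \<Rightarrow> nat \<Rightarrow> (nat \<Rightarrow> int) pmf" where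
  "walk_after w k 0 = return_pmf (\<lambda>_. 0)"
| "walk_after w k (Suc m) =
     map_pmf (\<lambda>(x, d). (\<lambda>j. x j + d j)) (pair_pmf (walk_after w k m) (jump w k))"

text \<open>The number of jumps that a rate-1 walk makes up to time \<open>t \<ge> 0\<close>. The case distinction is there
  because the library specifies \<open>poisson_pmf\<close> only for positive rates.\<close>

definition jump_count :: "real \<Rightarrow> nat pmf" where
  "jump_count t = (if t = 0 then return_pmf 0 else poisson_pmf t)"

text \<open>The law of $W(t)$, where $W$ is the rate-1 walk on $\mathbf{Z}^k$ started from the origin.\<close>

definition walk_law :: "walk_type \<Rightarrow> nat \<Rightarrow> real \<Rightarrow> (nat \<Rightarrow> int) pmf" where
  "walk_law w k t = bind_pmf (jump_count t) (walk_after w k)"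

text \<open>The law $\nu_s$ of $W_1(sk)$. For \<open>k \<ge> 1\<close> it does not depend on \<open>k\<close>: it is the law at time
  \<open>s\<close> of the rate-1 walk on $\mathbf{Z}$.\<close>

definition coord_law :: "walk_type \<Rightarrow> nat \<Rightarrow> real \<Rightarrow> int pmf" where
  "coord_law w k s = map_pmf (\<lambda>x. x 1) (walk_law w k (s * real k))"

text \<open>\<open>Q w k i t x\<close> is the value of $Q_i(t)$ on the event $W(t) = x$.\<close>

definition Q :: "walk_type \<Rightarrow> nat \<Rightarrow> nat \<Rightarrow> real \<Rightarrow> (nat \<Rightarrow> int) \<Rightarrow> real" where
  "Q w k i t x = - ln (pmf (coord_law w k (t / real k)) (x i))"

definition mean_Q1 :: "walk_type \<Rightarrow> nat \<Rightarrow> real \<Rightarrow> real" where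
  "mean_Q1 w k t = measure_pmf.expectation (walk_law w k t) (Q w k 1 t)"

definition var_Q1 :: "walk_type \<Rightarrow> nat \<Rightarrow> real \<Rightarrow> real" where
  "var_Q1 w k t = measure_pmf.variance (walk_law w k t) (Q w k 1 t)"

definition entropic_time :: "walk_type \<Rightarrow> nat \<Rightarrow> nat \<Rightarrow> real" where
  "entropic_time w k n = (THE t. t \<ge> 0 \<and> mean_Q1 w k t = ln (real n) / real k)"

text \<open>For \<open>\<alpha> < 0\<close> and small \<open>n\<close> the right-hand side can be negative; the equation then has no
  solution, and the value of \<open>cutoff_time\<close> is unspecified.\<close>

definition cutoff_time :: "walk_type \<Rightarrow> nat \<Rightarrow> nat \<Rightarrow> real \<Rightarrow> real" where
  "cutoff_time w k n \<alpha> = (THE t. t \<ge> 0 \<and> mean_Q1 w k t =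
     (ln (real n) + \<alpha> * sqrt (var_Q1 w k (entropic_time w k n) * real k)) / real k)"

end

theory Submission
  imports Defs "HOL-Real_Asymp.Real_Asymp"
begin

text \<open>Putting \<open>t = k s\<close> removes the dimension: \<open>E(Q\<^sub>1(t))\<close> is the Shannon entropy \<open>h(s)\<close> of the rate-1 walk on
  the integers at time \<open>s\<close>, and \<open>Var(Q\<^sub>1(t))\<close> is its varentropy \<open>V(s)\<close> (\<open>law_of_first_coordinate\<close>). The
  function \<open>h\<close> increases strictly from 0 to infinity, so \<open>t\<^sub>0 = k s\<^sub>0\<close> with \<open>h(s\<^sub>0) = log n / k\<close>, and a
  cutoff time is \<open>k s\<close> where \<open>h(s) - h(s\<^sub>0) = \<alpha> sqrt(V(s\<^sub>0) / k)\<close>. The three regimes are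
  \<open>s\<^sub>0 \<rightarrow> \<infinity>\<close>, \<open>s\<^sub>0 \<rightarrow> h\<^sup>-\<^sup>1(1/\<lambda>)\<close> and \<open>s\<^sub>0 \<rightarrow> 0\<close>.

  The main structural fact is that \<open>h\<close> is concave: the entropy gained by adding an independent increment is
  the mutual information between the sum and that increment, which decreases when more independent noise is
  added (\<open>entropy_submodular\<close>, \<open>entropy'_antimono\<close>). It is used twice. First, with a decreasing
  derivative the defining equation of the cutoff time can be linearised, which gives
  \<open>(s - s\<^sub>0) / s\<^sub>0 \<sim> \<alpha> G(s\<^sub>0) / sqrt k\<close> for \<open>G = sqrt V / (s h')\<close>, provided only that \<open>h'(r s\<^sub>0) / h'(s\<^sub>0)\<close>
  has a limit that is continuous at \<open>r = 1\<close> (\<open>perturbation\<close>). Secondly, asymptotics of a concave function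
  can be differentiated, so \<open>h'\<close> never has to be expanded by itself.

  For \<open>s \<rightarrow> \<infinity>\<close> a local limit theorem (\<open>local_limit\<close>, by Fourier inversion) says that the information
  content of the walk is \<open>log(2 \<pi> s) / 2 + Z\<^sup>2 / 2\<close> up to an error that vanishes in mean square, where \<open>Z\<close> is
  the standardised position. Hence \<open>h = log(2 \<pi> e s) / 2 + o(1)\<close>, \<open>V \<rightarrow> 1/2\<close>, \<open>s h' \<rightarrow> 1/2\<close> and
  \<open>G \<rightarrow> sqrt 2\<close>. For \<open>s \<rightarrow> 0\<close> only the origin and the support of one jump matter. With \<open>L = log(1/s)\<close> and
  \<open>c\<close> the entropy of one jump, \<open>h = s (L + c + 1 + o(1))\<close>, \<open>V = s ((L + c)\<^sup>2 + o(1))\<close>, \<open>h' = L + c + o(1)\<close> and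
  \<open>G = (1 + o(1/L)) / sqrt s\<close>. In between, \<open>f(\<lambda>) = h\<^sup>-\<^sup>1(1/\<lambda>)\<close> and \<open>g(\<lambda>) = G(f(\<lambda>))\<close>, which are continuous
  because \<open>h\<close>, \<open>h'\<close> and \<open>V\<close> are.

  The two walks differ in \<open>c\<close>, which is \<open>log 2\<close> for the simple walk and 0 for the directed one. The constant is
  visible in the expansion of \<open>h\<close>, so the functions \<open>f\<close> differ. If the functions \<open>g\<close> agreed, the rate
  \<open>o(1/L)\<close> would force the times of equal entropy of the two walks to have ratio \<open>1 + o(1/L)\<close>, and comparing
  the entropies at these times would give \<open>log 2 = 0\<close>.\<close>

section \<open>The law of one coordinate and its Fourier representation\<close>

definition steps :: "walk_type \<Rightarrow> int set" where
  "steps w = (case w of Simple \<Rightarrow> {1, -1} | Directed \<Rightarrow> {1})"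

lemma finite_steps [simp, intro]: "finite (steps w)" and steps_ne [simp]: "steps w \<noteq> {}"
  and card_steps_pos [simp]: "card (steps w) > 0"
  by (cases w; simp add: steps_def)+

lemma jump_size_eq: "jump_size w = pmf_of_set (steps w)"
  by (cases w) (simp_all add: steps_def pmf_of_set_singleton)

definition step_mean :: "walk_type \<Rightarrow> (int \<Rightarrow> 'a) \<Rightarrow> 'a::real_normed_field" where
  "step_mean w f = (\<Sum>d\<in>steps w. f d) / of_nat (card (steps w))"

text \<open>The parameter \<open>k\<close> stays because a jump of the walk moves the first coordinate only with probability
  \<open>1 / k\<close>. For \<open>k = 1\<close> this is the jump chain of the walk on the integers.\<close>

definition coord_after :: "walk_type \<Rightarrow> nat \<Rightarrow> nat \<Rightarrow> int pmf" where
  "coord_after w k m = map_pmf (\<lambda>x. x 1) (walk_after w k m)"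

lemma pmf_coord_after_0: "pmf (coord_after w k 0) x = (if x = 0 then 1 else 0)"
  by (auto simp: coord_after_def indicator_def)

lemma pmf_coord_after_Suc:
  assumes "k \<ge> 1"
  shows "pmf (coord_after w k (Suc m)) x =
    (1 - 1 / real k) * pmf (coord_after w k m) x
      + step_mean w (\<lambda>d. pmf (coord_after w k m) (x - d)) / real k"
proof -
  let ?A = "walk_after w k m"
  let ?C = "coord_after w k m"
  have "coord_after w k (Suc m) =
      bind_pmf (pmf_of_set {1..k}) (\<lambda>i. bind_pmf (pmf_of_set (steps w))
        (\<lambda>d. map_pmf (\<lambda>y. y + (if 1 = i then d else 0)) ?C))"
    unfolding coord_after_def walk_after.simps jump_def jump_size_eq pair_pmf_def map_pmf_def
    apply (simp add: bind_assoc_pmf bind_return_pmf)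
    apply (subst bind_commute_pmf)
    apply (intro bind_pmf_cong refl)
    apply (subst bind_commute_pmf)
    apply (intro bind_pmf_cong refl)
    done
  then have "pmf (coord_after w k (Suc m)) x =
      (\<Sum>i\<in>{1..k}. step_mean w (\<lambda>d. pmf (map_pmf (\<lambda>y. y + (if 1 = i then d else 0)) ?C) x)) / k"
    using assms by (simp add: pmf_bind_pmf_of_set step_mean_def)
  also have "(\<Sum>i\<in>{1..k}. step_mean w (\<lambda>d. pmf (map_pmf (\<lambda>y. y + (if 1 = i then d else 0)) ?C) x))
    = (\<Sum>i\<in>{1..k}. if i = 1 then step_mean w (\<lambda>d. pmf ?C (x - d)) else pmf ?C x)"
  proof (intro sum.cong refl, goal_cases)
    case (1 i)
    have "pmf (map_pmf (\<lambda>y. y + d) ?C) x = pmf ?C (x - d)" for d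
      using pmf_map_inj'[of "\<lambda>y. y + d" ?C "x - d"] by (simp add: inj_def)
    then show ?case by (auto simp: step_mean_def map_pmf_ident)
  qed
  also have "\<dots> = step_mean w (\<lambda>d. pmf ?C (x - d)) + (real k - 1) * pmf ?C x"
    using assms by (subst sum.remove[of _ 1]) (auto simp: of_nat_diff)
  finally show ?thesis using assms by (simp add: field_simps)
qed

text \<open>Normalised Lebesgue measure on an interval of length \<open>2 \<pi>\<close>. A probability measure keeps the factor
  \<open>1 / (2 \<pi>)\<close> of Fourier inversion out of the formulas.\<close>

definition circle :: "real measure" where
  "circle = density lborel (\<lambda>x. ennreal (indicator {-pi..pi} x / (2*pi)))"

lemma sets_circle [measurable_cong, simp]: "sets circle = sets borel"
  and space_circle [simp]: "space circle = UNIV"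
  by (simp_all add: circle_def)

lemma integral_circle:
  fixes f :: "real \<Rightarrow> complex"
  assumes "f \<in> borel_measurable borel"
  shows "(LINT t|circle. f t) = (LINT t:{-pi..pi}|lborel. f t) / (2*pi)"
proof -
  have "(LINT t|circle. f t) = (LINT t|lborel. (indicator {-pi..pi} t / (2*pi)) *\<^sub>R f t)"
    unfolding circle_def using assms by (subst integral_density) auto
  also have "\<dots> = (LINT t|lborel. (indicator {-pi..pi} t *\<^sub>R f t) / (2*pi))"
    by (intro Bochner_Integration.integral_cong refl) (auto simp: scaleR_conv_of_real)
  finally show ?thesis by (simp add: set_lebesgue_integral_def)
qed

interpretation circle: prob_space circle
proof
  have "emeasure circle (space circle) = (\<integral>\<^sup>+x. ennreal (1/(2*pi)) * indicator {-pi..pi} x \<partial>lborel)"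
    by (subst circle_def, subst emeasure_density)
       (auto simp: circle_def indicator_def intro!: nn_integral_cong)
  also have "\<dots> = ennreal (1/(2*pi)) * ennreal (2*pi)"
    by (subst nn_integral_cmult_indicator) auto
  also have "\<dots> = 1" by (simp add: ennreal_mult[symmetric])
  finally show "emeasure circle (space circle) = 1" .
qed

lemma integrable_circle:
  fixes f :: "real \<Rightarrow> complex"
  assumes "f \<in> borel_measurable borel" "\<And>t. norm (f t) \<le> B"
  shows "integrable circle f"
  by (rule circle.integrable_const_bound[of _ B]) (use assms in auto)

lemma circle_orthogonality:
  "(LINT t|circle. cis (- (of_int x * t))) = (if x = 0 then 1 else 0)"
proof (cases "x = 0")
  case False
  have "(LINT t:{-pi..pi}|lborel. cis (- (of_int x * t))) =
      cis (- (of_int x * pi)) * \<i> / of_int x - cis (- (of_int x * (-pi))) * \<i> / of_int x"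
    unfolding set_lebesgue_integral_def
  proof (rule integral_FTC_Icc)
    fix t :: real assume "-pi \<le> t" "t \<le> pi"
    have "((\<lambda>t. cis (- (of_int x * t)) * \<i> / of_int x) has_vector_derivative
       cis (- (of_int x * t))) (at t)"
    proof -
      let ?A = "- (\<i> * of_int x) :: complex"
      have "((\<lambda>t. exp (t *\<^sub>R ?A) * (\<i> / of_int x)) has_vector_derivative
          exp (t *\<^sub>R ?A) * ?A * (\<i> / of_int x)) (at t)"
        by (intro has_vector_derivative_mult_left exp_scaleR_has_vector_derivative_right)
      then show ?thesis
        using False by (simp add: cis_conv_exp scaleR_conv_of_real mult_ac)
    qed
    then show "((\<lambda>t. cis (- (of_int x * t)) * \<i> / of_int x) has_vector_derivative
       cis (- (of_int x * t))) (at t within {-pi..pi})"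
      by (rule has_vector_derivative_at_within)
  qed (auto intro!: continuous_intros)
  also have "cis (- (of_int x * pi)) = cis (- (of_int x * (-pi)))"
    using sin_npi_int[of x] by (auto simp: complex_eq_iff mult.commute)
  moreover have "(\<lambda>t. cis (- (of_int x * t))) \<in> borel_measurable borel"
    by (intro borel_measurable_continuous_onI continuous_intros)
  ultimately show ?thesis using False by (simp add: integral_circle)
qed (use circle.prob_space in simp)

lemma measurable_cis [measurable (raw)]:
  "f \<in> borel_measurable M \<Longrightarrow> (\<lambda>t. cis (f t)) \<in> borel_measurable M"
  by (rule measurable_compose[of f M borel cis borel])
     (auto intro!: borel_measurable_continuous_onI continuous_intros)

definition step_char :: "walk_type \<Rightarrow> real \<Rightarrow> complex" where
  "step_char w t = step_mean w (\<lambda>d. cis (of_int d * t))"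

lemma step_char_measurable [measurable]: "step_char w \<in> borel_measurable borel"
  unfolding step_char_def step_mean_def
  by (intro borel_measurable_continuous_onI continuous_intros) auto

lemma norm_step_mean_le:
  assumes "\<And>d. d \<in> steps w \<Longrightarrow> norm (f d) \<le> B"
  shows "norm (step_mean w f) \<le> B"
proof -
  have "norm (\<Sum>d\<in>steps w. f d) \<le> (\<Sum>d\<in>steps w. B)"
    by (rule sum_norm_le) (use assms in auto)
  then show ?thesis by (simp add: step_mean_def norm_divide field_simps)
qed

lemma norm_step_char_le: "norm (step_char w t) \<le> 1"
  unfolding step_char_def by (rule norm_step_mean_le) simp

lemma norm_lazy_char_le:
  assumes "k \<ge> 1"
  shows "norm (1 - 1 / of_nat k + step_char w t / of_nat k) \<le> 1"
proof -
  have "norm (1 - 1 / of_nat k + step_char w t / of_nat k) \<le>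
      norm (of_real (1 - 1 / real k) :: complex) + norm (step_char w t / of_nat k)"
    by (rule order_trans[OF _ norm_triangle_ineq]) simp
  also have "\<dots> \<le> (1 - 1 / real k) + 1 / real k"
    unfolding norm_of_real using assms norm_step_char_le[of w t]
    by (intro add_mono) (auto simp: norm_divide divide_right_mono)
  finally show ?thesis by simp
qed

text \<open>Inversion is obtained by induction on the number of jumps: a jump multiplies the integrand by the
  characteristic function of the step, so no sum over the integers has to be exchanged with the integral.\<close>

lemma coord_after_fourier:
  assumes "k \<ge> 1"
  shows "of_real (pmf (coord_after w k m) x) =
    (LINT t|circle. cis (- (of_int x * t)) * (1 - 1 / of_nat k + step_char w t / of_nat k) ^ m)"
proof (induction m arbitrary: x)
  case 0
  then show ?case by (simp add: pmf_coord_after_0 circle_orthogonality)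
next
  case (Suc m)
  let ?c = "\<lambda>t. 1 - 1 / of_nat k + step_char w t / of_nat k :: complex"
  have int: "integrable circle (\<lambda>t. cis (- (of_int x * t)) * ?c t ^ m)" for x :: int
    by (rule integrable_circle[of _ 1], measurable)
       (use norm_lazy_char_le[OF assms] in \<open>auto simp: norm_mult norm_power power_le_one\<close>)
  have "(LINT t|circle. cis (- (of_int x * t)) * ?c t ^ Suc m) =
    (LINT t|circle. (1 - 1 / of_nat k) * (cis (- (of_int x * t)) * ?c t ^ m) +
      (\<Sum>d\<in>steps w. cis (- (of_int (x - d) * t)) * ?c t ^ m) / (of_nat (card (steps w)) * of_nat k))"
  proof (intro Bochner_Integration.integral_cong refl)
    fix t
    have "cis (- (of_int (x - d) * t)) = cis (of_int d * t) * cis (- (of_int x * t))" for d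
      by (simp add: cis_mult algebra_simps)
    then have "(\<Sum>d\<in>steps w. cis (- (of_int (x - d) * t)) * ?c t ^ m) =
        (\<Sum>d\<in>steps w. cis (of_int d * t)) * (cis (- (of_int x * t)) * ?c t ^ m)"
      by (simp add: sum_distrib_right mult.assoc)
    also have "(\<Sum>d\<in>steps w. cis (of_int d * t)) = step_char w t * of_nat (card (steps w))"
      by (simp add: step_char_def step_mean_def)
    finally show "cis (- (of_int x * t)) * ?c t ^ Suc m =
      (1 - 1 / of_nat k) * (cis (- (of_int x * t)) * ?c t ^ m) +
      (\<Sum>d\<in>steps w. cis (- (of_int (x - d) * t)) * ?c t ^ m) / (of_nat (card (steps w)) * of_nat k)"
      by (simp add: algebra_simps)
  qed
  also have "\<dots> = (1 - 1 / of_nat k) * (LINT t|circle. (cis (- (of_int x * t)) * ?c t ^ m)) +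
      (\<Sum>d\<in>steps w. (LINT t|circle. cis (- (of_int (x - d) * t)) * ?c t ^ m)) / (of_nat (card (steps w)) * of_nat k)"
    using int by (subst Bochner_Integration.integral_add) (auto simp del: of_int_diff)
  also have "\<dots> = of_real (pmf (coord_after w k (Suc m)) x)"
    unfolding Suc[symmetric] pmf_coord_after_Suc[OF assms] step_mean_def by simp
  finally show ?case ..
qed

lemma pmf_jump_count:
  assumes "t \<ge> 0"
  shows "pmf (jump_count t) m = exp (-t) * t ^ m / fact m"
  using assms by (auto simp: jump_count_def pmf_poisson indicator_def)

lemma sums_jump_count:
  fixes a :: "nat \<Rightarrow> real"
  assumes "t \<ge> 0" "integrable (measure_pmf (jump_count t)) a"
  shows "(\<lambda>m. exp (-t) * t ^ m / fact m * a m) sums measure_pmf.expectation (jump_count t) a"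
proof -
  have "integrable (count_space UNIV) (\<lambda>m. pmf (jump_count t) m *\<^sub>R a m)"
    using assms by (simp add: measure_pmf_eq_density integrable_density)
  from sums_integral_count_space_nat[OF this] show ?thesis
    using assms by (simp add: measure_pmf_eq_density integral_density pmf_jump_count)
qed

lemma integrable_jump_count_bounded:
  fixes a :: "nat \<Rightarrow> real"
  assumes "\<And>m. \<bar>a m\<bar> \<le> B"
  shows "integrable (measure_pmf M) a"
  by (rule measure_pmf.integrable_const_bound[of _ B]) (use assms in auto)

lemma coord_law_sums:
  assumes "s \<ge> 0"
  shows "(\<lambda>m. exp (-(s*k)) * (s*k) ^ m / fact m * pmf (coord_after w k m) x) sums
    pmf (coord_law w k s) x"
proof -
  have "coord_law w k s = bind_pmf (jump_count (s * k)) (coord_after w k)"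
    by (simp add: coord_law_def walk_law_def map_bind_pmf coord_after_def[abs_def])
  then have "pmf (coord_law w k s) x = (LINT m|jump_count (s * k). pmf (coord_after w k m) x)"
    by (simp add: pmf_bind)
  moreover have "integrable (measure_pmf (jump_count (s * k))) (\<lambda>m. pmf (coord_after w k m) x)"
    by (rule integrable_jump_count_bounded[of _ 1]) (simp add: pmf_le_1)
  ultimately show ?thesis using sums_jump_count[of "s*k"] assms by auto
qed

lemma exp_sums_complex: "(\<lambda>m. z ^ m / fact m) sums exp (z::complex)"
  using exp_converges[of z] by (simp add: scaleR_conv_of_real divide_inverse mult.commute)

text \<open>The Poisson number of jumps turns the power of the lazy characteristic function into an exponential, in
  which the laziness \<open>1 - 1 / k\<close> and the rate \<open>k\<close> cancel.\<close>

lemma coord_law_fourier: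
  assumes "k \<ge> 1" "s \<ge> 0"
  shows "of_real (pmf (coord_law w k s) x) =
    (LINT t|circle. cis (- (of_int x * t)) * exp (of_real s * (step_char w t - 1)))"
proof -
  let ?c = "\<lambda>t. 1 - 1 / of_nat k + step_char w t / of_nat k :: complex"
  define \<tau> where "\<tau> = s * k"
  have \<tau>: "\<tau> \<ge> 0" using assms by (simp add: \<tau>_def)
  let ?f = "\<lambda>m t. of_real (exp (-\<tau>) * \<tau> ^ m / fact m) * (cis (- (of_int x * t)) * ?c t ^ m)"
  have bd: "norm (?f m t) \<le> exp (-\<tau>) * \<tau> ^ m / fact m" for m t
  proof -
    have "norm (?f m t) = exp (-\<tau>) * \<tau> ^ m / fact m * norm (?c t) ^ m"
      using \<tau> by (simp add: norm_mult norm_power norm_divide)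
    also have "\<dots> \<le> exp (-\<tau>) * \<tau> ^ m / fact m"
      using \<tau> norm_lazy_char_le[OF assms(1), of w t]
      by (intro mult_right_le_one_le) (auto simp: power_le_one)
    finally show ?thesis .
  qed
  have sm: "summable (\<lambda>m. exp (-\<tau>) * \<tau> ^ m / fact m)"
    using summable_mult[OF summable_exp[of \<tau>], of "exp (-\<tau>)"] by (simp add: field_simps)
  have int: "integrable circle (?f m)" for m
    by (rule integrable_circle[of _ "exp (-\<tau>) * \<tau> ^ m / fact m"]) (use bd in auto)
  have "(\<lambda>m. LINT t|circle. ?f m t) sums (LINT t|circle. (\<Sum>m. ?f m t))"
  proof (rule sums_integral[OF int])
    show "AE t in circle. summable (\<lambda>m. norm (?f m t))"
      by (intro always_eventually allI summable_comparison_test'[OF sm]) (use bd in auto)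
    show "summable (\<lambda>m. LINT t|circle. norm (?f m t))"
    proof (rule summable_comparison_test'[OF sm])
      fix m
      have "(LINT t|circle. norm (?f m t)) \<le> (LINT t|circle. exp (-\<tau>) * \<tau> ^ m / fact m)"
        by (intro integral_mono) (use bd int in auto)
      then show "norm (LINT t|circle. norm (?f m t)) \<le> exp (-\<tau>) * \<tau> ^ m / fact m"
        using circle.prob_space by (simp add: integral_nonneg_AE)
    qed
  qed
  moreover have "(LINT t|circle. ?f m t) = of_real (exp (-\<tau>) * \<tau> ^ m / fact m * pmf (coord_after w k m) x)" for m
    using coord_after_fourier[OF assms(1), of w m x] by simp
  moreover have "(\<lambda>m. of_real (exp (-\<tau>) * \<tau> ^ m / fact m * pmf (coord_after w k m) x)) sums
      (of_real (pmf (coord_law w k s) x) :: complex)"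
    using coord_law_sums[OF assms(2), of k w x] unfolding \<tau>_def[symmetric] by (rule sums_of_real)
  ultimately have "of_real (pmf (coord_law w k s) x) = (LINT t|circle. (\<Sum>m. ?f m t))"
    by (metis (no_types, lifting) sums_unique2 sums_cong)
  also have "\<dots> = (LINT t|circle. cis (- (of_int x * t)) * exp (of_real s * (step_char w t - 1)))"
  proof (intro Bochner_Integration.integral_cong refl)
    fix t
    have "(\<lambda>m. of_real (exp (-\<tau>)) * cis (- (of_int x * t)) * ((of_real \<tau> * ?c t) ^ m / fact m)) sums
      (of_real (exp (-\<tau>)) * cis (- (of_int x * t)) * exp (of_real \<tau> * ?c t))"
      by (intro sums_mult exp_sums_complex)
    moreover have "of_real (exp (-\<tau>)) * cis (- (of_int x * t)) * ((of_real \<tau> * ?c t) ^ m / fact m) = ?f m t" for m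
      by (simp only: power_mult_distrib of_real_mult of_real_divide of_real_power of_real_fact
            times_divide_eq_left times_divide_eq_right mult_ac)
    ultimately have "(\<lambda>m. ?f m t) sums (of_real (exp (-\<tau>)) * cis (- (of_int x * t)) * exp (of_real \<tau> * ?c t))"
      by (simp only:)
    then have "(\<Sum>m. ?f m t) = of_real (exp (-\<tau>)) * cis (- (of_int x * t)) * exp (of_real \<tau> * ?c t)"
      by (rule sums_unique[symmetric])
    also have "\<dots> = cis (- (of_int x * t)) * exp (of_real \<tau> * ?c t - of_real \<tau>)"
      by (simp only: exp_diff exp_of_real exp_minus of_real_inverse divide_inverse mult_ac)
    also have "of_real \<tau> * ?c t - of_real \<tau> = of_real s * (step_char w t - 1)"
      using assms by (simp add: \<tau>_def field_simps)
    finally show "(\<Sum>m. ?f m t) = cis (- (of_int x * t)) * exp (of_real s * (step_char w t - 1))" .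
  qed
  finally show ?thesis .
qed

text \<open>The right-hand side of \<open>coord_law_fourier\<close> does not mention \<open>k\<close>. From here on, the law with \<open>k = 1\<close> stands
  for every dimension.\<close>

lemma coord_law_indep:
  assumes "k \<ge> 1" "s \<ge> 0"
  shows "coord_law w k s = coord_law w 1 s"
proof (rule pmf_eqI)
  fix x
  have "complex_of_real (pmf (coord_law w k s) x) = of_real (pmf (coord_law w 1 s) x)"
    using coord_law_fourier[OF assms] coord_law_fourier[of 1 s] assms by simp
  then show "pmf (coord_law w k s) x = pmf (coord_law w 1 s) x"
    using of_real_eq_iff by blast
qed

definition heat :: "walk_type \<Rightarrow> real \<Rightarrow> int \<Rightarrow> real" where
  "heat w s x = pmf (coord_law w 1 s) x"

section \<open>The heat kernel on the integers\<close>

definition chain_pmf :: "walk_type \<Rightarrow> nat \<Rightarrow> int \<Rightarrow> real" where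
  "chain_pmf w m x = pmf (coord_after w 1 m) x"

lemma chain_pmf_nonneg [simp]: "chain_pmf w m x \<ge> 0" and chain_pmf_le_1 [simp]: "chain_pmf w m x \<le> 1"
  by (simp_all add: chain_pmf_def pmf_le_1)

lemma chain_pmf_0: "chain_pmf w 0 x = (if x = 0 then 1 else 0)"
  by (simp add: chain_pmf_def pmf_coord_after_0)

lemma heat_nonneg [simp]: "heat w s x \<ge> 0" and heat_le_1 [simp]: "heat w s x \<le> 1"
  by (simp_all add: heat_def pmf_le_1)

lemma chain_pmf_Suc: "chain_pmf w (Suc m) x = step_mean w (\<lambda>d. chain_pmf w m (x - d))"
  unfolding chain_pmf_def by (subst pmf_coord_after_Suc) simp_all

lemma heat_sums:
  assumes "s \<ge> 0"
  shows "(\<lambda>m. exp (-s) * s ^ m / fact m * chain_pmf w m x) sums heat w s x"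
  using coord_law_sums[OF assms, of 1 w x] by (simp add: heat_def chain_pmf_def)

lemma abs_steps: "d \<in> steps w \<Longrightarrow> \<bar>d\<bar> = 1"
  by (cases w) (auto simp: steps_def)

lemma chain_pmf_eq_0: "int m < \<bar>x\<bar> \<Longrightarrow> chain_pmf w m x = 0"
proof (induction m arbitrary: x)
  case (Suc m)
  have "chain_pmf w m (x - d) = 0" if "d \<in> steps w" for d
    using Suc.prems abs_steps[OF that] by (intro Suc.IH) auto
  then show ?case unfolding chain_pmf_Suc by (simp add: step_mean_def)
qed (auto simp: chain_pmf_0)

text \<open>A Chernoff bound: in \<open>m\<close> jumps the chain moves by at most \<open>m\<close>, so the weight \<open>b ^ \<bar>x\<bar>\<close> is at most \<open>b ^ m\<close>.
  A fixed \<open>b\<close> gives summability that is uniform on bounded time intervals, and \<open>b = 1 / s\<close> gives the tails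
  for small times.\<close>

lemma heat_le:
  assumes "s \<ge> 0" "b \<ge> 1"
  shows "heat w s x \<le> exp (s * (b - 1)) / b ^ nat \<bar>x\<bar>"
proof -
  have "heat w s x * b ^ nat \<bar>x\<bar> \<le> exp (-s) * exp (s * b)"
  proof (rule sums_le)
    show "(\<lambda>m. exp (-s) * s ^ m / fact m * chain_pmf w m x * b ^ nat \<bar>x\<bar>) sums (heat w s x * b ^ nat \<bar>x\<bar>)"
      by (intro sums_mult2 heat_sums assms)
    show "(\<lambda>m. exp (-s) * ((s * b) ^ m / fact m)) sums (exp (-s) * exp (s * b))"
      using exp_converges[of "s * b"] by (intro sums_mult) (simp add: field_simps)
    fix m
    have "chain_pmf w m x * b ^ nat \<bar>x\<bar> \<le> b ^ m"
    proof (cases "int m < \<bar>x\<bar>")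
      case False
      then have "b ^ nat \<bar>x\<bar> \<le> b ^ m" using assms by (intro power_increasing) auto
      then have "chain_pmf w m x * b ^ nat \<bar>x\<bar> \<le> 1 * b ^ m"
        using assms by (intro mult_mono) (auto simp: pmf_le_1)
      then show ?thesis by simp
    qed (use assms in \<open>simp add: chain_pmf_eq_0\<close>)
    then have "exp (-s) * s ^ m / fact m * (chain_pmf w m x * b ^ nat \<bar>x\<bar>) \<le> exp (-s) * s ^ m / fact m * b ^ m"
      using assms by (intro mult_left_mono) auto
    then show "exp (-s) * s ^ m / fact m * chain_pmf w m x * b ^ nat \<bar>x\<bar> \<le> exp (-s) * ((s * b) ^ m / fact m)"
      by (simp add: power_mult_distrib mult_ac)
  qed
  moreover have "exp (-s) * exp (s * b) = exp (s * (b - 1))"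
    by (simp add: exp_add[symmetric] algebra_simps)
  ultimately show ?thesis using assms by (simp add: field_simps)
qed

text \<open>The points with positive mass at positive times.\<close>

definition reachable :: "walk_type \<Rightarrow> int \<Rightarrow> bool" where
  "reachable w x \<longleftrightarrow> w = Simple \<or> x \<ge> 0"

lemma heat_unreachable:
  assumes "\<not> reachable w x" "s \<ge> 0"
  shows "heat w s x = 0"
proof -
  have w: "w = Directed" using assms by (cases w) (auto simp: reachable_def)
  have "chain_pmf w m x = 0" if "x < 0" for m x using that unfolding w
    by (induction m arbitrary: x) (auto simp: chain_pmf_0 chain_pmf_Suc step_mean_def steps_def)
  then have "(\<lambda>m. exp (-s) * s ^ m / fact m * chain_pmf w m x) = (\<lambda>_. 0)"
    using assms by (auto simp: reachable_def)
  with heat_sums[OF assms(2), of w x] show ?thesis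
    by (metis sums_unique sums_zero sums_unique2)
qed

lemma chain_pmf_lower:
  assumes "reachable w x" "nat \<bar>x\<bar> = n"
  shows "chain_pmf w n x \<ge> (1/2) ^ n"
  using assms
proof (induction n arbitrary: x)
  case (Suc n)
  define e where "e = sgn x"
  have e: "e \<in> steps w" "reachable w (x - e)" "nat \<bar>x - e\<bar> = n"
    using Suc.prems unfolding e_def
    by (cases w; auto simp: steps_def reachable_def sgn_if split: if_splits; fail)+
  have "(1/2) ^ n \<le> chain_pmf w n (x - e)" using Suc.IH e by simp
  also have "\<dots> \<le> (\<Sum>d\<in>steps w. chain_pmf w n (x - d))"
    using e by (intro member_le_sum) auto
  also have "\<dots> \<le> 2 * chain_pmf w (Suc n) x"
  proof -
    have "card (steps w) \<le> 2" by (cases w) (auto simp: steps_def)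
    moreover have "(\<Sum>d\<in>steps w. chain_pmf w n (x - d)) = real (card (steps w)) * chain_pmf w (Suc n) x"
      unfolding chain_pmf_Suc step_mean_def by simp
    ultimately show ?thesis by (auto intro!: mult_right_mono)
  qed
  finally show ?case by simp
qed (auto simp: chain_pmf_0)

text \<open>Only the paths that go straight to \<open>x\<close> are counted. This is enough to make \<open>ln (heat w s x)\<close> grow at most
  quadratically in \<open>x\<close>.\<close>

lemma heat_lower:
  assumes "reachable w x" "s \<ge> 0" "n = nat \<bar>x\<bar>"
  shows "heat w s x \<ge> exp (-s) * (s / 2) ^ n / fact n"
proof -
  have "exp (-s) * s ^ n / fact n * chain_pmf w n x \<le> heat w s x"
    using sums_le[OF _ sums_single heat_sums[OF assms(2)], of n "\<lambda>m. exp (-s) * s ^ m / fact m * chain_pmf w m x" w x]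
      assms by auto
  moreover have "exp (-s) * s ^ n / fact n * (1/2) ^ n \<le> exp (-s) * s ^ n / fact n * chain_pmf w n x"
    using chain_pmf_lower[OF assms(1)] assms by (intro mult_left_mono) auto
  ultimately show ?thesis by (simp add: power_divide mult_ac)
qed

lemma heat_pos: "reachable w x \<Longrightarrow> s > 0 \<Longrightarrow> heat w s x > 0"
  using heat_lower[of w x s "nat \<bar>x\<bar>"] by (smt (verit, ccfv_SIG) exp_gt_zero fact_gt_zero half_gt_zero_iff mult_pos_pos divide_pos_pos zero_less_power)

text \<open>The right-hand side of the Kolmogorov forward equation.\<close>

definition heat' :: "walk_type \<Rightarrow> real \<Rightarrow> int \<Rightarrow> real" where
  "heat' w s x = step_mean w (\<lambda>d. heat w s (x - d)) - heat w s x"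

lemma heat_deriv_aux:
  obtains F where "\<And>s. s \<ge> 0 \<Longrightarrow> heat w s x = exp (-s) * F s"
    "\<And>s. s \<ge> 0 \<Longrightarrow> (F has_real_derivative (exp s * step_mean w (\<lambda>d. heat w s (x - d)))) (at s)"
proof -
  define c where "c = (\<lambda>m. chain_pmf w m x / fact m)"
  define F where "F = (\<lambda>s. \<Sum>m. c m * s ^ m)"
  have sm: "summable (\<lambda>m. c m * s ^ m)" for s
  proof (rule summable_comparison_test'[OF summable_exp[of "\<bar>s\<bar>"]])
    fix m
    have "\<bar>chain_pmf w m x\<bar> * (\<bar>s\<bar> ^ m / fact m) \<le> 1 * (\<bar>s\<bar> ^ m / fact m)"
      by (intro mult_right_mono) (auto simp: pmf_le_1)
    then show "norm (c m * s ^ m) \<le> inverse (fact m) * \<bar>s\<bar> ^ m"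
      by (simp add: c_def abs_mult power_abs field_simps)
  qed
  have "(F has_real_derivative (\<Sum>m. diffs c m * s ^ m)) (at s)" for s
    unfolding F_def by (rule termdiffs_strong_converges_everywhere[OF sm])
  moreover have "(\<Sum>m. diffs c m * s ^ m) = exp s * step_mean w (\<lambda>d. heat w s (x - d))" if "s \<ge> 0" for s
  proof -
    have "(\<lambda>m. exp s * ((\<Sum>d\<in>steps w. exp (-s) * s ^ m / fact m * chain_pmf w m (x - d)) / card (steps w)))
       sums (exp s * step_mean w (\<lambda>d. heat w s (x - d)))"
      unfolding step_mean_def by (intro sums_mult sums_divide sums_sum heat_sums that)
    moreover have "exp s * ((\<Sum>d\<in>steps w. exp (-s) * s ^ m / fact m * chain_pmf w m (x - d)) / card (steps w)) = diffs c m * s ^ m" for m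
    proof -
      have "(\<Sum>d\<in>steps w. exp (-s) * s ^ m / fact m * chain_pmf w m (x - d)) / card (steps w)
         = exp (-s) * s ^ m / fact m * chain_pmf w (Suc m) x"
        unfolding chain_pmf_Suc step_mean_def by (simp add: sum_distrib_left)
      moreover have "diffs c m = chain_pmf w (Suc m) x / fact m"
        by (simp add: diffs_def c_def divide_simps del: of_nat_Suc)
      moreover have "exp s * (exp (-s) * y) = y" for y
        by (simp add: mult.assoc[symmetric] exp_minus)
      ultimately show ?thesis by (simp add: mult.assoc)
    qed
    ultimately show ?thesis by (simp add: sums_iff)
  qed
  moreover have "heat w s x = exp (-s) * F s" if "s \<ge> 0" for s
  proof -
    have "(\<lambda>m. exp (-s) * (c m * s ^ m)) sums (exp (-s) * F s)"
      unfolding F_def by (intro sums_mult summable_sums sm)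
    with heat_sums[OF that, of w x] show ?thesis
      by (simp add: c_def mult_ac sums_iff)
  qed
  ultimately show ?thesis using that by metis
qed

lemma heat_has_derivative:
  assumes "s > 0"
  shows "((\<lambda>s. heat w s x) has_real_derivative heat' w s x) (at s)"
proof -
  obtain F where F: "\<And>s. s \<ge> 0 \<Longrightarrow> heat w s x = exp (-s) * F s"
    "\<And>s. s \<ge> 0 \<Longrightarrow> (F has_real_derivative (exp s * step_mean w (\<lambda>d. heat w s (x - d)))) (at s)"
    using heat_deriv_aux[of w x] by metis
  let ?m = "step_mean w (\<lambda>d. heat w s (x - d))"
  have s0: "s \<ge> 0" using assms by simp
  have "((\<lambda>s. exp (-s)) has_real_derivative - exp (-s)) (at s)"
    by (auto intro!: derivative_eq_intros)
  from DERIV_mult[OF this F(2)[OF s0]]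
  have "((\<lambda>s. exp (-s) * F s) has_real_derivative (- exp (-s) * F s + exp s * ?m * exp (-s))) (at s)" .
  also have "- exp (-s) * F s + exp s * ?m * exp (-s) = heat' w s x"
  proof -
    have "exp s * ?m * exp (-s) = ?m" by (simp add: exp_minus)
    then show ?thesis unfolding heat'_def F(1)[OF s0, symmetric] using F(1)[OF s0] by simp
  qed
  finally have 1: "((\<lambda>s. exp (-s) * F s) has_real_derivative heat' w s x) (at s)" .
  show ?thesis
  proof (rule has_field_derivative_transform_within_open[OF 1, of "{0<..}"])
    show "exp (-t) * F t = heat w t x" if "t \<in> {0<..}" for t
      using F(1)[of t] that by simp
  qed (use assms in auto)
qed

lemma continuous_on_heat: "continuous_on {0..} (\<lambda>s. heat w s x)"
proof -
  obtain F where F: "\<And>s. s \<ge> 0 \<Longrightarrow> heat w s x = exp (-s) * F s"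
    "\<And>s. s \<ge> 0 \<Longrightarrow> (F has_real_derivative (exp s * step_mean w (\<lambda>d. heat w s (x - d)))) (at s)"
    using heat_deriv_aux[of w x] by metis
  have "continuous_on {0..} (\<lambda>s. exp (-s) * F s)"
    by (intro continuous_intros continuous_at_imp_continuous_on) (use F(2) DERIV_isCont in auto)
  then show ?thesis using F(1) by (subst continuous_on_cong[OF refl, of _ _ "\<lambda>s. exp (-s) * F s"]) auto
qed

lemma heat_0: "heat w 0 x = (if x = 0 then 1 else 0)"
  using heat_sums[of 0 w x] powser_sums_zero_iff[of "\<lambda>m. chain_pmf w m x / fact m"]
  by (simp add: chain_pmf_0 mult.commute)

section \<open>Entropy as a differentiable function of time\<close>

definition entropy :: "walk_type \<Rightarrow> real \<Rightarrow> real" where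
  "entropy w s = measure_pmf.expectation (coord_law w 1 s) (\<lambda>x. - ln (heat w s x))"

definition sq_info :: "walk_type \<Rightarrow> real \<Rightarrow> real" where
  "sq_info w s = measure_pmf.expectation (coord_law w 1 s) (\<lambda>x. (ln (heat w s x))\<^sup>2)"

lemma expectation_suminf:
  fixes f :: "int \<Rightarrow> real"
  assumes "summable (\<lambda>n. \<bar>heat w s (int_decode n) * f (int_decode n)\<bar>)"
  shows "integrable (measure_pmf (coord_law w 1 s)) f"
    "measure_pmf.expectation (coord_law w 1 s) f = (\<Sum>n. heat w s (int_decode n) * f (int_decode n))"
proof -
  have 1: "integrable (count_space UNIV) (\<lambda>n. heat w s (int_decode n) * f (int_decode n))"
    using assms by (simp add: integrable_count_space_nat_iff)
  then have 2: "integrable (count_space UNIV) (\<lambda>x. heat w s x *\<^sub>R f x)"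
    using integrable_bij_count_space[OF bij_int_decode, of "\<lambda>x. heat w s x *\<^sub>R f x"] by simp
  then show "integrable (measure_pmf (coord_law w 1 s)) f"
    unfolding measure_pmf_eq_density by (subst integrable_density) (auto simp: heat_def)
  have "measure_pmf.expectation (coord_law w 1 s) f = (LINT x|count_space UNIV. heat w s x *\<^sub>R f x)"
    unfolding measure_pmf_eq_density by (subst integral_density) (auto simp: heat_def)
  also have "\<dots> = (LINT n|count_space UNIV. heat w s (int_decode n) * f (int_decode n))"
    using integral_bij_count_space[OF bij_int_decode, of "\<lambda>x. heat w s x *\<^sub>R f x"] by simp
  also have "\<dots> = (\<Sum>n. heat w s (int_decode n) * f (int_decode n))"
    using 1 by (rule integral_count_space_nat)
  finally show "measure_pmf.expectation (coord_law w 1 s) f = (\<Sum>n. heat w s (int_decode n) * f (int_decode n))" .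
qed

lemma summable_half_power_int: "summable (\<lambda>n. (1/2::real) ^ nat \<bar>int_decode n\<bar>)"
proof -
  obtain r :: real where r: "r\<^sup>2 = 1/2" "1/2 \<le> r" "r < 1"
  proof
    show "(sqrt (1/2))\<^sup>2 = 1/2" by simp
    show "1/2 \<le> sqrt (1/2)" by (rule real_le_rsqrt) (simp add: power2_eq_square)
    show "sqrt (1/2) < 1" by simp
  qed
  have le: "(1/2::real) ^ nat \<bar>int_decode n\<bar> \<le> 2 * r ^ n" for n
  proof -
    have n: "n \<le> 2 * nat \<bar>int_decode n\<bar> + 1"
      by (auto simp: int_decode_def sum_decode_def)
    have "(1/2::real) ^ nat \<bar>int_decode n\<bar> * (1/2) \<le> (1/2) ^ nat \<bar>int_decode n\<bar> * r"
      using r(2) by (intro mult_left_mono) auto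
    also have "\<dots> = r ^ (2 * nat \<bar>int_decode n\<bar> + 1)"
      by (simp add: power_mult r(1))
    also have "\<dots> \<le> r ^ n"
      using n r by (intro power_decreasing) auto
    finally show ?thesis by simp
  qed
  have "summable (\<lambda>n. 2 * r ^ n)"
    using r by (intro summable_mult summable_geometric) auto
  then show ?thesis
    by (rule summable_comparison_test') (use le in simp)
qed

text \<open>The entropy terms are dominated by the square root of the mass. The heat kernel decays exponentially, so its
  square root is still summable.\<close>

lemma u_ln_le_sqrt:
  fixes u :: real
  assumes "0 \<le> u" "u \<le> 1"
  shows "u * (ln u)\<^sup>2 \<le> 16 * sqrt u" "u * \<bar>ln u\<bar> \<le> 17 * sqrt u"
proof -
  have 1: "u * (ln u)\<^sup>2 \<le> 16 * sqrt u"
  proof (cases "u = 0")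
    case False
    then have u: "u > 0" using assms by simp
    define v where "v = sqrt (sqrt u)"
    have v1: "v > 0" "v \<le> 1" "v\<^sup>2 = sqrt u"
      using u assms by (auto simp: v_def)
    have "v ^ 4 = (v\<^sup>2)\<^sup>2" by (simp flip: power_mult)
    then have v: "v > 0" "v \<le> 1" "u = v ^ 4" "sqrt u = v\<^sup>2"
      using v1 u by auto
    have "ln (1 / v) \<le> 1 / v - 1" using v by (intro ln_le_minus_one) auto
    then have "- ln v \<le> 1 / v" using v by (simp add: ln_div)
    moreover have "ln v \<le> 0" using v by simp
    ultimately have "(ln v)\<^sup>2 \<le> (1 / v)\<^sup>2"
      by (metis abs_le_square_iff abs_of_nonpos abs_of_pos divide_pos_pos v(1) zero_less_one)
    then have "u * (ln v)\<^sup>2 \<le> v ^ 4 * (1 / v)\<^sup>2"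
      unfolding v(3) by (intro mult_left_mono) auto
    also have "\<dots> = sqrt u" unfolding v(4) using v(1) by (simp add: power2_eq_square power4_eq_xxxx)
    finally show ?thesis using v(1) by (simp add: v(3) ln_realpow power_mult_distrib)
  qed simp
  have "\<bar>ln u\<bar> \<le> 1 + (ln u)\<^sup>2"
    using zero_le_power2[of "\<bar>ln u\<bar> - 1"] zero_le_power2[of "ln u"] by (simp add: power2_diff)
  then have "u * \<bar>ln u\<bar> \<le> u * (1 + (ln u)\<^sup>2)" using assms by (intro mult_left_mono) auto
  moreover have "u \<le> sqrt u" using assms by (simp add: real_le_rsqrt power2_eq_square mult_left_le)
  ultimately show "u * \<bar>ln u\<bar> \<le> 17 * sqrt u" using 1 by (simp add: algebra_simps)
  show "u * (ln u)\<^sup>2 \<le> 16 * sqrt u" by fact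
qed

lemma sqrt_heat_le:
  assumes "0 \<le> s" "s \<le> B"
  shows "sqrt (heat w s x) \<le> exp (2 * B) * (1/2) ^ nat \<bar>x\<bar>"
proof -
  have "heat w s x \<le> exp (s * 3) / 4 ^ nat \<bar>x\<bar>" using heat_le[of s 4 w x] assms by simp
  also have "\<dots> \<le> exp (4 * B) / 4 ^ nat \<bar>x\<bar>" using assms by (intro divide_right_mono) auto
  also have "\<dots> = (exp (2 * B) * (1/2) ^ nat \<bar>x\<bar>)\<^sup>2"
    by (simp add: power_mult_distrib power_divide exp_double[symmetric] power2_eq_square
       exp_add[symmetric] flip: power_mult_distrib)
  finally show ?thesis by (intro real_le_lsqrt) auto
qed

lemma continuous_on_u_ln:
  "continuous_on {0..1} (\<lambda>u::real. u * ln u)" "continuous_on {0..1} (\<lambda>u::real. u * (ln u)\<^sup>2)"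
proof -
  have *: "continuous_on {0..1} f" if "\<And>u. u > 0 \<Longrightarrow> isCont f u" "f 0 = 0" "\<And>u. 0 \<le> u \<Longrightarrow> u \<le> 1 \<Longrightarrow> \<bar>f u\<bar> \<le> 17 * sqrt u"
    for f :: "real \<Rightarrow> real"
    unfolding continuous_on_eq_continuous_within
  proof
    fix u :: real assume u: "u \<in> {0..1}"
    show "continuous (at u within {0..1}) f"
    proof (cases "u = 0")
      case True
      have "(f \<longlongrightarrow> 0) (at 0 within {0..1})"
      proof (rule Lim_null_comparison)
        show "\<forall>\<^sub>F x in at 0 within {0..1}. norm (f x) \<le> 17 * sqrt x"
          using that(3) by (auto simp: eventually_at_filter)
        have "((\<lambda>x. 17 * sqrt x) \<longlongrightarrow> 17 * sqrt 0) (at 0 within {0..1})" by (intro tendsto_intros)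
        then show "((\<lambda>x. 17 * sqrt x) \<longlongrightarrow> 0) (at 0 within {0..1})" by simp
      qed
      then show ?thesis using True that(2) by (simp add: continuous_within)
    qed (use u that(1) in \<open>auto intro: continuous_at_imp_continuous_within\<close>)
  qed
  show "continuous_on {0..1} (\<lambda>u::real. u * ln u)"
    by (rule *) (use u_ln_le_sqrt(2) in \<open>auto simp: abs_mult intro!: continuous_intros\<close>)
  have "u * (ln u)\<^sup>2 \<le> 17 * sqrt u" if "0 \<le> u" "u \<le> 1" for u :: real
    using u_ln_le_sqrt(1)[OF that] that by (smt (verit) real_sqrt_ge_zero)
  then show "continuous_on {0..1} (\<lambda>u::real. u * (ln u)\<^sup>2)"
    by (intro *) (auto simp: abs_mult intro!: continuous_intros)
qed

text \<open>The Weierstrass test for the series that define the entropy (\<open>g = - ln\<close>) and its second moment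
  (\<open>g = ln\<^sup>2\<close>), summed along the enumeration \<open>int_decode\<close> of the integers.\<close>

lemma heat_series:
  fixes g :: "real \<Rightarrow> real"
  assumes g: "\<And>u. 0 \<le> u \<Longrightarrow> u \<le> 1 \<Longrightarrow> \<bar>u * g u\<bar> \<le> 17 * sqrt u"
  shows summable_heat: "s \<ge> 0 \<Longrightarrow> summable (\<lambda>n. \<bar>heat w s (int_decode n) * g (heat w s (int_decode n))\<bar>)"
    and continuous_on_heat_series: "continuous_on {0..1} (\<lambda>u. u * g u) \<Longrightarrow>
      continuous_on {0..} (\<lambda>s. \<Sum>n. heat w s (int_decode n) * g (heat w s (int_decode n)))"
proof -
  let ?M = "\<lambda>B n. 17 * exp (2 * B) * (1/2::real) ^ nat \<bar>int_decode n\<bar>"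
  let ?t = "\<lambda>n s. heat w s (int_decode n) * g (heat w s (int_decode n))"
  have bd: "\<bar>?t n s\<bar> \<le> ?M B n" if "0 \<le> s" "s \<le> B" for n s B
    using g[of "heat w s (int_decode n)"] sqrt_heat_le[OF that, of w "int_decode n"] by simp
  have sM: "summable (?M B)" for B
    by (intro summable_mult summable_half_power_int)
  show "summable (\<lambda>n. \<bar>?t n s\<bar>)" if "s \<ge> 0" for s
    by (rule summable_comparison_test'[OF sM[of s]]) (use bd[OF that order_refl] in auto)
  assume cont: "continuous_on {0..1} (\<lambda>u. u * g u)"
  have c1: "continuous_on {0..} (?t n)" for n
    by (rule continuous_on_compose2[OF cont continuous_on_heat]) auto
  have c2: "continuous_on {0..B} (\<lambda>s. \<Sum>n. ?t n s)" for B
  proof (rule uniform_limit_theorem)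
    show "uniform_limit {0..B} (\<lambda>N s. \<Sum>n<N. ?t n s) (\<lambda>s. \<Sum>n. ?t n s) sequentially"
      by (rule Weierstrass_m_test[OF _ sM[of B]]) (use bd in auto)
    show "\<forall>\<^sub>F N in sequentially. continuous_on {0..B} (\<lambda>s. \<Sum>n<N. ?t n s)"
      by (intro always_eventually allI continuous_on_sum) (rule continuous_on_subset[OF c1], auto)
  qed auto
  show "continuous_on {0..} (\<lambda>s. \<Sum>n. ?t n s)"
    unfolding continuous_on_eq_continuous_within
  proof
    fix s :: real assume s: "s \<in> {0..}"
    have "continuous (at s within {0..s+1}) (\<lambda>s. \<Sum>n. ?t n s)"
      using c2[of "s+1"] s by (auto simp: continuous_on_eq_continuous_within)
    moreover have "at s within {0..s+1} = at s within {0..}"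
      by (rule at_within_nhd[of _ "{..<s+1}"]) auto
    ultimately show "continuous (at s within {0..}) (\<lambda>s. \<Sum>n. ?t n s)"
      by (simp add: continuous_within)
  qed
qed

lemma entropy_series:
  assumes "s \<ge> 0"
  shows "integrable (measure_pmf (coord_law w 1 s)) (\<lambda>x. ln (heat w s x))"
    and "integrable (measure_pmf (coord_law w 1 s)) (\<lambda>x. (ln (heat w s x))\<^sup>2)"
    and "entropy w s = (\<Sum>n. heat w s (int_decode n) * - ln (heat w s (int_decode n)))"
    and "sq_info w s = (\<Sum>n. heat w s (int_decode n) * (ln (heat w s (int_decode n)))\<^sup>2)"
    and "summable (\<lambda>n. \<bar>heat w s (int_decode n) * - ln (heat w s (int_decode n))\<bar>)"
proof -
  have 1: "summable (\<lambda>n. \<bar>heat w s (int_decode n) * - ln (heat w s (int_decode n))\<bar>)"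
    by (rule summable_heat[of "\<lambda>u. - ln u"]) (use u_ln_le_sqrt(2) assms in \<open>auto simp: abs_mult\<close>)
  have 2: "summable (\<lambda>n. \<bar>heat w s (int_decode n) * (ln (heat w s (int_decode n)))\<^sup>2\<bar>)"
  proof (rule summable_heat[of "\<lambda>u. (ln u)\<^sup>2"])
    fix u :: real assume "0 \<le> u" "u \<le> 1"
    then show "\<bar>u * (ln u)\<^sup>2\<bar> \<le> 17 * sqrt u"
      using u_ln_le_sqrt(1)[of u] by (smt (verit) real_sqrt_ge_zero zero_le_power2 mult_nonneg_nonneg)
  qed fact
  show "summable (\<lambda>n. \<bar>heat w s (int_decode n) * - ln (heat w s (int_decode n))\<bar>)" by fact
  show "entropy w s = (\<Sum>n. heat w s (int_decode n) * - ln (heat w s (int_decode n)))"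
    unfolding entropy_def by (rule expectation_suminf(2)[OF 1])
  show "sq_info w s = (\<Sum>n. heat w s (int_decode n) * (ln (heat w s (int_decode n)))\<^sup>2)"
    unfolding sq_info_def by (rule expectation_suminf(2)[OF 2])
  show "integrable (measure_pmf (coord_law w 1 s)) (\<lambda>x. (ln (heat w s x))\<^sup>2)"
    by (rule expectation_suminf(1)[OF 2])
  show "integrable (measure_pmf (coord_law w 1 s)) (\<lambda>x. ln (heat w s x))"
    using expectation_suminf(1)[OF 1] by simp
qed

lemma continuous_on_entropy: "continuous_on {0..} (entropy w)"
proof -
  have "continuous_on {0..} (\<lambda>s. \<Sum>n. heat w s (int_decode n) * - ln (heat w s (int_decode n)))"
    by (rule continuous_on_heat_series[of "\<lambda>u. - ln u"])
       (use u_ln_le_sqrt(2) continuous_on_minus[OF continuous_on_u_ln(1)] in \<open>auto simp: abs_mult\<close>)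
  then show ?thesis by (rule continuous_on_eq) (simp add: entropy_series)
qed

lemma continuous_on_sq_info: "continuous_on {0..} (sq_info w)"
proof -
  have "continuous_on {0..} (\<lambda>s. \<Sum>n. heat w s (int_decode n) * (ln (heat w s (int_decode n)))\<^sup>2)"
  proof (rule continuous_on_heat_series[of "\<lambda>u. (ln u)\<^sup>2"])
    fix u :: real assume "0 \<le> u" "u \<le> 1"
    then show "\<bar>u * (ln u)\<^sup>2\<bar> \<le> 17 * sqrt u"
      using u_ln_le_sqrt(1)[of u] by (smt (verit) real_sqrt_ge_zero zero_le_power2 mult_nonneg_nonneg)
  qed (rule continuous_on_u_ln)
  then show ?thesis by (rule continuous_on_eq) (simp add: entropy_series)
qed

lemma entropy_0: "entropy w 0 = 0"
proof -
  have "heat w 0 x * - ln (heat w 0 x) = 0" for x by (simp add: heat_0)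
  then show ?thesis unfolding entropy_series(3)[OF order_refl] by (simp only: suminf_zero)
qed

text \<open>The derivative of the entropy series, taken term by term.\<close>

definition entropy' :: "walk_type \<Rightarrow> real \<Rightarrow> real" where
  "entropy' w s = (\<Sum>n. - heat' w s (int_decode n) * (ln (heat w s (int_decode n)) + 1))"

lemma heat'_le:
  assumes "0 \<le> s" "s \<le> B"
  shows "\<bar>heat' w s x\<bar> \<le> 5 * exp (3 * B) * (1/4) ^ nat \<bar>x\<bar>"
proof -
  have h: "heat w s y \<le> exp (3 * B) * (1/4) ^ nat \<bar>y\<bar>" for y
  proof -
    have "heat w s y \<le> exp (s * 3) / 4 ^ nat \<bar>y\<bar>" using heat_le[of s 4 w y] assms by simp
    also have "\<dots> \<le> exp (3 * B) / 4 ^ nat \<bar>y\<bar>" using assms by (intro divide_right_mono) auto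
    finally show ?thesis by (simp add: power_divide)
  qed
  have "norm (step_mean w (\<lambda>d. heat w s (x - d))) \<le> 4 * exp (3 * B) * (1/4) ^ nat \<bar>x\<bar>"
  proof (rule norm_step_mean_le)
    fix d assume "d \<in> steps w"
    then have d: "\<bar>d\<bar> = 1" by (rule abs_steps)
    have "(1/4::real) ^ nat \<bar>x - d\<bar> * (1/4) = (1/4) ^ (nat \<bar>x - d\<bar> + 1)" by simp
    also have "\<dots> \<le> (1/4) ^ nat \<bar>x\<bar>" using d by (intro power_decreasing) auto
    finally have "exp (3 * B) * ((1/4::real) ^ nat \<bar>x - d\<bar> * (1/4)) \<le> exp (3 * B) * (1/4) ^ nat \<bar>x\<bar>"
      by (intro mult_left_mono) auto
    then show "norm (heat w s (x - d)) \<le> 4 * exp (3 * B) * (1/4) ^ nat \<bar>x\<bar>"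
      unfolding real_norm_def abs_of_nonneg[OF heat_nonneg] using h[of "x - d"] by linarith
  qed
  then show ?thesis using h[of x] heat_nonneg[of w s x] unfolding heat'_def real_norm_def by linarith
qed

lemma abs_ln_heat_le:
  assumes "reachable w x" "0 < a" "a \<le> s" "s \<le> B"
  shows "\<bar>ln (heat w s x) + 1\<bar> \<le> 1 + B + \<bar>ln (a / 2)\<bar> * real (nat \<bar>x\<bar>) + (real (nat \<bar>x\<bar>))\<^sup>2"
proof -
  define n where "n = nat \<bar>x\<bar>"
  have pos: "heat w s x > 0" using heat_pos assms by simp
  have "ln (exp (-s) * (s / 2) ^ n / fact n) \<le> ln (heat w s x)"
    using heat_lower[OF assms(1) _ n_def, of s] assms pos by (subst ln_le_cancel_iff) auto
  moreover have "ln (exp (-s) * (s / 2) ^ n / fact n) = - s + real n * ln (s / 2) - ln (fact n)"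
    using assms by (simp add: ln_div ln_mult ln_realpow)
  moreover have "ln (fact n :: real) \<le> real n ^ 2"
  proof (cases "n = 0")
    case False
    have "ln (fact n :: real) \<le> ln (real n ^ n)"
      using False fact_le_power[of n, where 'a = real] by (subst ln_le_cancel_iff) (auto simp del: of_nat_power simp flip: of_nat_power)
    also have "\<dots> = real n * ln (real n)" using False by (simp add: ln_realpow)
    also have "\<dots> \<le> real n * real n" using False ln_le_minus_one[of "real n"] by (intro mult_left_mono) auto
    finally show ?thesis by (simp add: power2_eq_square)
  qed simp
  moreover have "real n * ln (s / 2) \<ge> real n * (- \<bar>ln (a / 2)\<bar>)"
  proof (rule mult_left_mono)
    have "ln (a / 2) \<le> ln (s / 2)" using assms by (subst ln_le_cancel_iff) auto
    then show "- \<bar>ln (a / 2)\<bar> \<le> ln (s / 2)" by linarith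
  qed simp
  moreover have "ln (heat w s x) \<le> 0" using pos by simp
  ultimately show ?thesis unfolding n_def[symmetric] using assms by (simp add: mult.commute abs_le_iff)
qed

lemma square_le_4_power2: "(real n)\<^sup>2 \<le> 4 * 2 ^ n"
proof (induction n)
  case (Suc n)
  show ?case
  proof (cases "n \<ge> 3")
    case True
    have "real n \<ge> 3" using True by simp
    moreover have "real n * 3 \<le> real n * real n" using True by (intro mult_left_mono) auto
    ultimately have "(real (Suc n))\<^sup>2 \<le> 2 * (real n)\<^sup>2" unfolding power2_eq_square of_nat_Suc ring_distribs by linarith
    then show ?thesis using Suc by simp
  next
    case False
    then have "n \<in> {0,1,2}" by auto
    then show ?thesis by auto
  qed
qed simp

lemma heat'_unreachable: "\<not> reachable w x \<Longrightarrow> t \<ge> 0 \<Longrightarrow> heat' w t x = 0"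
  by (cases w) (auto simp: heat'_def step_mean_def steps_def heat_unreachable reachable_def)

lemma entropy'_term_bound:
  assumes aB: "0 < a" "a \<le> B"
  obtains C where "\<And>n t. t \<in> {a..B} \<Longrightarrow>
    \<bar>- heat' w t (int_decode n) * (ln (heat w t (int_decode n)) + 1)\<bar> \<le> C * (1/2) ^ nat \<bar>int_decode n\<bar>"
proof
  define C where "C = 1 + B + \<bar>ln (a / 2)\<bar> + 4"
  let ?T' = "\<lambda>n s. - heat' w s (int_decode n) * (ln (heat w s (int_decode n)) + 1)"
  fix n t assume t: "t \<in> {a..B}"
  show "\<bar>?T' n t\<bar> \<le> 5 * exp (3 * B) * C * (1/2) ^ nat \<bar>int_decode n\<bar>"
  proof (cases "reachable w (int_decode n)")
    case True
    define m where "m = nat \<bar>int_decode n\<bar>"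
    have m2: "real m \<le> 2 ^ m" by (simp add: of_nat_less_two_power less_imp_le)
    have "\<bar>ln (heat w t (int_decode n)) + 1\<bar> \<le> 1 + B + \<bar>ln (a / 2)\<bar> * real m + (real m)\<^sup>2"
      using abs_ln_heat_le[OF True aB(1), of t B] t unfolding m_def by auto
    also have "\<dots> \<le> (1 + B) * 2 ^ m + \<bar>ln (a / 2)\<bar> * 2 ^ m + 4 * 2 ^ m"
      using m2 aB square_le_4_power2[of m] by (intro add_mono mult_left_mono) (auto simp: mult_le_cancel_left1)
    also have "\<dots> = C * 2 ^ m" by (simp add: C_def algebra_simps)
    finally have 1: "\<bar>ln (heat w t (int_decode n)) + 1\<bar> \<le> C * 2 ^ m" .
    have "\<bar>?T' n t\<bar> \<le> (5 * exp (3 * B) * (1/4) ^ m) * (C * 2 ^ m)"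
      unfolding abs_mult abs_minus_cancel using heat'_le[of t B w "int_decode n"] 1 t aB
      by (intro mult_mono) (auto simp: m_def)
    also have "\<dots> = 5 * exp (3 * B) * C * ((1/4) ^ m * 2 ^ m)" by simp
    also have "(1/4::real) ^ m * 2 ^ m = (1/2) ^ m" by (simp flip: power_mult_distrib)
    finally show ?thesis by (simp only: m_def)
  next
    case False
    then show ?thesis using heat'_unreachable[OF False] t aB by (simp add: C_def)
  qed
qed

lemma entropy_has_derivative:
  assumes "s > 0"
  shows "(entropy w has_real_derivative entropy' w s) (at s)"
proof -
  define a where "a = s / 2"
  define B where "B = s + 1"
  have aB: "0 < a" "a < s" "s < B" using assms by (auto simp: a_def B_def)
  let ?T = "\<lambda>n s. heat w s (int_decode n) * - ln (heat w s (int_decode n))"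
  let ?T' = "\<lambda>n s. - heat' w s (int_decode n) * (ln (heat w s (int_decode n)) + 1)"
  obtain C where bd: "\<And>n t. t \<in> {a..B} \<Longrightarrow> \<bar>?T' n t\<bar> \<le> C * (1/2) ^ nat \<bar>int_decode n\<bar>"
    using entropy'_term_bound[of a B w] aB by (metis less_imp_le less_trans)
  have "((\<lambda>s. \<Sum>n. ?T n s) has_real_derivative (\<Sum>n. ?T' n s)) (at s)"
  proof (rule has_field_derivative_series'(2)[where S = "{a..B}" and f' = ?T'])
    show "uniformly_convergent_on {a..B} (\<lambda>N t. \<Sum>n<N. ?T' n t)"
      by (rule Weierstrass_m_test'[of _ _ "\<lambda>n. C * (1/2) ^ nat \<bar>int_decode n\<bar>"])
         (use bd in \<open>auto intro!: summable_mult summable_half_power_int\<close>)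
    show "summable (\<lambda>n. ?T n s)"
      using entropy_series(5)[OF less_imp_le[OF assms]] by (rule summable_rabs_cancel)
    show "s \<in> {a..B}" using aB by simp
    show "s \<in> interior {a..B}" using aB by (simp add: interior_atLeastAtMost_real)
    fix n t assume t: "t \<in> {a..B}"
    have "(?T n has_real_derivative ?T' n t) (at t)"
    proof (cases "reachable w (int_decode n)")
      case True
      have t0: "t > 0" using t aB by auto
      note pos = heat_pos[OF True t0] and d = heat_has_derivative[OF t0, of w "int_decode n"]
      have dl: "((\<lambda>s. ln (heat w s (int_decode n))) has_real_derivative
          inverse (heat w t (int_decode n)) * heat' w t (int_decode n)) (at t)"
        by (rule DERIV_chain2[where f = ln and g = "\<lambda>s. heat w s (int_decode n)", OF DERIV_ln[OF pos] d])
      have "(?T n has_real_derivative heat' w t (int_decode n) * - ln (heat w t (int_decode n)) +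
         - (inverse (heat w t (int_decode n)) * heat' w t (int_decode n)) * heat w t (int_decode n)) (at t)"
        by (rule DERIV_mult[OF d DERIV_minus[OF dl]])
      also have "heat' w t (int_decode n) * - ln (heat w t (int_decode n)) +
         - (inverse (heat w t (int_decode n)) * heat' w t (int_decode n)) * heat w t (int_decode n) = ?T' n t"
        using pos by (simp add: algebra_simps)
      finally show ?thesis .
    next
      case False
      have ev: "\<forall>\<^sub>F u in nhds t. ?T n u = 0"
        using eventually_nhds_in_open[of "{0<..}" t] t aB
        by (auto elim!: eventually_mono simp: heat_unreachable[OF False])
      have "((\<lambda>_. 0) has_real_derivative ?T' n t) (at t)"
        using heat'_unreachable[OF False] t aB by simp
      then show ?thesis using ev has_field_derivative_cong_ev[of t t UNIV "?T n" "\<lambda>_. 0"] by simp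
    qed
    then show "(?T n has_real_derivative ?T' n t) (at t within {a..B})"
      by (rule has_field_derivative_at_within)
  qed (rule convex_real_interval)
  then have "((\<lambda>s. \<Sum>n. ?T n s) has_real_derivative entropy' w s) (at s)"
    by (simp add: entropy'_def)
  moreover have "\<forall>\<^sub>F u in nhds s. entropy w u = (\<Sum>n. ?T n u)"
    using eventually_nhds_in_open[of "{0<..}" s] assms
    by (auto elim!: eventually_mono simp: entropy_series)
  ultimately show ?thesis using has_field_derivative_cong_ev[of s s UNIV] by fastforce
qed

lemma continuous_on_entropy': "continuous_on {0<..} (entropy' w)"
proof -
  let ?T' = "\<lambda>n s. - heat' w s (int_decode n) * (ln (heat w s (int_decode n)) + 1)"
  have ch: "continuous_on {a..B} (\<lambda>s. heat w s x)" if "0 < a" for a B x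
    by (rule continuous_on_subset[OF continuous_on_heat]) (use that in auto)
  have c: "continuous_on {a..B} (?T' n)" if "0 < a" for a B n
  proof (cases "reachable w (int_decode n)")
    case True
    have "heat w s (int_decode n) \<noteq> 0" if "s \<in> {a..B}" for s
      using heat_pos[OF True, of s] that \<open>0 < a\<close> by auto
    then show ?thesis unfolding heat'_def step_mean_def
      by (intro continuous_intros ch that ballI) auto
  next
    case False
    have "?T' n s = 0" if "s \<in> {a..B}" for s
      using heat'_unreachable[OF False, of s] that \<open>0 < a\<close> by simp
    then show ?thesis by (subst continuous_on_cong[OF refl, of _ _ "\<lambda>_. 0"]) auto
  qed
  have "isCont (entropy' w) s" if "s > 0" for s
  proof -
    have s2: "0 < s/2" "s/2 \<le> s+1" using that by auto
    obtain C where bd: "\<And>n t. t \<in> {s/2..s+1} \<Longrightarrow> \<bar>?T' n t\<bar> \<le> C * (1/2) ^ nat \<bar>int_decode n\<bar>"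
      using entropy'_term_bound[OF s2, of w] by blast
    have "continuous_on {s/2..s+1} (\<lambda>s. \<Sum>n. ?T' n s)"
    proof (rule uniform_limit_theorem)
      show "uniform_limit {s/2..s+1} (\<lambda>N s. \<Sum>n<N. ?T' n s) (\<lambda>s. \<Sum>n. ?T' n s) sequentially"
        by (rule Weierstrass_m_test[of _ _ "\<lambda>n. C * (1/2) ^ nat \<bar>int_decode n\<bar>"])
           (use bd in \<open>auto intro!: summable_mult summable_half_power_int\<close>)
      show "\<forall>\<^sub>F N in sequentially. continuous_on {s/2..s+1} (\<lambda>s. \<Sum>n<N. ?T' n s)"
        by (intro always_eventually allI continuous_on_sum c) (use that in auto)
    qed auto
    then have "continuous_on {s/2..s+1} (entropy' w)"
      unfolding entropy'_def[abs_def] .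
    then show ?thesis
      by (rule continuous_on_interior) (use that in \<open>simp add: interior_atLeastAtMost_real\<close>)
  qed
  then show ?thesis by (simp add: continuous_at_imp_continuous_on)
qed

section \<open>Concavity of the entropy\<close>

lemma coord_after_1_Suc:
  "coord_after w 1 (Suc m) = bind_pmf (coord_after w 1 m) (\<lambda>y. map_pmf (\<lambda>d. y + d) (pmf_of_set (steps w)))"
proof (rule pmf_eqI)
  fix x
  have "bind_pmf (coord_after w 1 m) (\<lambda>y. map_pmf (\<lambda>d. y + d) (pmf_of_set (steps w)))
     = bind_pmf (pmf_of_set (steps w)) (\<lambda>d. map_pmf (\<lambda>y. y + d) (coord_after w 1 m))"
    unfolding map_pmf_def by (rule bind_commute_pmf)
  moreover have "pmf (map_pmf (\<lambda>y. y + d) (coord_after w 1 m)) x = chain_pmf w m (x - d)" for d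
    using pmf_map_inj'[of "\<lambda>y. y + d" "coord_after w 1 m" "x - d"] by (simp add: inj_def chain_pmf_def)
  ultimately show "pmf (coord_after w 1 (Suc m)) x =
      pmf (bind_pmf (coord_after w 1 m) (\<lambda>y. map_pmf (\<lambda>d. y + d) (pmf_of_set (steps w)))) x"
    using chain_pmf_Suc[of w m x] by (simp add: pmf_bind_pmf_of_set step_mean_def chain_pmf_def)
qed

text \<open>The steps of the chain are independent. With additivity of the Poisson counts this makes the laws at the
  different times a convolution semigroup.\<close>

lemma coord_after_add:
  "coord_after w 1 (m + l) = bind_pmf (coord_after w 1 m) (\<lambda>a. map_pmf (\<lambda>b. a + b) (coord_after w 1 l))"
proof (induction l)
  case 0
  have "coord_after w 1 0 = return_pmf 0" by (simp add: coord_after_def)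
  then show ?case by (simp add: bind_return_pmf')
next
  case (Suc l)
  have "coord_after w 1 (m + Suc l) = bind_pmf (coord_after w 1 (m + l)) (\<lambda>y. map_pmf (\<lambda>d. y + d) (pmf_of_set (steps w)))"
    unfolding add_Suc_right by (rule coord_after_1_Suc)
  moreover have "(+) (x + y) = (\<lambda>d. x + (y + d))" for x y :: int
    by (auto simp: add.assoc)
  ultimately show ?case unfolding Suc coord_after_1_Suc[of w l]
    by (simp only: bind_assoc_pmf map_bind_pmf bind_map_pmf map_pmf_comp add.assoc)
qed

lemma jump_count_add:
  assumes "s \<ge> 0" "u \<ge> 0"
  shows "jump_count (s + u) = bind_pmf (jump_count s) (\<lambda>m. map_pmf (\<lambda>l. m + l) (jump_count u))"
proof (rule pmf_eqI)
  fix N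
  have map: "pmf (map_pmf (\<lambda>l. m + l) (jump_count u)) N = (if m \<le> N then pmf (jump_count u) (N - m) else 0)" for m
  proof (cases "m \<le> N")
    case True
    then show ?thesis using pmf_map_inj'[of "\<lambda>l. m + l" "jump_count u" "N - m"] by simp
  next
    case False
    then have "N \<notin> set_pmf (map_pmf (\<lambda>l. m + l) (jump_count u))" by auto
    then show ?thesis using False by (simp only: set_pmf_iff not_not if_False)
  qed
  have "pmf (bind_pmf (jump_count s) (\<lambda>m. map_pmf (\<lambda>l. m + l) (jump_count u))) N =
      (LINT m|jump_count s. (if m \<le> N then pmf (jump_count u) (N - m) else 0))"
    by (simp add: pmf_bind map)
  also have "\<dots> = (\<Sum>m\<in>{..N}. (if m \<le> N then pmf (jump_count u) (N - m) else 0) * pmf (jump_count s) m)"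
    by (rule integral_measure_pmf_real) (auto split: if_splits)
  also have "\<dots> = (\<Sum>m\<le>N. exp (-(s+u)) / fact N * (real (N choose m) * s ^ m * u ^ (N - m)))"
  proof (intro sum.cong refl)
    fix m assume "m \<in> {..N}"
    then have m: "m \<le> N" by simp
    then have "real (N choose m) = fact N / (fact m * fact (N - m))" by (rule binomial_fact)
    then show "(if m \<le> N then pmf (jump_count u) (N - m) else 0) * pmf (jump_count s) m =
      exp (-(s+u)) / fact N * (real (N choose m) * s ^ m * u ^ (N - m))"
      using m assms by (simp add: pmf_jump_count exp_add exp_diff exp_minus field_simps)
  qed
  also have "\<dots> = exp (-(s+u)) / fact N * (s + u) ^ N"
    by (simp add: binomial_ring sum_distrib_left)
  also have "\<dots> = pmf (jump_count (s + u)) N"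
    using assms by (subst pmf_jump_count) auto
  finally show "pmf (jump_count (s + u)) N = pmf (bind_pmf (jump_count s) (\<lambda>m. map_pmf (\<lambda>l. m + l) (jump_count u))) N" ..
qed

lemma coord_law_1: "coord_law w 1 s = bind_pmf (jump_count s) (coord_after w 1)"
  by (simp add: coord_law_def walk_law_def map_bind_pmf coord_after_def[abs_def])

lemma coord_law_add:
  assumes "s \<ge> 0" "u \<ge> 0"
  shows "coord_law w 1 (s + u) = bind_pmf (coord_law w 1 s) (\<lambda>a. map_pmf (\<lambda>b. a + b) (coord_law w 1 u))"
proof -
  have "coord_law w 1 (s + u) = bind_pmf (jump_count s) (\<lambda>m. bind_pmf (jump_count u) (\<lambda>l.
      bind_pmf (coord_after w 1 m) (\<lambda>a. map_pmf (\<lambda>b. a + b) (coord_after w 1 l))))"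
    unfolding coord_law_1 jump_count_add[OF assms]
    by (simp only: bind_assoc_pmf bind_map_pmf coord_after_add)
  also have "\<dots> = bind_pmf (jump_count s) (\<lambda>m. bind_pmf (coord_after w 1 m) (\<lambda>a. bind_pmf (jump_count u)
      (\<lambda>l. map_pmf (\<lambda>b. a + b) (coord_after w 1 l))))"
    by (intro bind_pmf_cong refl bind_commute_pmf)
  also have "\<dots> = bind_pmf (coord_law w 1 s) (\<lambda>a. map_pmf (\<lambda>b. a + b) (coord_law w 1 u))"
    unfolding coord_law_1 by (simp only: bind_assoc_pmf map_bind_pmf)
  finally show ?thesis .
qed

lemma heat_add:
  assumes "s \<ge> 0" "u \<ge> 0"
  shows "ennreal (heat w (s + u) t) = (\<integral>\<^sup>+y. ennreal (heat w s (t - y)) \<partial>measure_pmf (coord_law w 1 u))"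
proof -
  have "coord_law w 1 (s + u) = bind_pmf (coord_law w 1 u) (\<lambda>y. map_pmf (\<lambda>a. a + y) (coord_law w 1 s))"
    unfolding coord_law_add[OF assms] map_pmf_def by (rule bind_commute_pmf)
  moreover have "pmf (map_pmf (\<lambda>a. a + y) (coord_law w 1 s)) t = heat w s (t - y)" for y
    using pmf_map_inj'[of "\<lambda>a. a + y" "coord_law w 1 s" "t - y"] by (simp add: inj_def heat_def)
  ultimately show ?thesis by (simp add: heat_def ennreal_pmf_bind)
qed

text \<open>Let \<open>X\<close>, \<open>Y\<close>, \<open>Z\<close> be independent increments over times \<open>s\<close>, \<open>u\<close>, \<open>v\<close>. The integrand is the ratio
  \<open>p(X + Y) p(X + Z) / (p(X + Y + Z) p(X))\<close> of the corresponding densities. Summing over \<open>x\<close> cancels \<open>p(X)\<close>, and after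
  the substitution \<open>t = x + y + z\<close> both remaining sums reproduce the density of \<open>X + Y + Z\<close>, which leaves the
  total mass of that density. The inequality sign is due to the points where a denominator vanishes.\<close>

lemma heat_likelihood_ratio_le:
  assumes "s \<ge> 0" "u \<ge> 0" "v \<ge> 0"
  shows "(\<integral>\<^sup>+y. \<integral>\<^sup>+z. \<integral>\<^sup>+x. ennreal (heat w (s + u) (x + y) * heat w (s + v) (x + z) /
            (heat w (s + u + v) (x + y + z) * heat w s x))
          \<partial>measure_pmf (coord_law w 1 s) \<partial>measure_pmf (coord_law w 1 v) \<partial>measure_pmf (coord_law w 1 u)) \<le> 1"
    (is "?L \<le> 1")
proof -
  let ?U = "measure_pmf (coord_law w 1 u)" and ?V = "measure_pmf (coord_law w 1 v)"
  let ?S = "measure_pmf (coord_law w 1 s)"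
  let ?g = "\<lambda>y z t. ennreal (heat w (s + u) (t - z) * heat w (s + v) (t - y) / heat w (s + u + v) t)"
  have "(\<integral>\<^sup>+x. ennreal (heat w (s + u) (x + y) * heat w (s + v) (x + z) /
            (heat w (s + u + v) (x + y + z) * heat w s x)) \<partial>?S) \<le> (\<integral>\<^sup>+t. ?g y z t \<partial>count_space UNIV)" for y z
  proof -
    have "(\<integral>\<^sup>+x. ennreal (heat w (s + u) (x + y) * heat w (s + v) (x + z) /
            (heat w (s + u + v) (x + y + z) * heat w s x)) \<partial>?S) =
       (\<integral>\<^sup>+x. ennreal (heat w s x) * ennreal (heat w (s + u) (x + y) * heat w (s + v) (x + z) /
            (heat w (s + u + v) (x + y + z) * heat w s x)) \<partial>count_space UNIV)"
      unfolding nn_integral_measure_pmf heat_def ..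
    also have "\<dots> \<le> (\<integral>\<^sup>+x. ?g y z (x + y + z) \<partial>count_space UNIV)"
    proof (rule nn_integral_mono)
      fix x
      show "ennreal (heat w s x) * ennreal (heat w (s + u) (x + y) * heat w (s + v) (x + z) /
            (heat w (s + u + v) (x + y + z) * heat w s x)) \<le> ?g y z (x + y + z)"
        by (cases "heat w s x = 0") (auto simp flip: ennreal_mult simp: add.commute)
    qed
    also have "\<dots> = (\<integral>\<^sup>+t. ?g y z t \<partial>count_space UNIV)"
    proof (rule nn_integral_bij_count_space[of "\<lambda>x. x + y + z"])
      show "bij_betw (\<lambda>x. x + y + z) UNIV UNIV"
        by (rule bij_betwI[of _ _ _ "\<lambda>t. t - y - z"]) auto
    qed
    finally show ?thesis .
  qed
  then have "?L \<le> (\<integral>\<^sup>+y. \<integral>\<^sup>+z. \<integral>\<^sup>+t. ?g y z t \<partial>count_space UNIV \<partial>?V \<partial>?U)"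
    by (intro nn_integral_mono) auto
  also have "\<dots> = (\<integral>\<^sup>+y. \<integral>\<^sup>+t. \<integral>\<^sup>+z. ?g y z t \<partial>?V \<partial>count_space UNIV \<partial>?U)"
    by (subst nn_integral_count_space_nn_integral) auto
  also have "\<dots> = (\<integral>\<^sup>+t. \<integral>\<^sup>+y. \<integral>\<^sup>+z. ?g y z t \<partial>?V \<partial>?U \<partial>count_space UNIV)"
    by (subst nn_integral_count_space_nn_integral) auto
  also have "\<dots> \<le> (\<integral>\<^sup>+t. ennreal (heat w (s + u + v) t) \<partial>count_space UNIV)"
  proof (rule nn_integral_mono)
    fix t
    let ?h = "heat w (s + u + v) t"
    have g: "?g y z t = ennreal (1 / ?h) * (ennreal (heat w (s + v) (t - y)) * ennreal (heat w (s + u) (t - z)))" for y z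
      by (simp flip: ennreal_mult add: mult_ac)
    have "(\<integral>\<^sup>+y. \<integral>\<^sup>+z. ?g y z t \<partial>?V \<partial>?U) =
        ennreal (1 / ?h) * ((\<integral>\<^sup>+y. ennreal (heat w (s + v) (t - y)) \<partial>?U) * (\<integral>\<^sup>+z. ennreal (heat w (s + u) (t - z)) \<partial>?V))"
      unfolding g by (simp add: nn_integral_cmult nn_integral_multc)
    also have "(\<integral>\<^sup>+z. ennreal (heat w (s + u) (t - z)) \<partial>?V) = ennreal ?h"
      using heat_add[of "s + u" v w t] assms by simp
    also have "(\<integral>\<^sup>+y. ennreal (heat w (s + v) (t - y)) \<partial>?U) = ennreal ?h"
      using heat_add[of "s + v" u w t] assms by (simp add: ac_simps)
    also have "ennreal (1 / ?h) * (ennreal ?h * ennreal ?h) \<le> ennreal ?h"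
      by (cases "?h = 0") (auto simp flip: ennreal_mult)
    finally show "(\<integral>\<^sup>+y. \<integral>\<^sup>+z. ?g y z t \<partial>?V \<partial>?U) \<le> ennreal ?h" .
  qed
  also have "\<dots> = 1"
    unfolding heat_def by (simp add: nn_integral_pmf measure_pmf.emeasure_space_1[simplified])
  finally show ?thesis .
qed

text \<open>Gibbs' inequality \<open>ln R \<le> R - 1\<close>, applied to the likelihood ratio \<open>R\<close> above, whose mean is at most 1. The
  logarithm of \<open>R\<close> is the combination of information contents whose mean is the difference of the two sides.\<close>

lemma entropy_submodular:
  assumes "s > 0" "u \<ge> 0" "v \<ge> 0"
  shows "entropy w (s + u + v) + entropy w s \<le> entropy w (s + u) + entropy w (s + v)"
proof -
  let ?U = "coord_law w 1 u" and ?V = "coord_law w 1 v" and ?S = "coord_law w 1 s"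
  define T where "T = pair_pmf ?U (pair_pmf ?V ?S)"
  have mS: "map_pmf (\<lambda>(y,z,x). x) T = ?S"
    by (simp add: T_def pair_pmf_def map_bind_pmf bind_assoc_pmf bind_return_pmf bind_return_pmf')
  have mSU: "map_pmf (\<lambda>(y,z,x). x + y) T = coord_law w 1 (s + u)"
  proof -
    have "map_pmf (\<lambda>(y,z,x). x + y) T = bind_pmf ?U (\<lambda>y. bind_pmf ?S (\<lambda>x. return_pmf (x + y)))"
      by (simp add: T_def pair_pmf_def map_bind_pmf bind_assoc_pmf bind_return_pmf)
    also have "\<dots> = coord_law w 1 (s + u)"
      using assms by (subst bind_commute_pmf) (simp only: coord_law_add map_pmf_def less_imp_le)
    finally show ?thesis .
  qed
  have mSV: "map_pmf (\<lambda>(y,z,x). x + z) T = coord_law w 1 (s + v)"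
  proof -
    have "map_pmf (\<lambda>(y,z,x). x + z) T = bind_pmf ?V (\<lambda>y. bind_pmf ?S (\<lambda>x. return_pmf (x + y)))"
      by (simp add: T_def pair_pmf_def map_bind_pmf bind_assoc_pmf bind_return_pmf)
    also have "\<dots> = coord_law w 1 (s + v)"
      using assms by (subst bind_commute_pmf) (simp only: coord_law_add map_pmf_def less_imp_le)
    finally show ?thesis .
  qed
  have mSUV: "map_pmf (\<lambda>(y,z,x). x + y + z) T = coord_law w 1 (s + u + v)"
  proof -
    have "map_pmf (\<lambda>(y,z,x). x + y + z) T = bind_pmf ?U (\<lambda>y. bind_pmf ?V (\<lambda>z. bind_pmf ?S (\<lambda>x. return_pmf (x + y + z))))"
      by (simp add: T_def pair_pmf_def map_bind_pmf bind_assoc_pmf bind_return_pmf)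
    also have "\<dots> = bind_pmf ?U (\<lambda>y. bind_pmf ?S (\<lambda>x. bind_pmf ?V (\<lambda>z. return_pmf (x + y + z))))"
      by (intro bind_pmf_cong refl bind_commute_pmf)
    also have "\<dots> = bind_pmf ?S (\<lambda>x. bind_pmf ?U (\<lambda>y. bind_pmf ?V (\<lambda>z. return_pmf (x + y + z))))"
      by (rule bind_commute_pmf)
    also have "\<dots> = coord_law w 1 (s + u + v)"
      using assms by (simp only: coord_law_add map_pmf_def bind_assoc_pmf bind_return_pmf
        less_imp_le add_nonneg_nonneg)
    finally show ?thesis .
  qed
  have int: "integrable (measure_pmf T) (\<lambda>a. ln (heat w r (f a)))"
    and ent: "measure_pmf.expectation T (\<lambda>a. ln (heat w r (f a))) = - entropy w r"
    if "map_pmf f T = coord_law w 1 r" "r \<ge> 0" for r f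
  proof -
    have "integrable (measure_pmf (map_pmf f T)) (\<lambda>x. ln (heat w r x))"
      unfolding that(1) by (rule entropy_series(1)[OF that(2)])
    then show "integrable (measure_pmf T) (\<lambda>a. ln (heat w r (f a)))" by simp
    have "measure_pmf.expectation (map_pmf f T) (\<lambda>x. ln (heat w r x)) = - entropy w r"
      unfolding that(1) by (simp add: entropy_def)
    then show "measure_pmf.expectation T (\<lambda>a. ln (heat w r (f a))) = - entropy w r" by simp
  qed
  define R where "R = (\<lambda>(y,z,x). heat w (s + u) (x + y) * heat w (s + v) (x + z) /
            (heat w (s + u + v) (x + y + z) * heat w s x))"
  have R0: "R a \<ge> 0" for a by (auto simp: R_def split: prod.split)
  have nnR: "(\<integral>\<^sup>+a. ennreal (R a) \<partial>T) \<le> 1"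
    using heat_likelihood_ratio_le[of s u v w] assms
    by (simp add: T_def nn_integral_pair_pmf' R_def)
  then have iR: "integrable (measure_pmf T) R"
    by (intro integrableI_nonneg) (auto simp: R0 intro: le_less_trans)
  have ER: "measure_pmf.expectation T R \<le> 1"
    using nnR nn_integral_eq_integral[OF iR] R0 by (simp add: ennreal_le_1)
  let ?I = "\<lambda>a. ln (heat w (s+u+v) ((\<lambda>(y,z,x). x + y + z) a)) + ln (heat w s ((\<lambda>(y,z,x). x) a))
      - ln (heat w (s+u) ((\<lambda>(y,z,x). x + y) a)) - ln (heat w (s+v) ((\<lambda>(y,z,x). x + z) a))"
  have s0: "s \<ge> 0" "s + u \<ge> 0" "s + v \<ge> 0" "s + u + v \<ge> 0" using assms by auto
  note ii = int[OF mS s0(1)] int[OF mSU s0(2)] int[OF mSV s0(3)] int[OF mSUV s0(4)]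
  note ee = ent[OF mS s0(1)] ent[OF mSU s0(2)] ent[OF mSV s0(3)] ent[OF mSUV s0(4)]
  have "measure_pmf.expectation T (\<lambda>a. 1 - R a) \<le> measure_pmf.expectation T ?I"
  proof (rule integral_mono_AE)
    show "integrable (measure_pmf T) (\<lambda>a. 1 - R a)" using iR by simp
    show "integrable (measure_pmf T) ?I"
      by (intro Bochner_Integration.integrable_diff Bochner_Integration.integrable_add ii)
    show "AE a in measure_pmf T. 1 - R a \<le> ?I a"
      unfolding AE_measure_pmf_iff
    proof
      fix a assume a: "a \<in> set_pmf T"
      obtain y z x where yzx: "a = (y, z, x)" by (cases a)
      have pos: "heat w r (f a) > 0" if "map_pmf f T = coord_law w 1 r" for f r
      proof -
        have "f a \<in> set_pmf (coord_law w 1 r)" using a unfolding that[symmetric] by simp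
        then show ?thesis by (simp add: heat_def pmf_positive)
      qed
      have p: "heat w s x > 0" "heat w (s + u) (x + y) > 0" "heat w (s + v) (x + z) > 0"
         "heat w (s + u + v) (x + y + z) > 0"
        using pos[OF mS] pos[OF mSU] pos[OF mSV] pos[OF mSUV] by (auto simp: yzx)
      have "R a > 0" using p by (simp add: R_def yzx)
      then have "ln (R a) \<le> R a - 1" by (rule ln_le_minus_one)
      moreover have "ln (R a) = - ?I a" using p by (simp add: R_def yzx ln_div ln_mult)
      ultimately show "1 - R a \<le> ?I a" by simp
    qed
  qed
  moreover have "measure_pmf.expectation T ?I = - entropy w (s + u + v) - entropy w s + entropy w (s + u) + entropy w (s + v)"
    using ii ee by simp
  moreover have "measure_pmf.expectation T (\<lambda>a. 1 - R a) = 1 - measure_pmf.expectation T R"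
    using iR by simp
  ultimately show ?thesis using ER by linarith
qed

text \<open>Submodularity bounds the increments of the entropy over a time step \<open>v\<close>; the step then shrinks to 0.\<close>

lemma entropy'_antimono:
  assumes "0 < s" "s \<le> t"
  shows "entropy' w t \<le> entropy' w s"
proof -
  have lim: "((\<lambda>v. (entropy w (r + v) - entropy w r) / v) \<longlongrightarrow> entropy' w r) (at_right 0)" if "r > 0" for r
    using entropy_has_derivative[OF that, of w] unfolding DERIV_def
    by (rule tendsto_mono[rotated]) (simp add: at_le)
  show ?thesis
  proof (rule tendsto_le[OF _ lim lim])
    show "\<forall>\<^sub>F v in at_right 0. (entropy w (t + v) - entropy w t) / v \<le> (entropy w (s + v) - entropy w s) / v"
      unfolding eventually_at_filter
    proof (intro always_eventually allI impI)
      fix v :: real assume "v \<in> {0<..}"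
      then have v: "v > 0" by simp
      show "(entropy w (t + v) - entropy w t) / v \<le> (entropy w (s + v) - entropy w s) / v"
        using entropy_submodular[of s "t - s" v w] assms v by (intro divide_right_mono) auto
    qed
  qed (use assms in auto)
qed

lemma entropy_diff_bounds:
  assumes "0 < a" "a \<le> b"
  shows "entropy' w b * (b - a) \<le> entropy w b - entropy w a"
    and "entropy w b - entropy w a \<le> entropy' w a * (b - a)"
proof -
  have "entropy' w b * (b - a) \<le> entropy w b - entropy w a \<and> entropy w b - entropy w a \<le> entropy' w a * (b - a)"
  proof (cases "a = b")
    case False
    then have ab: "a < b" using assms by simp
    have "\<exists>z. a < z \<and> z < b \<and> entropy w b - entropy w a = (b - a) * entropy' w z"
      using assms by (intro MVT2[OF ab] entropy_has_derivative) auto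
    then obtain z where z: "a < z" "z < b" "entropy w b - entropy w a = (b - a) * entropy' w z" by auto
    have "entropy' w b \<le> entropy' w z" "entropy' w z \<le> entropy' w a"
      using z assms by (auto intro!: entropy'_antimono)
    then show ?thesis unfolding z(3) using ab by (auto simp: mult.commute intro!: mult_left_mono)
  qed simp
  then show "entropy' w b * (b - a) \<le> entropy w b - entropy w a"
    "entropy w b - entropy w a \<le> entropy' w a * (b - a)" by auto
qed

section \<open>Moments\<close>

abbreviation E_rw :: "walk_type \<Rightarrow> real \<Rightarrow> (int \<Rightarrow> real) \<Rightarrow> real" where
  "E_rw w s \<equiv> measure_pmf.expectation (coord_law w 1 s)"

lemma step_mean_swap:
  "step_mean w (\<lambda>d. step_mean w (\<lambda>e. f d e)) = step_mean w (\<lambda>e. step_mean w (\<lambda>d. f d e))"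
  unfolding step_mean_def sum_divide_distrib[symmetric] by (subst sum.swap) simp

lemma step_mean_add: "step_mean w (\<lambda>d. f d + g d) = step_mean w f + step_mean w g"
  by (simp add: step_mean_def sum.distrib add_divide_distrib)

lemma step_mean_cmult: "step_mean w (\<lambda>d. c * f d) = c * step_mean w f"
  by (simp add: step_mean_def sum_distrib_left)

text \<open>The Stein equation of a sum of independent steps: by exchangeability, the mean displacement given the endpoint
  can be charged to any single step. After mixing over the Poisson number of jumps it becomes \<open>heat_stein\<close>.\<close>

lemma chain_pmf_stein:
  "of_int x * chain_pmf w (Suc m) x = real (Suc m) * step_mean w (\<lambda>d. of_int d * chain_pmf w m (x - d))"
proof (induction m arbitrary: x)
  case 0
  have "of_int x * step_mean w (\<lambda>d. chain_pmf w 0 (x - d)) = step_mean w (\<lambda>d. of_int x * chain_pmf w 0 (x - d))"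
    by (rule step_mean_cmult[symmetric])
  also have "\<dots> = step_mean w (\<lambda>d. of_int d * chain_pmf w 0 (x - d))"
    by (simp add: chain_pmf_0 step_mean_def if_distrib cong: if_cong)
  finally show ?case by (simp add: chain_pmf_Suc)
next
  case (Suc m)
  have "of_int x * chain_pmf w (Suc (Suc m)) x = step_mean w (\<lambda>d. of_int x * chain_pmf w (Suc m) (x - d))"
    by (simp only: chain_pmf_Suc[of w "Suc m"] step_mean_cmult)
  also have "\<dots> = step_mean w (\<lambda>d. of_int (x - d) * chain_pmf w (Suc m) (x - d) + of_int d * chain_pmf w (Suc m) (x - d))"
    by (simp add: algebra_simps)
  also have "\<dots> = step_mean w (\<lambda>d. real (Suc m) * step_mean w (\<lambda>e. of_int e * chain_pmf w m (x - d - e)))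
       + step_mean w (\<lambda>d. of_int d * chain_pmf w (Suc m) (x - d))"
    unfolding step_mean_add by (simp only: Suc.IH)
  also have "step_mean w (\<lambda>d. real (Suc m) * step_mean w (\<lambda>e. of_int e * chain_pmf w m (x - d - e)))
     = real (Suc m) * step_mean w (\<lambda>e. of_int e * step_mean w (\<lambda>d. chain_pmf w m (x - e - d)))"
    unfolding step_mean_cmult by (subst step_mean_swap) (simp add: step_mean_cmult algebra_simps)
  also have "\<dots> = real (Suc m) * step_mean w (\<lambda>e. of_int e * chain_pmf w (Suc m) (x - e))"
    by (simp only: chain_pmf_Suc)
  finally show ?case by (simp only: of_nat_Suc ring_distribs mult_1)
qed

lemma heat_stein:
  assumes "s \<ge> 0"
  shows "of_int x * heat w s x = s * step_mean w (\<lambda>d. of_int d * heat w s (x - d))"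
proof -
  let ?f = "\<lambda>m. of_int x * (exp (-s) * s ^ m / fact m * chain_pmf w m x)"
  have "?f sums (of_int x * heat w s x)"
    by (intro sums_mult heat_sums assms)
  moreover have "?f 0 = 0" by (simp add: chain_pmf_0)
  ultimately have "(\<lambda>m. ?f (Suc m)) sums (of_int x * heat w s x)"
    by (subst sums_Suc_iff[of ?f]) (simp only: add_0_right)
  moreover have "?f (Suc m) = s * ((\<Sum>d\<in>steps w. of_int d * (exp (-s) * s ^ m / fact m * chain_pmf w m (x - d))) / card (steps w))" for m
  proof -
    have "?f (Suc m) = exp (-s) * s ^ Suc m / fact (Suc m) * (of_int x * chain_pmf w (Suc m) x)"
      by (simp only: mult_ac times_divide_eq_right times_divide_eq_left)
    also have "\<dots> = exp (-s) * s ^ Suc m / fact m * step_mean w (\<lambda>d. of_int d * chain_pmf w m (x - d))"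
      unfolding chain_pmf_stein by (simp add: field_simps del: of_nat_Suc)
    also have "\<dots> = s * (exp (-s) * s ^ m / fact m * step_mean w (\<lambda>d. of_int d * chain_pmf w m (x - d)))"
      by simp
    also have "exp (-s) * s ^ m / fact m * step_mean w (\<lambda>d. of_int d * chain_pmf w m (x - d))
       = step_mean w (\<lambda>d. of_int d * (exp (-s) * s ^ m / fact m * chain_pmf w m (x - d)))"
      unfolding step_mean_cmult[symmetric] by (simp only: mult_ac)
    finally show ?thesis by (simp only: step_mean_def)
  qed
  moreover have "(\<lambda>m. s * ((\<Sum>d\<in>steps w. of_int d * (exp (-s) * s ^ m / fact m * chain_pmf w m (x - d))) / card (steps w)))
      sums (s * ((\<Sum>d\<in>steps w. of_int d * heat w s (x - d)) / card (steps w)))"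
    by (intro sums_mult sums_divide sums_sum heat_sums assms)
  ultimately show ?thesis
    unfolding step_mean_def by (metis (no_types, lifting) sums_cong sums_unique2)
qed

text \<open>One term of the exponential series. It lets the exponential tails absorb polynomial weights.\<close>

lemma power_le_fact_exp:
  fixes y :: real
  assumes "y \<ge> 0"
  shows "y ^ j \<le> fact j * exp y"
proof -
  have "inverse (fact j) * y ^ j \<le> (\<Sum>n. inverse (fact n) * y ^ n)"
    using sum_le_suminf[OF summable_exp[of y], of "{j}"] assms by simp
  also have "\<dots> = exp y" by (simp add: exp_def scaleR_conv_of_real)
  finally show ?thesis by (simp add: field_simps)
qed

lemma integrable_rw_iff:
  "integrable (measure_pmf (coord_law w 1 s)) f \<longleftrightarrow> integrable (count_space UNIV) (\<lambda>x. heat w s x * f x)"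
  unfolding measure_pmf_eq_density by (subst integrable_density) (auto simp: heat_def)

lemma E_rw_count: "E_rw w s f = (LINT x|count_space UNIV. heat w s x * f x)"
  unfolding measure_pmf_eq_density by (subst integral_density) (auto simp: heat_def)

lemma integrable_power:
  fixes c :: real
  assumes "s \<ge> 0"
  shows "integrable (measure_pmf (coord_law w 1 s)) (\<lambda>x. (of_int x + c) ^ j)"
proof (rule expectation_suminf(1), rule summable_comparison_test')
  define K where "K = exp (s * (2 * exp 1 - 1)) * fact j * exp \<bar>c\<bar>"
  show "summable (\<lambda>n. K * (1/2) ^ nat \<bar>int_decode n\<bar>)"
    by (intro summable_mult summable_half_power_int)
  fix n :: nat
  define x where "x = int_decode n"
  define l where "l = nat \<bar>x\<bar>"
  have e1: "exp 1 \<ge> (1::real)" by simp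
  have "heat w s x \<le> exp (s * (2 * exp 1 - 1)) / (2 * exp 1) ^ l"
    unfolding l_def by (rule heat_le) (use assms e1 in linarith)+
  moreover have "\<bar>of_int x + c\<bar> ^ j \<le> fact j * exp \<bar>c\<bar> * exp 1 ^ l"
  proof -
    have "\<bar>of_int x + c\<bar> ^ j \<le> fact j * exp \<bar>of_int x + c\<bar>" by (rule power_le_fact_exp) simp
    also have "\<dots> \<le> fact j * exp (\<bar>c\<bar> + real l)" by (intro mult_left_mono) (auto simp: l_def)
    also have "\<dots> = fact j * exp \<bar>c\<bar> * exp 1 ^ l"
      by (simp add: exp_add flip: exp_of_nat_mult)
    finally show ?thesis .
  qed
  ultimately have "heat w s x * \<bar>of_int x + c\<bar> ^ j \<le>
      exp (s * (2 * exp 1 - 1)) / (2 * exp 1) ^ l * (fact j * exp \<bar>c\<bar> * exp 1 ^ l)"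
    by (intro mult_mono) auto
  also have "\<dots> = K * (1/2) ^ l"
    by (simp add: K_def power_mult_distrib power_divide)
  finally show "norm \<bar>heat w s (int_decode n) * (of_int (int_decode n) + c) ^ j\<bar> \<le> K * (1/2) ^ nat \<bar>int_decode n\<bar>"
    by (simp add: abs_mult power_abs x_def l_def)
qed

lemma E_rw_stein:
  assumes "s \<ge> 0" "integrable (measure_pmf (coord_law w 1 s)) (\<lambda>x. of_int x * f x)"
    "\<And>d. d \<in> steps w \<Longrightarrow> integrable (measure_pmf (coord_law w 1 s)) (\<lambda>x. f (x + d))"
  shows "E_rw w s (\<lambda>x. of_int x * f x) = s * step_mean w (\<lambda>d. of_int d * E_rw w s (\<lambda>x. f (x + d)))"
proof -
  have bij: "bij_betw (\<lambda>x. x + d) UNIV (UNIV :: int set)" for d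
    by (rule bij_betwI[of _ _ _ "\<lambda>t. t - d"]) auto
  have int: "integrable (count_space UNIV) (\<lambda>x. heat w s (x - d) * f x)" if "d \<in> steps w" for d
    using assms(3)[OF that] unfolding integrable_rw_iff
    using integrable_bij_count_space[OF bij, of "\<lambda>x. heat w s (x - d) * f x" d] by simp
  have eq: "(LINT x|count_space UNIV. heat w s (x - d) * f x) = E_rw w s (\<lambda>x. f (x + d))" for d
    unfolding E_rw_count
    using integral_bij_count_space[OF bij, of "\<lambda>x. heat w s (x - d) * f x" d] by simp
  have "E_rw w s (\<lambda>x. of_int x * f x) = (LINT x|count_space UNIV. (of_int x * heat w s x) * f x)"
    unfolding E_rw_count by (simp add: mult_ac)
  also have "\<dots> = (LINT x|count_space UNIV. s * ((\<Sum>d\<in>steps w. of_int d * (heat w s (x - d) * f x)) / card (steps w)))"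
    unfolding heat_stein[OF assms(1)] step_mean_def by (simp add: sum_distrib_right sum_distrib_left mult_ac)
  also have "\<dots> = s * ((\<Sum>d\<in>steps w. of_int d * (LINT x|count_space UNIV. heat w s (x - d) * f x)) / card (steps w))"
    using int by (subst Bochner_Integration.integral_mult_right_zero,
        subst Bochner_Integration.integral_divide_zero,
        subst Bochner_Integration.integral_sum) auto
  finally show ?thesis unfolding step_mean_def eq .
qed

definition drift :: "walk_type \<Rightarrow> real" where
  "drift w = (case w of Simple \<Rightarrow> 0 | Directed \<Rightarrow> 1)"

definition moment :: "walk_type \<Rightarrow> real \<Rightarrow> nat \<Rightarrow> real" where
  "moment w s j = E_rw w s (\<lambda>x. (of_int x - s * drift w) ^ j)"

text \<open>The Stein equation applied to \<open>(X - s * drift w) ^ j\<close>. The centring removes the leading term, so the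
  recursion determines each central moment from lower ones.\<close>

lemma moment_Suc:
  assumes "s \<ge> 0"
  shows "moment w s (Suc j) =
    s * step_mean w (\<lambda>d. of_int d * (E_rw w s (\<lambda>x. (of_int x - s * drift w + of_int d) ^ j) - moment w s j))"
proof -
  let ?c = "s * drift w"
  have int: "integrable (measure_pmf (coord_law w 1 s)) (\<lambda>x. (of_int x - ?c + a) ^ j)" for a j
    using integrable_power[OF assms, of w "a - ?c" j] by (simp add: algebra_simps)
  have int0: "integrable (measure_pmf (coord_law w 1 s)) (\<lambda>x. (of_int x - ?c) ^ j)" for j
    using int[of 0] by simp
  have split: "of_int x * (of_int x - ?c) ^ j = (of_int x - ?c) ^ Suc j + ?c * (of_int x - ?c) ^ j" for x
    by (simp add: algebra_simps)
  have conv: "of_int (x + d) - ?c = of_int x - ?c + of_int d" for x d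
    by simp
  have f1: "E_rw w s (\<lambda>x. of_int x * (of_int x - ?c) ^ j) = s * step_mean w (\<lambda>d. of_int d * E_rw w s (\<lambda>x. (of_int (x + d) - ?c) ^ j))"
  proof (rule E_rw_stein[OF assms])
    show "integrable (measure_pmf (coord_law w 1 s)) (\<lambda>x. of_int x * (of_int x - ?c) ^ j)"
      unfolding split by (intro Bochner_Integration.integrable_add integrable_mult_right int0)
    show "integrable (measure_pmf (coord_law w 1 s)) (\<lambda>x. (of_int (x + d) - ?c) ^ j)" for d
      using int[of "of_int d" j] by (simp add: algebra_simps)
  qed
  have f2: "E_rw w s (\<lambda>x. of_int x * (of_int x - ?c) ^ j) = moment w s (Suc j) + ?c * moment w s j"
    unfolding split moment_def by (subst Bochner_Integration.integral_add) (use int0 in \<open>auto simp del: power_Suc\<close>)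
  have "drift w = step_mean w (\<lambda>d. of_int d)"
    by (cases w) (auto simp: drift_def step_mean_def steps_def)
  then have f3: "?c * moment w s j = s * step_mean w (\<lambda>d. moment w s j * of_int d)"
    by (simp add: step_mean_cmult)
  have f4: "step_mean w (\<lambda>d. of_int d * (E_rw w s (\<lambda>x. (of_int x - ?c + of_int d) ^ j) - moment w s j)) =
     step_mean w (\<lambda>d. of_int d * E_rw w s (\<lambda>x. (of_int x - ?c + of_int d) ^ j)) - step_mean w (\<lambda>d. moment w s j * of_int d)"
    by (simp add: step_mean_def sum_subtractf diff_divide_distrib right_diff_distrib mult.commute)
  show ?thesis unfolding f4
    by (subst right_diff_distrib) (use f1[unfolded conv] f2 f3 in linarith)
qed

lemma E_rw_shift_power:
  assumes "s \<ge> 0"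
  shows "E_rw w s (\<lambda>x. (of_int x - s * drift w + a) ^ j) = (\<Sum>i\<le>j. real (j choose i) * a ^ (j - i) * moment w s i)"
proof -
  have int: "integrable (measure_pmf (coord_law w 1 s)) (\<lambda>x. (of_int x - s * drift w) ^ j)" for j
    using integrable_power[OF assms, of w "- s * drift w" j] by simp
  have "E_rw w s (\<lambda>x. (of_int x - s * drift w + a) ^ j) =
     E_rw w s (\<lambda>x. \<Sum>i\<le>j. real (j choose i) * a ^ (j - i) * (of_int x - s * drift w) ^ i)"
    by (simp add: binomial_ring mult_ac)
  also have "\<dots> = (\<Sum>i\<le>j. real (j choose i) * a ^ (j - i) * moment w s i)"
    unfolding moment_def using int by (subst Bochner_Integration.integral_sum) auto
  finally show ?thesis .
qed

text \<open>The second and the fourth moment give the mean and the variance of \<open>Z\<^sup>2 / 2\<close>; the sixth controls the tails.\<close>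

lemma moments:
  assumes "s \<ge> 0"
  shows "moment w s 2 = s" "moment w s 4 = 3 * s\<^sup>2 + s" "s \<ge> 1 \<Longrightarrow> moment w s 6 \<le> 41 * s ^ 3"
proof -
  have m0: "moment w s 0 = 1" by (simp add: moment_def)
  have sums: "(\<Sum>i\<le>n. g i) = (\<Sum>i<Suc n. g i)" for g :: "nat \<Rightarrow> real" and n
    by (simp add: lessThan_Suc_atMost)
  note rec = moment_Suc[OF assms, of w, unfolded E_rw_shift_power[OF assms] step_mean_def]
  have ch: "(4 choose 2) = (6::nat)" "(5 choose 2) = (10::nat)" "(5 choose 3) = (10::nat)" "(3 choose 2) = (3::nat)" "(4 choose 3) = (4::nat)" "(5 choose 4) = (5::nat)"
    by (simp_all add: eval_nat_numeral)
  have all: "moment w s (Suc 0) = 0 \<and> moment w s 2 = s \<and> moment w s 3 = s * drift w \<and>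
     moment w s 4 = 3 * s^2 + s \<and> moment w s 5 = drift w * (10 * s^2 + s) \<and>
     moment w s 6 = 15 * s^3 + (if w = Simple then 15 else 25) * s\<^sup>2 + s"
  proof (cases w)
    case Simple
    have [simp]: "card (steps w) = 2" and s: "steps w = {1,-1}" using Simple by (auto simp: steps_def)
    have m1: "moment w s (Suc 0) = 0" by (subst rec) (simp add: s m0)
    have m2: "moment w s (Suc (Suc 0)) = s" by (subst rec) (simp add: s m0 m1)
    have m3: "moment w s (Suc (Suc (Suc 0))) = 0" by (subst rec) (simp add: s m0 m1 m2)
    have m4: "moment w s (Suc (Suc (Suc (Suc 0)))) = 3 * s^2 + s" by (subst rec) (simp add: s m0 m1 m2 m3 power2_eq_square algebra_simps)
    have m5: "moment w s (Suc (Suc (Suc (Suc (Suc 0))))) = 0" by (subst rec) (simp add: s m0 m1 m2 m3 m4)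
    have m6: "moment w s (Suc (Suc (Suc (Suc (Suc (Suc 0)))))) = 15 * s^3 + 15 * s^2 + s"
      by (subst rec) (simp add: s m0 m1 m2 m3 m4 m5 power2_eq_square power3_eq_cube algebra_simps)
    show ?thesis using m1 m2 m3 m4 m5 m6 by (simp add: eval_nat_numeral Simple drift_def)
  next
    case Directed
    have [simp]: "card (steps w) = 1" and s: "steps w = {1}" using Directed by (auto simp: steps_def)
    have m1: "moment w s (Suc 0) = 0" by (subst rec) (simp add: s m0)
    have m2: "moment w s (Suc (Suc 0)) = s" by (subst rec) (simp add: s m0 m1)
    have m3: "moment w s (Suc (Suc (Suc 0))) = s" by (subst rec) (simp add: s m0 m1 m2)
    have m4: "moment w s (Suc (Suc (Suc (Suc 0)))) = 3 * s^2 + s" by (subst rec) (simp add: s m0 m1 m2 m3 power2_eq_square algebra_simps)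
    have m5: "moment w s (Suc (Suc (Suc (Suc (Suc 0))))) = 10 * s^2 + s" by (subst rec) (simp add: s m0 m1 m2 m3 m4 power2_eq_square algebra_simps)
    have m6: "moment w s (Suc (Suc (Suc (Suc (Suc (Suc 0)))))) = 15 * s^3 + 25 * s^2 + s"
      by (subst rec) (simp add: s m0 m1 m2 m3 m4 m5 power2_eq_square power3_eq_cube algebra_simps)
    show ?thesis using m1 m2 m3 m4 m5 m6 by (simp add: eval_nat_numeral Directed drift_def)
  qed
  then show "moment w s 2 = s" "moment w s 4 = 3 * s\<^sup>2 + s" by auto
  assume s1: "s \<ge> 1"
  have "s\<^sup>2 \<le> s ^ 3" "s \<le> s ^ 3"
    using power_increasing[of 2 3 s] power_increasing[of 1 3 s] s1 by auto
  moreover have "s ^ 3 \<ge> 0" using s1 by simp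
  ultimately show "moment w s 6 \<le> 41 * s ^ 3" using all by (auto split: if_splits)
qed

section \<open>The local limit theorem\<close>

lemma Re_step_char: "Re (step_char w t) = cos t"
  by (cases w) (auto simp: step_char_def step_mean_def steps_def)

lemma step_char_taylor:
  "norm (step_char w t - 1 - \<i> * of_real (drift w * t) + of_real (t\<^sup>2 / 2)) \<le> \<bar>t\<bar> ^ 3 / 6"
proof -
  let ?f = "\<lambda>d. cis (of_int d * t) - 1 - \<i> * of_real (of_int d * t) + of_real (t\<^sup>2 / 2)"
  have "step_char w t - 1 - \<i> * of_real (drift w * t) + of_real (t\<^sup>2 / 2) = step_mean w ?f"
    by (cases w) (auto simp: step_char_def step_mean_def steps_def drift_def field_simps)
  moreover have "norm (step_mean w ?f) \<le> \<bar>t\<bar> ^ 3 / 6"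
  proof (rule norm_step_mean_le)
    fix d assume "d \<in> steps w"
    then have d: "\<bar>d\<bar> = 1" by (rule abs_steps)
    then have d2: "(of_int d * t)\<^sup>2 = t\<^sup>2" by (auto simp: abs_if power_mult_distrib split: if_splits)
    let ?u = "of_int d * t :: real"
    have eq: "?f d = iexp ?u - (\<Sum>k\<le>2. (\<i> * ?u) ^ k / fact k)"
    proof -
      have "(\<Sum>k\<le>2. (\<i> * of_real ?u) ^ k / fact k) = 1 + \<i> * of_real ?u - of_real (?u\<^sup>2 / 2)"
      proof -
        have "{..2::nat} = {0, 1, 2}" by auto
        then show ?thesis by (simp add: power_mult_distrib)
      qed
      then show ?thesis unfolding cis_conv_exp d2 by simp
    qed
    have "norm (?f d) \<le> \<bar>?u\<bar> ^ Suc 2 / fact (Suc 2)"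
      unfolding eq by (rule iexp_approx1)
    also have "\<dots> = \<bar>?u\<bar> ^ 3 / 6" by (simp add: eval_nat_numeral)
    also have "\<bar>?u\<bar> = \<bar>t\<bar>" using d by (simp add: abs_mult flip: of_int_abs)
    finally show "norm (?f d) \<le> \<bar>t\<bar> ^ 3 / 6" .
  qed
  ultimately show ?thesis by simp
qed

text \<open>This gives a Gaussian bound for the rescaled characteristic function that is uniform in the time. The constant
  \<open>1 / 12\<close> is what the Taylor polynomial of degree 2 yields on the whole interval, because \<open>\<pi>\<^sup>2 < 10\<close>.\<close>

lemma cos_le_quadratic:
  assumes "\<bar>t\<bar> \<le> pi"
  shows "cos t \<le> 1 - t\<^sup>2 / 12"
proof -
  have "Re (iexp t - (\<Sum>k\<le>3. (\<i> * t) ^ k / fact k)) \<le> \<bar>t\<bar> ^ 4 / 24"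
    using iexp_approx1[of t 3] complex_Re_le_cmod[of "iexp t - (\<Sum>k\<le>3. (\<i> * t) ^ k / fact k)"]
    by (simp add: eval_nat_numeral)
  moreover have "Re (iexp t - (\<Sum>k\<le>3. (\<i> * t) ^ k / fact k)) = cos t - (1 - t\<^sup>2 / 2)"
    by (simp add: eval_nat_numeral Re_exp)
  moreover have "\<bar>t\<bar> ^ 4 = t\<^sup>2 * t\<^sup>2" by (simp add: power_abs power4_eq_xxxx power2_eq_square)
  moreover have "t\<^sup>2 \<le> 10"
  proof -
    have "pi < 3.15" using pi_approx by simp
    then have "\<bar>t\<bar>\<^sup>2 \<le> 3.15\<^sup>2" using assms by (intro power_mono) auto
    then show ?thesis by (simp add: power2_eq_square)
  qed
  then have "t\<^sup>2 * t\<^sup>2 \<le> 10 * t\<^sup>2" by (intro mult_right_mono) auto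
  ultimately show ?thesis by linarith
qed

text \<open>The characteristic function of the standardised position. It is cut off outside the rescaled interval of
  integration, which makes it integrable over the whole line.\<close>

definition scaled_char :: "walk_type \<Rightarrow> real \<Rightarrow> real \<Rightarrow> complex" where
  "scaled_char w s u = indicator {- pi * sqrt s..pi * sqrt s} u *\<^sub>R
     (cis (- (drift w * sqrt s * u)) * exp (of_real s * (step_char w (u / sqrt s) - 1)))"

lemma scaled_char_measurable [measurable]: "scaled_char w s \<in> borel_measurable borel"
  unfolding scaled_char_def[abs_def] by measurable

lemma norm_scaled_char_le:
  assumes "s > 0"
  shows "norm (scaled_char w s u) \<le> exp (- u\<^sup>2 / 12)"
proof (cases "u \<in> {- pi * sqrt s..pi * sqrt s}")
  case True
  then have "\<bar>u\<bar> \<le> pi * sqrt s" by auto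
  then have le: "\<bar>u / sqrt s\<bar> \<le> pi" using assms by (simp add: abs_divide field_simps)
  have "norm (scaled_char w s u) = exp (s * (cos (u / sqrt s) - 1))"
    using True by (simp add: scaled_char_def norm_mult norm_exp_eq_Re Re_step_char)
  also have "\<dots> \<le> exp (s * (- (u / sqrt s)\<^sup>2 / 12))"
  proof -
    have "s * (cos (u / sqrt s) - 1) \<le> s * (- (u / sqrt s)\<^sup>2 / 12)"
      by (rule mult_left_mono) (use cos_le_quadratic[OF le] assms in auto)
    then show ?thesis by simp
  qed
  also have "\<dots> = exp (- u\<^sup>2 / 12)" using assms by (simp add: power_divide)
  finally show ?thesis .
qed (simp add: scaled_char_def)

lemma scaled_char_tendsto: "((\<lambda>s. scaled_char w s u) \<longlongrightarrow> of_real (exp (- u\<^sup>2 / 2))) at_top"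
proof -
  have "((\<lambda>s. of_real s * (step_char w (u / sqrt s) - 1 - \<i> * of_real (drift w * (u / sqrt s))) + of_real (u\<^sup>2 / 2)) \<longlongrightarrow> 0) at_top"
  proof (rule Lim_null_comparison)
    show "\<forall>\<^sub>F s in at_top. norm (of_real s * (step_char w (u / sqrt s) - 1 - \<i> * of_real (drift w * (u / sqrt s))) + of_real (u\<^sup>2 / 2))
        \<le> \<bar>u\<bar> ^ 3 / 6 / sqrt s"
      using eventually_gt_at_top[of 0]
    proof eventually_elim
      case (elim s)
      let ?t = "u / sqrt s"
      have "of_real s * (step_char w ?t - 1 - \<i> * of_real (drift w * ?t)) + of_real (u\<^sup>2 / 2)
        = of_real s * (step_char w ?t - 1 - \<i> * of_real (drift w * ?t) + of_real (?t\<^sup>2 / 2))"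
      proof -
        have e: "s * (?t\<^sup>2 / 2) = u\<^sup>2 / 2" using elim by (simp add: power_divide)
        show ?thesis unfolding e[symmetric] of_real_mult by (simp add: distrib_left)
      qed
      also have "norm \<dots> \<le> s * (\<bar>?t\<bar> ^ 3 / 6)"
        unfolding norm_mult using elim step_char_taylor[of w ?t] by (simp add: mult_left_mono)
      also have "\<dots> = \<bar>u\<bar> ^ 3 / 6 / sqrt s"
        using elim by (simp add: abs_divide power_divide power3_eq_cube field_simps)
      finally show ?case .
    qed
    show "((\<lambda>s. \<bar>u\<bar> ^ 3 / 6 / sqrt s) \<longlongrightarrow> 0) at_top" by real_asymp
  qed
  then have "((\<lambda>s. exp (of_real s * (step_char w (u / sqrt s) - 1 - \<i> * of_real (drift w * (u / sqrt s))) + of_real (u\<^sup>2 / 2) - of_real (u\<^sup>2 / 2)))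
      \<longlongrightarrow> exp (0 - of_real (u\<^sup>2 / 2))) at_top"
    by (intro tendsto_intros)
  moreover have "\<forall>\<^sub>F s in at_top. exp (of_real s * (step_char w (u / sqrt s) - 1 - \<i> * of_real (drift w * (u / sqrt s))) + of_real (u\<^sup>2 / 2) - of_real (u\<^sup>2 / 2))
     = scaled_char w s u"
  proof -
    have "\<forall>\<^sub>F s in at_top. \<bar>u\<bar> \<le> pi * sqrt s" by real_asymp
    then show ?thesis using eventually_gt_at_top[of 0]
    proof eventually_elim
      case (elim s)
      then have "u \<in> {- pi * sqrt s..pi * sqrt s}" by auto
      then have "scaled_char w s u = exp (\<i> * of_real (- (drift w * sqrt s * u))) * exp (of_real s * (step_char w (u / sqrt s) - 1))"
        by (simp add: scaled_char_def cis_conv_exp)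
      also have "\<dots> = exp (\<i> * of_real (- (drift w * sqrt s * u)) + of_real s * (step_char w (u / sqrt s) - 1))"
        by (rule exp_add[symmetric])
      also have "of_real (- (drift w * sqrt s * u)) = - (of_real s * of_real (drift w * (u / sqrt s)) :: complex)"
      proof -
        have "s / sqrt s = sqrt s" using elim by (simp add: real_div_sqrt)
        moreover have "s * (drift w * (u / sqrt s)) = drift w * (s / sqrt s) * u" by simp
        ultimately show ?thesis unfolding of_real_mult[symmetric] by simp
      qed
      finally show ?case by (simp add: algebra_simps)
    qed
  qed
  ultimately have "((\<lambda>s. scaled_char w s u) \<longlongrightarrow> exp (0 - of_real (u\<^sup>2 / 2))) at_top"
    by (rule Lim_transform_eventually)
  moreover have "exp (0 - of_real (u\<^sup>2 / 2)) = (of_real (exp (- u\<^sup>2 / 2)) :: complex)"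
    by (simp flip: exp_of_real)
  ultimately show ?thesis by simp
qed

lemma integrable_gauss: "c > 0 \<Longrightarrow> integrable lborel (\<lambda>u::real. exp (- u\<^sup>2 / c))"
proof -
  assume c: "c > 0"
  have "integrable lborel (\<lambda>u. sqrt (pi * c) * normal_density 0 (sqrt (c / 2)) u)"
    using c by (intro integrable_mult_right integrable_normal_density) auto
  moreover have "sqrt (pi * c) * normal_density 0 (sqrt (c / 2)) u = exp (- u\<^sup>2 / c)" for u
    using c by (simp add: normal_density_def)
  ultimately show ?thesis by simp
qed

definition zscore :: "walk_type \<Rightarrow> real \<Rightarrow> int \<Rightarrow> real" where
  "zscore w s x = (of_int x - s * drift w) / sqrt s"

lemma heat_scaled_fourier:
  assumes "s > 0"
  shows "of_real (sqrt (2 * pi * s) * heat w s x) =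
    (LINT u|lborel. cis (- (zscore w s x * u)) * scaled_char w s u) / sqrt (2 * pi)"
proof -
  let ?F = "\<lambda>t. cis (- (of_int x * t)) * exp (of_real s * (step_char w t - 1))"
  have m: "?F \<in> borel_measurable borel" by measurable
  have "of_real (heat w s x) = (LINT t|circle. ?F t)"
    using coord_law_fourier[of 1 s w x] assms by (simp add: heat_def)
  also have "\<dots> = (LINT t|lborel. indicator {-pi..pi} t *\<^sub>R ?F t) / (2*pi)"
    by (subst integral_circle[OF m]) (simp add: set_lebesgue_integral_def)
  also have "(LINT t|lborel. indicator {-pi..pi} t *\<^sub>R ?F t) =
      \<bar>1 / sqrt s\<bar> *\<^sub>R (LINT u|lborel. indicator {-pi..pi} (0 + 1 / sqrt s * u) *\<^sub>R ?F (0 + 1 / sqrt s * u))"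
    by (rule lborel_integral_real_affine) (use assms in auto)
  also have "\<dots> = of_real (1 / sqrt s) * (LINT u|lborel. cis (- (zscore w s x * u)) * scaled_char w s u)"
  proof -
    have "indicator {-pi..pi} (0 + 1 / sqrt s * u) *\<^sub>R ?F (0 + 1 / sqrt s * u) = cis (- (zscore w s x * u)) * scaled_char w s u" for u
    proof -
      have i: "indicator {-pi..pi} (0 + 1 / sqrt s * u) = (indicator {- pi * sqrt s..pi * sqrt s} u :: real)"
        using assms by (auto simp: indicator_def field_simps)
      have "- (zscore w s x * u) + - (drift w * sqrt s * u) = - (of_int x * (u / sqrt s))"
      proof -
        have "s / sqrt s = sqrt s" using assms by (simp add: real_div_sqrt)
        then have "drift w * sqrt s * u = s * drift w / sqrt s * u" by (metis mult.commute times_divide_eq_left)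
        then show ?thesis by (simp add: zscore_def diff_divide_distrib algebra_simps)
      qed
      then have "cis (- (zscore w s x * u)) * cis (- (drift w * sqrt s * u)) = cis (- (of_int x * (u / sqrt s)))"
        by (simp add: cis_mult)
      then show ?thesis unfolding i scaled_char_def
        by (simp add: mult.assoc[symmetric] scaleR_conv_of_real)
    qed
    then show ?thesis using assms by (simp add: scaleR_conv_of_real)
  qed
  finally have "of_real (heat w s x) = of_real (1 / sqrt s) * (LINT u|lborel. cis (- (zscore w s x * u)) * scaled_char w s u) / (2*pi)" .
  moreover have "sqrt (2 * pi * s) * (1 / sqrt s) / (2 * pi) = 1 / sqrt (2 * pi)"
    using assms by (simp add: real_sqrt_mult field_simps)
  then have "of_real (sqrt (2 * pi * s)) * of_real (1 / sqrt s) / of_real (2 * pi) = (1 / of_real (sqrt (2 * pi)) :: complex)"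
    by (metis of_real_1 of_real_divide of_real_mult)
  ultimately show ?thesis
    by (simp only: of_real_mult) (simp add: field_simps)
qed

lemma gauss_fourier: "of_real (exp (- z\<^sup>2 / 2)) = (LINT u|lborel. cis (- (z * u)) * of_real (exp (- u\<^sup>2 / 2))) / sqrt (2 * pi)"
proof -
  have "of_real (exp (- z\<^sup>2 / 2)) = char std_normal_distribution (- z)"
    by (simp add: char_std_normal_distribution)
  also have "\<dots> = (LINT u|lborel. std_normal_density u *\<^sub>R iexp (- z * u))"
    unfolding char_def by (subst integral_density) auto
  also have "\<dots> = (LINT u|lborel. (cis (- (z * u)) * of_real (exp (- u\<^sup>2 / 2))) / sqrt (2 * pi))"
    by (intro Bochner_Integration.integral_cong refl)
       (simp add: std_normal_density_def scaleR_conv_of_real cis_conv_exp)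
  finally show ?thesis by simp
qed

text \<open>By \<open>heat_scaled_fourier\<close> and \<open>gauss_fourier\<close> both terms are Fourier integrals at the same frequency, so the
  difference is at most the \<open>L\<^sup>1\<close> distance of the two characteristic functions, uniformly in \<open>x\<close>. Dominated
  convergence makes it vanish.\<close>

lemma local_limit:
  obtains \<epsilon> where "(\<epsilon> \<longlongrightarrow> 0) at_top"
    "\<And>s x. s > 0 \<Longrightarrow> \<bar>sqrt (2 * pi * s) * heat w s x - exp (- (zscore w s x)\<^sup>2 / 2)\<bar> \<le> \<epsilon> s"
proof
  let ?d = "\<lambda>s u. norm (scaled_char w s u - of_real (exp (- u\<^sup>2 / 2)))"
  let ?e = "\<lambda>s. LINT u|lborel. ?d s u"
  have int_s: "integrable lborel (\<lambda>u. scaled_char w s u)" if "s > 0" for s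
    by (rule Bochner_Integration.integrable_bound[OF integrable_gauss[of 12]]) (use norm_scaled_char_le[OF that] in auto)
  have int_g: "integrable lborel (\<lambda>u. of_real (exp (- u\<^sup>2 / 2)) :: complex)"
    by (intro integrable_of_real integrable_gauss) simp
  have "(?e \<longlongrightarrow> (LINT u|(lborel :: real measure). (0::real))) at_top"
  proof (rule integral_dominated_convergence_at_top[where w = "\<lambda>u. exp (- u\<^sup>2 / 12) + exp (- u\<^sup>2 / 2)"])
    show "integrable lborel (\<lambda>u::real. exp (- u\<^sup>2 / 12) + exp (- u\<^sup>2 / 2))"
      by (intro Bochner_Integration.integrable_add integrable_gauss) auto
    show "AE u in lborel. ((\<lambda>s. ?d s u) \<longlongrightarrow> 0) at_top"
      using scaled_char_tendsto[of w] by (auto intro!: tendsto_norm_zero simp: LIM_zero_iff)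
    show "\<forall>\<^sub>F s in at_top. AE u in lborel. norm (?d s u) \<le> exp (- u\<^sup>2 / 12) + exp (- u\<^sup>2 / 2)"
      using eventually_gt_at_top[of 0]
    proof eventually_elim
      case (elim s)
      have "?d s u \<le> exp (- u\<^sup>2 / 12) + exp (- u\<^sup>2 / 2)" for u
        using norm_triangle_ineq4[of "scaled_char w s u" "of_real (exp (- u\<^sup>2 / 2))"] norm_scaled_char_le[OF elim, of w u]
        by simp
      then show ?case by auto
    qed
  qed auto
  then show "((\<lambda>s. ?e s / sqrt (2 * pi)) \<longlongrightarrow> 0) at_top"
    using tendsto_divide_zero by auto
  fix s :: real and x assume s: "s > 0"
  let ?z = "zscore w s x"
  have bound: "integrable lborel (\<lambda>u. cis (- (?z * u)) * f u)" if "integrable lborel f" for f :: "real \<Rightarrow> complex"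
    by (rule Bochner_Integration.integrable_bound[OF that]) (use that in \<open>auto simp: norm_mult\<close>)
  let ?S = "\<lambda>u. cis (- (?z * u)) * scaled_char w s u" and ?G = "\<lambda>u. cis (- (?z * u)) * of_real (exp (- u\<^sup>2 / 2))"
  have "of_real (sqrt (2 * pi * s) * heat w s x - exp (- ?z\<^sup>2 / 2)) =
     (LINT u|lborel. ?S u) / sqrt (2 * pi) - (LINT u|lborel. ?G u) / sqrt (2 * pi)"
    by (simp only: of_real_diff heat_scaled_fourier[OF s] gauss_fourier[of ?z])
  also have "\<dots> = ((LINT u|lborel. ?S u) - (LINT u|lborel. ?G u)) / sqrt (2 * pi)"
    by (rule diff_divide_distrib[symmetric])
  also have "(LINT u|lborel. ?S u) - (LINT u|lborel. ?G u) = (LINT u|lborel. ?S u - ?G u)"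
    by (rule Bochner_Integration.integral_diff[OF bound[OF int_s[OF s]] bound[OF int_g], symmetric])
  also have "\<dots> = (LINT u|lborel. cis (- (?z * u)) * (scaled_char w s u - of_real (exp (- u\<^sup>2 / 2))))"
    by (simp only: right_diff_distrib)
  finally have eq: "of_real (sqrt (2 * pi * s) * heat w s x - exp (- ?z\<^sup>2 / 2)) =
     (LINT u|lborel. cis (- (?z * u)) * (scaled_char w s u - of_real (exp (- u\<^sup>2 / 2)))) / sqrt (2 * pi)" .
  have "\<bar>sqrt (2 * pi * s) * heat w s x - exp (- ?z\<^sup>2 / 2)\<bar> =
     norm (of_real (sqrt (2 * pi * s) * heat w s x - exp (- ?z\<^sup>2 / 2)) :: complex)"
    by (simp only: norm_of_real)
  also have "\<dots> = norm (LINT u|lborel. cis (- (?z * u)) * (scaled_char w s u - of_real (exp (- u\<^sup>2 / 2)))) / sqrt (2 * pi)"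
    by (simp only: eq norm_divide norm_of_real) simp
  also have "\<dots> \<le> (LINT u|lborel. norm (cis (- (?z * u)) * (scaled_char w s u - of_real (exp (- u\<^sup>2 / 2))))) / sqrt (2 * pi)"
    by (intro divide_right_mono integral_norm_bound) auto
  finally show "\<bar>sqrt (2 * pi * s) * heat w s x - exp (- ?z\<^sup>2 / 2)\<bar> \<le> ?e s / sqrt (2 * pi)"
    by (simp add: norm_mult)
qed

section \<open>Information content at large times\<close>

lemma sums_E_rw:
  assumes "integrable (measure_pmf (coord_law w 1 s)) f"
  shows "(\<lambda>n. heat w s (int_decode n) * f (int_decode n)) sums E_rw w s f"
proof -
  have "integrable (count_space UNIV) (\<lambda>n. heat w s (int_decode n) * f (int_decode n))"
    using assms integrable_bij_count_space[OF bij_int_decode, of "\<lambda>x. heat w s x * f x"]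
    unfolding integrable_rw_iff by simp
  from sums_integral_count_space_nat[OF this] show ?thesis
    using integral_bij_count_space[OF bij_int_decode, of "\<lambda>x. heat w s x * f x"]
    unfolding E_rw_count by simp
qed

text \<open>The sum is compared with the telescoping increments of \<open>arctan\<close>, whose derivative is the summand. The factor 3
  pays for the variation of the summand over one lattice step, which is at most 1 on the scale of \<open>zscore\<close>.\<close>

lemma sum_int_le_arctan:
  assumes "s \<ge> 1"
  shows "(\<Sum>x\<in>{-int N..<int N}. 1 / (sqrt s * (1 + (zscore w s x)\<^sup>2))) \<le> 3 * pi"
proof -
  let ?a = "\<lambda>x. arctan (zscore w s x)"
  have le: "1 / (sqrt s * (1 + (zscore w s x)\<^sup>2)) \<le> 3 * (?a (x + 1) - ?a x)" for x
  proof -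
    define z where "z = zscore w s x"
    define h where "h = 1 / sqrt s"
    have h: "0 < h" "h \<le> 1" using assms by (auto simp: h_def)
    have z1: "zscore w s (x + 1) = z + h"
      by (simp add: z_def h_def zscore_def diff_divide_distrib add_divide_distrib)
    have "\<exists>\<xi>. z < \<xi> \<and> \<xi> < z + h \<and> arctan (z + h) - arctan z = (z + h - z) * inverse (1 + \<xi>\<^sup>2)"
      using h by (intro MVT2) (auto intro!: DERIV_arctan)
    then obtain \<xi> where \<xi>: "z < \<xi>" "\<xi> < z + h" "arctan (z + h) - arctan z = h * inverse (1 + \<xi>\<^sup>2)" by auto
    have "\<bar>\<xi> - z\<bar> \<le> 1" using \<xi> h by auto
    then have f1: "(\<xi> - z)\<^sup>2 \<le> 1" by (simp add: abs_square_le_1)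
    have f2: "\<xi>\<^sup>2 \<le> 2 * z\<^sup>2 + 2 * (\<xi> - z)\<^sup>2"
    proof -
      have "2 * z\<^sup>2 + 2 * (\<xi> - z)\<^sup>2 - \<xi>\<^sup>2 = (\<xi> - 2 * z)\<^sup>2" by (simp add: power2_eq_square algebra_simps)
      then show ?thesis using zero_le_power2[of "\<xi> - 2 * z"] by linarith
    qed
    have "\<xi>\<^sup>2 \<le> 2 * z\<^sup>2 + 2 * 1"
      by (rule order_trans[OF f2]) (intro add_left_mono mult_left_mono f1, simp)
    then have "1 + \<xi>\<^sup>2 \<le> 3 * (1 + z\<^sup>2)" using zero_le_power2[of z] unfolding distrib_left by linarith
    then have "inverse (3 * (1 + z\<^sup>2)) \<le> inverse (1 + \<xi>\<^sup>2)"
      by (intro le_imp_inverse_le) (auto simp: add_pos_nonneg)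
    then have "h * inverse (3 * (1 + z\<^sup>2)) \<le> h * inverse (1 + \<xi>\<^sup>2)" using h by (intro mult_left_mono) auto
    then have "h * inverse (1 + z\<^sup>2) \<le> 3 * (arctan (z + h) - arctan z)" unfolding \<xi>(3) inverse_mult_distrib by simp
    then show ?thesis unfolding z1 z_def[symmetric] by (simp add: h_def divide_inverse)
  qed
  have tele: "(\<Sum>x\<in>{-int N..<int N}. ?a (x + 1) - ?a x) = ?a (int N) - ?a (- int N)"
  proof (induction N)
    case (Suc N)
    have e: "int (Suc N) = int N + 1" "- int (Suc N) = - int N - 1" by auto
    have "{-int N - 1..<int N + 1} = insert (- int N - 1) (insert (int N) {-int N..<int N})" by auto
    then show ?case using Suc unfolding e by simp
  qed simp
  have "(\<Sum>x\<in>{-int N..<int N}. 1 / (sqrt s * (1 + (zscore w s x)\<^sup>2))) \<le> 3 * (?a (int N) - ?a (- int N))"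
    unfolding tele[symmetric] sum_distrib_left by (intro sum_mono le)
  also have "\<dots> \<le> 3 * pi"
    using arctan_bounded[of "zscore w s (int N)"] arctan_bounded[of "zscore w s (- int N)"] by simp
  finally show ?thesis .
qed

lemma cauchy_series:
  assumes "s \<ge> 1"
  shows "summable (\<lambda>n. 1 / (sqrt s * (1 + (zscore w s (int_decode n))\<^sup>2)))"
    "(\<Sum>n. 1 / (sqrt s * (1 + (zscore w s (int_decode n))\<^sup>2))) \<le> 3 * pi"
proof -
  let ?f = "\<lambda>x. 1 / (sqrt s * (1 + (zscore w s x)\<^sup>2))"
  have nn: "?f x \<ge> 0" for x using assms by simp
  have le: "(\<Sum>n<N. ?f (int_decode n)) \<le> 3 * pi" for N
  proof -
    have "(\<Sum>n<N. ?f (int_decode n)) = (\<Sum>x\<in>int_decode ` {..<N}. ?f x)"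
      by (rule sum.reindex_cong[symmetric, of int_decode, OF _ refl refl, THEN sym, THEN sym]) (auto simp: inj_int_decode)
    also have "\<dots> \<le> (\<Sum>x\<in>{-int N..<int N}. ?f x)"
    proof (rule sum_mono2)
      show "int_decode ` {..<N} \<subseteq> {-int N..<int N}"
        by (auto simp: int_decode_def sum_decode_def)
    qed (use nn in auto)
    also have "\<dots> \<le> 3 * pi" by (rule sum_int_le_arctan[OF assms])
    finally show ?thesis .
  qed
  show 1: "summable (\<lambda>n. ?f (int_decode n))"
    by (rule summableI_nonneg_bounded[OF nn le])
  show "(\<Sum>n. ?f (int_decode n)) \<le> 3 * pi"
    by (rule suminf_le_const[OF 1 le])
qed

text \<open>The deviation of the information content from its Gaussian value.\<close>

definition info_err :: "walk_type \<Rightarrow> real \<Rightarrow> int \<Rightarrow> real" where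
  "info_err w s x = - ln (heat w s x) - ln (2 * pi * s) / 2 - (zscore w s x)\<^sup>2 / 2"

lemma E_zscore:
  assumes "s > 0"
  shows "integrable (measure_pmf (coord_law w 1 s)) (\<lambda>x. zscore w s x ^ j)"
    "E_rw w s (\<lambda>x. zscore w s x ^ j) = moment w s j / sqrt s ^ j"
proof -
  have int: "integrable (measure_pmf (coord_law w 1 s)) (\<lambda>x. (of_int x - s * drift w) ^ j)" for j
    using integrable_power[of s w "- s * drift w" j] assms by simp
  then show "integrable (measure_pmf (coord_law w 1 s)) (\<lambda>x. zscore w s x ^ j)"
    "E_rw w s (\<lambda>x. zscore w s x ^ j) = moment w s j / sqrt s ^ j"
    unfolding zscore_def power_divide moment_def by auto
qed

lemma integrable_info_err:
  assumes "s > 0"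
  shows "integrable (measure_pmf (coord_law w 1 s)) (info_err w s)"
    "integrable (measure_pmf (coord_law w 1 s)) (\<lambda>x. (info_err w s x)\<^sup>2)"
proof -
  have s0: "s \<ge> 0" using assms by simp
  note i = entropy_series(1,2)[OF s0, of w] E_zscore(1)[OF assms, of w]
  show "integrable (measure_pmf (coord_law w 1 s)) (info_err w s)"
    unfolding info_err_def by (intro Bochner_Integration.integrable_diff integrable_minus i integrable_divide) auto
  let ?c = "ln (2 * pi * s) / 2"
  show "integrable (measure_pmf (coord_law w 1 s)) (\<lambda>x. (info_err w s x)\<^sup>2)"
  proof (rule Bochner_Integration.integrable_bound)
    show "integrable (measure_pmf (coord_law w 1 s)) (\<lambda>x. 3 * ((ln (heat w s x))\<^sup>2 + ?c\<^sup>2 + zscore w s x ^ 4))"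
      by (intro integrable_mult_right Bochner_Integration.integrable_add i) auto
    have "(a + b + c / 2)\<^sup>2 \<le> 3 * (a\<^sup>2 + b\<^sup>2 + c\<^sup>2)" for a b c :: real
    proof -
      have "3 * (a\<^sup>2 + b\<^sup>2 + c\<^sup>2) - (a + b + c / 2)\<^sup>2 = (a - b)\<^sup>2 + (a - c/2)\<^sup>2 + (b - c/2)\<^sup>2 + 9/4 * c\<^sup>2"
        by (simp add: power2_eq_square algebra_simps)
      then show ?thesis
        using zero_le_power2[of "a - b"] zero_le_power2[of "a - c/2"] zero_le_power2[of "b - c/2"] zero_le_power2[of c]
        by linarith
    qed
    from this[of "ln (heat w s x)" ?c "(zscore w s x)\<^sup>2" for x]
    have "(info_err w s x)\<^sup>2 \<le> 3 * ((ln (heat w s x))\<^sup>2 + ?c\<^sup>2 + zscore w s x ^ 4)" for x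
      unfolding info_err_def
      by (simp add: power2_eq_square power4_eq_xxxx algebra_simps)
    then show "AE x in measure_pmf (coord_law w 1 s). norm ((info_err w s x)\<^sup>2) \<le> norm (3 * ((ln (heat w s x))\<^sup>2 + ?c\<^sup>2 + zscore w s x ^ 4))"
      by (intro always_eventually allI) (simp add: order_trans[OF _ abs_ge_self])
  qed simp
qed

lemma ln_sq_le:
  fixes u :: real
  assumes "u \<ge> 1" shows "(ln u)\<^sup>2 \<le> 4 * u"
proof -
  have "ln (sqrt u) \<le> sqrt u - 1" using assms by (intro ln_le_minus_one) auto
  then have "ln u \<le> 2 * sqrt u" using assms by (simp add: ln_sqrt)
  then have "(ln u)\<^sup>2 \<le> (2 * sqrt u)\<^sup>2" using assms by (intro power_mono) auto
  then show ?thesis using assms by (simp add: power_mult_distrib)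
qed

text \<open>The term \<open>q / W\<close>, with \<open>q = 1 / (1 + z\<^sup>2)\<^sup>2\<close>, avoids any lower bound for the density. Here \<open>W\<close> is the rescaled
  density. If \<open>W\<close> is tiny, then \<open>(ln W)\<^sup>2\<close> is large, but multiplied by the mass it costs at most the reference
  density \<open>q\<close>, whose tails are small.\<close>

lemma ln_sq_le_weight:
  fixes W z :: real
  assumes "0 < W" "W \<le> exp 1"
  shows "(ln W)\<^sup>2 \<le> 1 + 8 / (W * (1 + z\<^sup>2)\<^sup>2) + 8 * z ^ 4"
proof -
  define q where "q = 1 / (1 + z\<^sup>2)\<^sup>2"
  have z: "1 + z\<^sup>2 > 0" by (simp add: add_pos_nonneg)
  have q: "q > 0" using z by (simp add: q_def)
  have lq: "ln (1 / q) = 2 * ln (1 + z\<^sup>2)" using z by (simp add: q_def ln_realpow)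
  have "ln (1 + z\<^sup>2) \<le> z\<^sup>2" using ln_le_minus_one[OF z] by simp
  then have lq2: "0 \<le> ln (1 / q)" "ln (1 / q) \<le> 2 * z\<^sup>2" unfolding lq by auto
  have z4: "(2 * z\<^sup>2)\<^sup>2 = 4 * z ^ 4" by (simp add: power_mult_distrib flip: power_mult)
  have nn: "0 \<le> 8 * (q / W)" "0 \<le> 8 * z ^ 4" using q assms by auto
  have "(ln W)\<^sup>2 \<le> 1 + 8 * (q / W) + 8 * z ^ 4"
  proof (cases "W \<ge> 1")
    case True
    have "ln W \<le> 1" using assms ln_le_cancel_iff[of W "exp 1"] by simp
    then have "(ln W)\<^sup>2 \<le> 1" using True by (simp add: abs_square_le_1)
    then show ?thesis using nn by linarith
  next
    case False
    then have lW: "0 \<le> ln (1 / W)" using assms by simp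
    have sq: "(ln W)\<^sup>2 = (ln (1 / W))\<^sup>2" using assms by (simp add: ln_div)
    show ?thesis
    proof (cases "q \<ge> W")
      case True
      have "ln (1 / W) = ln (q / W) + ln (1 / q)" using assms q by (simp add: ln_div)
      also have "\<dots>\<^sup>2 \<le> 2 * (ln (q / W))\<^sup>2 + 2 * (ln (1 / q))\<^sup>2"
        using zero_le_power2[of "ln (q / W) - ln (1 / q)"] by (simp add: power2_eq_square algebra_simps)
      also have "(ln (q / W))\<^sup>2 \<le> 4 * (q / W)" using True assms by (intro ln_sq_le) simp
      also have "(ln (1 / q))\<^sup>2 \<le> (2 * z\<^sup>2)\<^sup>2" using lq2 by (intro power_mono) auto
      finally have "(ln (1 / W))\<^sup>2 \<le> 8 * (q / W) + 8 * z ^ 4" unfolding z4 by simp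
      then show ?thesis unfolding sq by simp
    next
      case False
      then have "ln (1 / W) \<le> ln (1 / q)" using q assms by (simp add: frac_le)
      then have "(ln (1 / W))\<^sup>2 \<le> (2 * z\<^sup>2)\<^sup>2" using lW lq2 by (intro power_mono) auto
      then show ?thesis unfolding sq z4 using nn by linarith
    qed
  qed
  then show ?thesis by (simp add: q_def mult.commute)
qed

text \<open>For \<open>\<bar>zscore\<bar> \<le> M\<close> the local limit theorem makes the error small, which is the first term. Beyond \<open>M\<close> the sixth
  moment and the reference density of \<open>ln_sq_le_weight\<close> take over, each with a factor \<open>1 / M\<^sup>2\<close> to spare.\<close>

lemma info_err_pointwise:
  assumes s: "s \<ge> 1" and M: "M \<ge> 1" and \<eta>: "0 < \<eta>" "\<eta> \<le> 1/2"
    and lcl: "\<bar>sqrt (2 * pi * s) * heat w s x - exp (- (zscore w s x)\<^sup>2 / 2)\<bar> \<le> \<eta> * exp (- M\<^sup>2 / 2)"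
  shows "heat w s x * (info_err w s x)\<^sup>2 \<le> 4 * \<eta>\<^sup>2 * heat w s x + 19 / M\<^sup>2 * (heat w s x * zscore w s x ^ 6)
     + 16 / M\<^sup>2 * (1 / (sqrt s * (1 + (zscore w s x)\<^sup>2)))"
proof -
  define z where "z = zscore w s x"
  define W where "W = sqrt (2 * pi * s) * heat w s x"
  define D where "D = info_err w s x"
  let ?h = "heat w s x"
  have nn: "0 \<le> 4 * \<eta>\<^sup>2 * ?h" "0 \<le> 19 / M\<^sup>2 * (?h * z ^ 6)" "0 \<le> 16 / M\<^sup>2 * (1 / (sqrt s * (1 + z\<^sup>2)))"
    using s by auto
  show ?thesis
  proof (cases "?h = 0")
    case True
    then show ?thesis using nn unfolding z_def by simp
  next
    case False
    then have h: "?h > 0" using heat_nonneg[of w s x] by linarith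
    have W: "W > 0" using h s by (simp add: W_def)
    have lnW: "ln W = ln (2 * pi * s) / 2 + ln ?h" using h s by (simp add: W_def ln_mult ln_sqrt)
    have D: "D = - ln W - z\<^sup>2 / 2" by (simp add: D_def info_err_def lnW z_def)
    have eM: "exp (- M\<^sup>2 / 2) \<le> 1" by simp
    have lcl': "\<bar>W - exp (- z\<^sup>2 / 2)\<bar> \<le> \<eta> * exp (- M\<^sup>2 / 2)" using lcl by (simp add: W_def z_def)
    show ?thesis
    proof (cases "\<bar>z\<bar> \<le> M")
      case True
      then have "z\<^sup>2 \<le> M\<^sup>2" using M by (simp add: abs_le_square_iff[symmetric])
      define y where "y = W * exp (z\<^sup>2 / 2) - 1"
      have "\<bar>y\<bar> = exp (z\<^sup>2 / 2) * \<bar>W - exp (- z\<^sup>2 / 2)\<bar>"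
      proof -
        have "y = exp (z\<^sup>2 / 2) * (W - exp (- z\<^sup>2 / 2))"
          by (simp add: y_def right_diff_distrib mult.commute flip: exp_add)
        then show ?thesis by (simp add: abs_mult)
      qed
      also have "\<dots> \<le> exp (M\<^sup>2 / 2) * (\<eta> * exp (- M\<^sup>2 / 2))"
        using lcl' \<open>z\<^sup>2 \<le> M\<^sup>2\<close> by (intro mult_mono) auto
      also have "\<dots> = \<eta> * (exp (M\<^sup>2 / 2) * exp (- M\<^sup>2 / 2))" by simp
      also have "exp (M\<^sup>2 / 2) * exp (- M\<^sup>2 / 2) = 1" by (simp flip: exp_add)
      finally have y: "\<bar>y\<bar> \<le> \<eta>" by simp
      have "\<bar>ln (1 + y) - y\<bar> \<le> 2 * y\<^sup>2" using y \<eta> by (intro abs_ln_one_plus_x_minus_x_bound) auto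
      moreover have "2 * y\<^sup>2 \<le> \<bar>y\<bar>"
      proof -
        have "2 * \<bar>y\<bar> * \<bar>y\<bar> \<le> 1 * \<bar>y\<bar>" using y \<eta> by (intro mult_right_mono) auto
        then show ?thesis by (simp add: power2_eq_square)
      qed
      ultimately have l2: "\<bar>ln (1 + y)\<bar> \<le> 2 * \<eta>" using y by linarith
      have "ln (1 + y) = ln W + z\<^sup>2 / 2" using W by (simp add: y_def ln_mult)
      then have "\<bar>D\<bar> \<le> 2 * \<eta>" using l2 unfolding D by linarith
      then have "\<bar>D\<bar>\<^sup>2 \<le> (2 * \<eta>)\<^sup>2" by (intro power_mono) auto
      then have "D\<^sup>2 \<le> (2 * \<eta>)\<^sup>2" by simp
      then have "?h * D\<^sup>2 \<le> ?h * (4 * \<eta>\<^sup>2)" by (intro mult_left_mono) (auto simp: power_mult_distrib)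
      then have "?h * D\<^sup>2 \<le> 4 * \<eta>\<^sup>2 * ?h" by (simp only: mult.commute)
      then show ?thesis using nn unfolding z_def D_def by linarith
    next
      case False
      have z2: "M\<^sup>2 \<le> z\<^sup>2" using False M by (simp add: abs_le_square_iff[symmetric])
      have M2: "1 \<le> M\<^sup>2" using M by (simp add: one_le_power)
      have "W \<le> exp (- z\<^sup>2 / 2) + \<eta> * exp (- M\<^sup>2 / 2)" using lcl' by linarith
      also have "\<dots> \<le> 1 + 1/2 * 1" using \<eta> eM by (intro add_mono mult_mono) auto
      also have "\<dots> \<le> exp 1" using exp_ge_add_one_self[of 1] by simp
      finally have We: "W \<le> exp 1" .
      have "D\<^sup>2 \<le> 2 * (ln W)\<^sup>2 + z ^ 4 / 2"
      proof -
        have "2 * (ln W)\<^sup>2 + z ^ 4 / 2 - D\<^sup>2 = (ln W - z\<^sup>2 / 2)\<^sup>2"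
          unfolding D by (simp add: power2_eq_square power4_eq_xxxx algebra_simps)
        then show ?thesis using zero_le_power2[of "ln W - z\<^sup>2 / 2"] by linarith
      qed
      also have "\<dots> \<le> 2 * (1 + 8 / (W * (1 + z\<^sup>2)\<^sup>2) + 8 * z ^ 4) + z ^ 4 / 2"
        using ln_sq_le_weight[OF W We, of z] by simp
      also have "\<dots> \<le> 19 / M\<^sup>2 * z ^ 6 + 16 / (W * (1 + z\<^sup>2)\<^sup>2)"
      proof -
        have z46: "z ^ 4 \<le> z ^ 6 / M\<^sup>2"
        proof -
          have "z ^ 4 * M\<^sup>2 \<le> z ^ 4 * z\<^sup>2" using z2 by (intro mult_left_mono) auto
          also have "\<dots> = z ^ 6" by (simp flip: power_add)
          finally show ?thesis using M2 by (intro mult_imp_le_div_pos) linarith+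
        qed
        have "1 * 1 \<le> z\<^sup>2 * z\<^sup>2" using z2 M2 by (intro mult_mono) auto
        then have "1 \<le> z ^ 4" by (simp add: power2_eq_square power4_eq_xxxx mult.assoc)
        then have "2 * (1 + 8 * z ^ 4) + z ^ 4 / 2 \<le> 19 * (z ^ 6 / M\<^sup>2)" using z46 unfolding distrib_left by linarith
        then show ?thesis by simp
      qed
      finally have "?h * D\<^sup>2 \<le> ?h * (19 / M\<^sup>2 * z ^ 6 + 16 / (W * (1 + z\<^sup>2)\<^sup>2))"
        using h by (intro mult_left_mono) auto
      also have "\<dots> = 19 / M\<^sup>2 * (?h * z ^ 6) + 16 * (?h / W) / (1 + z\<^sup>2)\<^sup>2"
        by (simp add: distrib_left mult_ac)
      also have "?h / W = 1 / sqrt (2 * pi * s)" using h by (simp add: W_def)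
      also have "16 * (1 / sqrt (2 * pi * s)) / (1 + z\<^sup>2)\<^sup>2 \<le> 16 / M\<^sup>2 * (1 / (sqrt s * (1 + z\<^sup>2)))"
      proof -
        have "sqrt s \<le> sqrt (2 * pi * s)" using s pi_gt3 by (intro real_sqrt_le_mono) auto
        moreover have "M\<^sup>2 * (1 + z\<^sup>2) \<le> (1 + z\<^sup>2)\<^sup>2" unfolding power2_eq_square[of "1 + z\<^sup>2"]
          using z2 by (intro mult_right_mono) auto
        ultimately have "sqrt s * (M\<^sup>2 * (1 + z\<^sup>2)) \<le> sqrt (2 * pi * s) * (1 + z\<^sup>2)\<^sup>2"
          by (intro mult_mono) (use s in auto)
        then have "16 / (sqrt (2 * pi * s) * (1 + z\<^sup>2)\<^sup>2) \<le> 16 / (sqrt s * (M\<^sup>2 * (1 + z\<^sup>2)))"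
          using s M2 add_pos_nonneg[OF zero_less_one zero_le_power2[of z]]
          by (intro divide_left_mono mult_pos_pos) auto
        then show ?thesis by (simp add: mult_ac)
      qed
      finally show ?thesis using nn unfolding z_def D_def by linarith
    qed
  qed
qed

lemma E_info_err_sq_tendsto: "((\<lambda>s. E_rw w s (\<lambda>x. (info_err w s x)\<^sup>2)) \<longlongrightarrow> 0) at_top"
proof (rule tendstoI)
  fix e :: real assume e: "e > 0"
  obtain \<epsilon> where \<epsilon>: "(\<epsilon> \<longlongrightarrow> 0) at_top"
    "\<And>s x. s > 0 \<Longrightarrow> \<bar>sqrt (2 * pi * s) * heat w s x - exp (- (zscore w s x)\<^sup>2 / 2)\<bar> \<le> \<epsilon> s"
    using local_limit by blast
  define K where "K = 19 * 41 + 16 * (3 * pi)"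
  have K: "K > 0" by (simp add: K_def add_pos_pos)
  \<comment> \<open>Chosen so that \<open>K / M\<^sup>2 < e / 2\<close>; \<open>K\<close> collects the bounds for the sixth moment and for the reference density.\<close>
  define M where "M = max 1 (sqrt (2 * K / e) + 1)"
  have M: "M \<ge> 1" by (simp add: M_def)
  have KM: "K / M\<^sup>2 < e / 2"
  proof -
    have "sqrt (2 * K / e) < M" by (simp add: M_def)
    then have "(sqrt (2 * K / e))\<^sup>2 < M\<^sup>2" using K e by (intro power_strict_mono) auto
    then have "2 * K / e < M\<^sup>2" using K e by simp
    then show ?thesis using e M by (simp add: field_simps)
  qed
  define \<eta> where "\<eta> = min (1/2) (sqrt (e / 16))"
  have \<eta>: "0 < \<eta>" "\<eta> \<le> 1/2" using e by (auto simp: \<eta>_def)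
  have \<eta>2: "4 * \<eta>\<^sup>2 \<le> e / 4"
  proof -
    have "\<eta>\<^sup>2 \<le> (sqrt (e / 16))\<^sup>2" using \<eta> by (intro power_mono) (auto simp: \<eta>_def)
    then show ?thesis using e by simp
  qed
  have "\<forall>\<^sub>F s in at_top. \<epsilon> s < \<eta> * exp (- M\<^sup>2 / 2)"
    using order_tendstoD(2)[OF \<epsilon>(1)] \<eta> by simp
  then show "\<forall>\<^sub>F s in at_top. dist (E_rw w s (\<lambda>x. (info_err w s x)\<^sup>2)) 0 < e"
    using eventually_ge_at_top[of 1]
  proof eventually_elim
    case (elim s)
    have s0: "s > 0" using elim by simp
    have lcl: "\<bar>sqrt (2 * pi * s) * heat w s x - exp (- (zscore w s x)\<^sup>2 / 2)\<bar> \<le> \<eta> * exp (- M\<^sup>2 / 2)" for x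
      using \<epsilon>(2)[OF s0, of x] elim by linarith
    let ?e = int_decode
    let ?c = "\<lambda>n. 1 / (sqrt s * (1 + (zscore w s (?e n))\<^sup>2))"
    have "(\<lambda>n. 4 * \<eta>\<^sup>2 * (heat w s (?e n) * 1) + 19 / M\<^sup>2 * (heat w s (?e n) * zscore w s (?e n) ^ 6) + 16 / M\<^sup>2 * ?c n)
       sums (4 * \<eta>\<^sup>2 * E_rw w s (\<lambda>_. 1) + 19 / M\<^sup>2 * E_rw w s (\<lambda>x. zscore w s x ^ 6) + 16 / M\<^sup>2 * (\<Sum>n. ?c n))"
      by (intro sums_add sums_mult sums_E_rw summable_sums cauchy_series(1) elim E_zscore(1) s0) auto
    note bound_sums = this
    have err_sums: "(\<lambda>n. heat w s (?e n) * (info_err w s (?e n))\<^sup>2) sums E_rw w s (\<lambda>x. (info_err w s x)\<^sup>2)"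
      by (rule sums_E_rw[OF integrable_info_err(2)[OF s0]])
    have "heat w s (?e n) * (info_err w s (?e n))\<^sup>2 \<le>
       4 * \<eta>\<^sup>2 * (heat w s (?e n) * 1) + 19 / M\<^sup>2 * (heat w s (?e n) * zscore w s (?e n) ^ 6) + 16 / M\<^sup>2 * ?c n" for n
      using info_err_pointwise[OF elim(2) M \<eta> lcl, of "?e n"] by simp
    from sums_le[OF this err_sums bound_sums] have "E_rw w s (\<lambda>x. (info_err w s x)\<^sup>2) \<le>
        4 * \<eta>\<^sup>2 * E_rw w s (\<lambda>_. 1) + 19 / M\<^sup>2 * E_rw w s (\<lambda>x. zscore w s x ^ 6) + 16 / M\<^sup>2 * (\<Sum>n. ?c n)" .
    also have "\<dots> \<le> 4 * \<eta>\<^sup>2 * 1 + 19 / M\<^sup>2 * 41 + 16 / M\<^sup>2 * (3 * pi)"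
    proof (intro add_mono mult_left_mono cauchy_series(2) elim)
      have "sqrt s ^ 6 = ((sqrt s)\<^sup>2) ^ 3" by (simp flip: power_mult)
      then have "sqrt s ^ 6 = s ^ 3" using s0 by simp
      then show "E_rw w s (\<lambda>x. zscore w s x ^ 6) \<le> 41"
        unfolding E_zscore(2)[OF s0] using moments(3)[of s w] elim by (simp add: field_simps)
    qed auto
    also have "\<dots> = 4 * \<eta>\<^sup>2 + K / M\<^sup>2" by (simp add: K_def add_divide_distrib)
    also have "\<dots> < e" using \<eta>2 KM e by linarith
    finally show ?case by (simp add: integral_nonneg_AE)
  qed
qed

section \<open>Entropy and varentropy at large times\<close>

(* Keeps the dimension 1 in coord_law w 1 s from being rewritten to Suc 0. *)
declare One_nat_def [simp del]

definition varentropy :: "walk_type \<Rightarrow> real \<Rightarrow> real" where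
  "varentropy w s = sq_info w s - (entropy w s)\<^sup>2"

lemma varentropy_nonneg:
  assumes "s \<ge> 0"
  shows "varentropy w s \<ge> 0"
proof -
  have "measure_pmf.variance (coord_law w 1 s) (\<lambda>x. ln (heat w s x)) = varentropy w s"
    using entropy_series(1,2)[OF assms, of w]
    by (subst measure_pmf.variance_eq) (auto simp: varentropy_def sq_info_def entropy_def)
  then show ?thesis by (metis measure_pmf.variance_positive)
qed

lemma square_mean_le:
  assumes "integrable (measure_pmf (coord_law w 1 s)) f" "integrable (measure_pmf (coord_law w 1 s)) (\<lambda>x. (f x)\<^sup>2)"
  shows "(E_rw w s f)\<^sup>2 \<le> E_rw w s (\<lambda>x. (f x)\<^sup>2)"
  using measure_pmf.variance_positive[of "coord_law w 1 s" f] measure_pmf.variance_eq[OF assms] by simp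

lemma E_info_err_tendsto: "((\<lambda>s. E_rw w s (info_err w s)) \<longlongrightarrow> 0) at_top"
proof (rule Lim_null_comparison)
  show "\<forall>\<^sub>F s in at_top. norm (E_rw w s (info_err w s)) \<le> sqrt (E_rw w s (\<lambda>x. (info_err w s x)\<^sup>2))"
    using eventually_gt_at_top[of 0]
  proof eventually_elim
    case (elim s)
    have "sqrt ((E_rw w s (info_err w s))\<^sup>2) \<le> sqrt (E_rw w s (\<lambda>x. (info_err w s x)\<^sup>2))"
      by (intro real_sqrt_le_mono square_mean_le integrable_info_err elim)
    then show ?case by simp
  qed
  show "((\<lambda>s. sqrt (E_rw w s (\<lambda>x. (info_err w s x)\<^sup>2))) \<longlongrightarrow> 0) at_top"
    using tendsto_real_sqrt[OF E_info_err_sq_tendsto[of w]] by simp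
qed

lemma E_zscore_2_4:
  assumes "s > 0"
  shows "E_rw w s (\<lambda>x. (zscore w s x)\<^sup>2) = 1" "E_rw w s (\<lambda>x. zscore w s x ^ 4) = 3 + 1 / s"
proof -
  have "sqrt s ^ 4 = ((sqrt s)\<^sup>2)\<^sup>2" by (simp flip: power_mult)
  then have "sqrt s ^ 4 = s\<^sup>2" using assms by simp
  then show "E_rw w s (\<lambda>x. zscore w s x ^ 4) = 3 + 1 / s"
    unfolding E_zscore(2)[OF assms] using assms moments(2)[of s w]
    by (simp add: power2_eq_square field_simps)
  show "E_rw w s (\<lambda>x. (zscore w s x)\<^sup>2) = 1"
    using E_zscore(2)[OF assms, of w 2] moments(1)[of s w] assms by simp
qed

lemma entropy_eq_err:
  assumes "s > 0"
  shows "entropy w s - (ln (2 * pi * s) / 2 + 1 / 2) = E_rw w s (info_err w s)"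
proof -
  have s0: "s \<ge> 0" using assms by simp
  note i = entropy_series(1)[OF s0, of w] E_zscore(1)[OF assms, of w 2]
  have "E_rw w s (info_err w s) = entropy w s - ln (2 * pi * s) / 2 - E_rw w s (\<lambda>x. (zscore w s x)\<^sup>2) / 2"
    unfolding info_err_def entropy_def using i by simp
  then show ?thesis by (simp add: E_zscore_2_4[OF assms])
qed

lemma entropy_large: "((\<lambda>s. entropy w s - (ln (2 * pi * s) / 2 + 1 / 2)) \<longlongrightarrow> 0) at_top"
proof (rule Lim_transform_eventually[OF E_info_err_tendsto[of w]])
  show "\<forall>\<^sub>F s in at_top. E_rw w s (info_err w s) = entropy w s - (ln (2 * pi * s) / 2 + 1 / 2)"
    using eventually_gt_at_top[of 0] by eventually_elim (simp add: entropy_eq_err)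
qed

text \<open>The information content is \<open>c + A + D\<close> with a constant \<open>c\<close>, the centred Gaussian part \<open>A = Z\<^sup>2 / 2 - 1 / 2\<close> of
  variance \<open>1 / 2 + 1 / (4 s)\<close>, and an error \<open>D\<close> that vanishes in mean square; so does its covariance with \<open>A\<close>.\<close>

lemma varentropy_large: "(varentropy w \<longlongrightarrow> 1 / 2) at_top"
proof -
  define A where "A = (\<lambda>s x. (zscore w s x)\<^sup>2 / 2 - 1 / 2)"
  define D where "D = info_err w"
  let ?E = "E_rw w"
  have intA2: "integrable (measure_pmf (coord_law w 1 s)) (\<lambda>x. (A s x)\<^sup>2)"
    and EA2: "?E s (\<lambda>x. (A s x)\<^sup>2) = 1/2 + 1 / (4 * s)"
    if s: "s > 0" for s
  proof -
    note i = E_zscore(1)[OF s, of w]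
    have A2: "(A s x)\<^sup>2 = zscore w s x ^ 4 / 4 - (zscore w s x)\<^sup>2 / 2 + 1/4" for x
      by (simp add: A_def power2_eq_square power4_eq_xxxx algebra_simps)
    show "integrable (measure_pmf (coord_law w 1 s)) (\<lambda>x. (A s x)\<^sup>2)" "?E s (\<lambda>x. (A s x)\<^sup>2) = 1/2 + 1 / (4 * s)"
      unfolding A2 using i E_zscore_2_4[OF s, of w] by (auto simp: add_divide_distrib)
  qed
  have intAD: "integrable (measure_pmf (coord_law w 1 s)) (\<lambda>x. A s x * D s x)" if s: "s > 0" for s
  proof (rule Bochner_Integration.integrable_bound)
    show "integrable (measure_pmf (coord_law w 1 s)) (\<lambda>x. (A s x)\<^sup>2 + (D s x)\<^sup>2)"
      unfolding D_def by (intro Bochner_Integration.integrable_add intA2 integrable_info_err s)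
    have "\<bar>a * b\<bar> \<le> a\<^sup>2 + b\<^sup>2" for a b :: real
    proof -
      have "a\<^sup>2 + b\<^sup>2 - 2 * (a * b) = (a - b)\<^sup>2" "a\<^sup>2 + b\<^sup>2 + 2 * (a * b) = (a + b)\<^sup>2"
        by (auto simp: power2_eq_square algebra_simps)
      then have "2 * \<bar>a * b\<bar> \<le> a\<^sup>2 + b\<^sup>2"
        using zero_le_power2[of "a - b"] zero_le_power2[of "a + b"] by linarith
      then show ?thesis using zero_le_power2[of a] zero_le_power2[of b] by linarith
    qed
    then show "AE x in measure_pmf (coord_law w 1 s). norm (A s x * D s x) \<le> norm ((A s x)\<^sup>2 + (D s x)\<^sup>2)"
      by (intro always_eventually allI) (simp add: order_trans[OF _ abs_ge_self])
  qed simp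
  have split: "varentropy w s = (1/2 + 1 / (4 * s)) + 2 * ?E s (\<lambda>x. A s x * D s x) + ?E s (\<lambda>x. (D s x)\<^sup>2) - (?E s (D s))\<^sup>2"
    if s: "s > 0" for s
  proof -
    define c where "c = ln (2 * pi * s) / 2 + 1 / 2"
    have s0: "s \<ge> 0" using s by simp
    note ie = entropy_series(1,2)[OF s0, of w]
    have AD: "A s x + D s x = - ln (heat w s x) - c" for x
      by (simp add: A_def D_def info_err_def c_def)
    have "(?E s (\<lambda>x. (A s x + D s x)\<^sup>2)) = ?E s (\<lambda>x. (A s x)\<^sup>2 + 2 * (A s x * D s x) + (D s x)\<^sup>2)"
      by (simp add: power2_sum algebra_simps)
    also have "\<dots> = ?E s (\<lambda>x. (A s x)\<^sup>2) + 2 * ?E s (\<lambda>x. A s x * D s x) + ?E s (\<lambda>x. (D s x)\<^sup>2)"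
      using intA2[OF s] intAD[OF s] integrable_info_err[OF s, of w] by (simp add: D_def)
    finally have 1: "?E s (\<lambda>x. (A s x + D s x)\<^sup>2) = (1/2 + 1 / (4 * s)) + 2 * ?E s (\<lambda>x. A s x * D s x) + ?E s (\<lambda>x. (D s x)\<^sup>2)"
      unfolding EA2[OF s] .
    have "?E s (\<lambda>x. (A s x + D s x)\<^sup>2) = ?E s (\<lambda>x. (ln (heat w s x))\<^sup>2 + 2 * c * ln (heat w s x) + c\<^sup>2)"
      unfolding AD by (simp add: power2_eq_square algebra_simps)
    also have "\<dots> = sq_info w s - 2 * c * entropy w s + c\<^sup>2"
      using ie by (simp add: sq_info_def entropy_def)
    finally have 2: "?E s (\<lambda>x. (A s x + D s x)\<^sup>2) = sq_info w s - 2 * c * entropy w s + c\<^sup>2" .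
    have "?E s (D s) = entropy w s - c" using entropy_eq_err[OF s, of w] by (simp add: D_def c_def)
    then have "(?E s (D s))\<^sup>2 = (entropy w s)\<^sup>2 - 2 * c * entropy w s + c\<^sup>2"
      by (simp add: power2_diff)
    then show ?thesis using 1 2 unfolding varentropy_def by linarith
  qed
  have D2: "((\<lambda>s. ?E s (\<lambda>x. (D s x)\<^sup>2)) \<longlongrightarrow> 0) at_top" unfolding D_def by (rule E_info_err_sq_tendsto)
  have ED: "((\<lambda>s. ?E s (D s)) \<longlongrightarrow> 0) at_top" unfolding D_def by (rule E_info_err_tendsto)
  have cross: "((\<lambda>s. 2 * ?E s (\<lambda>x. A s x * D s x)) \<longlongrightarrow> 0) at_top"
  proof (rule Lim_null_comparison)
    \<comment> \<open>The weight in \<open>2 \<bar>A D\<bar> \<le> r A\<^sup>2 + D\<^sup>2 / r\<close>. The summand \<open>1 / s\<close> keeps it positive if \<open>D\<close> vanishes.\<close>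
    let ?r = "\<lambda>s. sqrt (?E s (\<lambda>x. (D s x)\<^sup>2)) + 1 / s"
    have r0: "(?r \<longlongrightarrow> 0) at_top"
    proof -
      have "((\<lambda>s. sqrt (?E s (\<lambda>x. (D s x)\<^sup>2)) + 1 / s) \<longlongrightarrow> sqrt 0 + 0) at_top"
        by (intro tendsto_add tendsto_real_sqrt D2) real_asymp
      then show ?thesis by simp
    qed
    have "((\<lambda>s. ?r s * (1/2 + 1 / (4 * s)) + ?r s) \<longlongrightarrow> 0 * (1/2 + 0) + 0) at_top"
      by (intro tendsto_add tendsto_mult r0 tendsto_const) real_asymp
    then show "((\<lambda>s. ?r s * (1/2 + 1 / (4 * s)) + ?r s) \<longlongrightarrow> 0) at_top" by simp
    show "\<forall>\<^sub>F s in at_top. norm (2 * ?E s (\<lambda>x. A s x * D s x)) \<le> ?r s * (1/2 + 1 / (4 * s)) + ?r s"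
      using eventually_gt_at_top[of 0]
    proof eventually_elim
      case (elim s)
      define r where "r = ?r s"
      define e where "e = ?E s (\<lambda>x. (D s x)\<^sup>2)"
      have e0: "e \<ge> 0" unfolding e_def by (simp add: integral_nonneg_AE)
      have r: "r > 0" using elim e0 unfolding r_def e_def[symmetric] by (simp add: add_nonneg_pos)
      have "sqrt e \<le> r" unfolding r_def e_def using elim by simp
      then have "(sqrt e)\<^sup>2 \<le> r\<^sup>2" using e0 by (intro power_mono) auto
      then have "e \<le> r * r" using e0 by (simp add: power2_eq_square)
      then have er: "e / r \<le> r" using r by (simp add: divide_le_eq)
      have pw: "\<bar>2 * (a * b)\<bar> \<le> r * a\<^sup>2 + b\<^sup>2 / r" for a b :: real
      proof -
        have "r * a\<^sup>2 + b\<^sup>2 / r - 2 * (a * b) = (r * a - b)\<^sup>2 / r"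
          "r * a\<^sup>2 + b\<^sup>2 / r + 2 * (a * b) = (r * a + b)\<^sup>2 / r"
          using r by (auto simp: power2_eq_square field_simps)
        moreover have "(r * a - b)\<^sup>2 / r \<ge> 0" "(r * a + b)\<^sup>2 / r \<ge> 0" using r by auto
        ultimately show ?thesis by linarith
      qed
      have "\<bar>?E s (\<lambda>x. 2 * (A s x * D s x))\<bar> \<le> ?E s (\<lambda>x. \<bar>2 * (A s x * D s x)\<bar>)"
        by (rule integral_abs_bound)
      also have "\<dots> \<le> ?E s (\<lambda>x. r * (A s x)\<^sup>2 + (D s x)\<^sup>2 / r)"
        using intA2[OF elim] intAD[OF elim] integrable_info_err[OF elim, of w] pw
        by (intro integral_mono) (auto simp: D_def)
      also have "\<dots> = r * (1/2 + 1 / (4 * s)) + e / r"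
        using intA2[OF elim] integrable_info_err[OF elim, of w] EA2[OF elim] by (simp add: D_def e_def)
      also have "\<dots> \<le> r * (1/2 + 1 / (4 * s)) + r" using er by simp
      finally show ?case by (simp add: r_def)
    qed
  qed
  have "((\<lambda>s. (1/2 + 1 / (4 * s)) + 2 * ?E s (\<lambda>x. A s x * D s x) + ?E s (\<lambda>x. (D s x)\<^sup>2) - (?E s (D s))\<^sup>2)
      \<longlongrightarrow> (1/2 + 0) + 0 + 0 - 0\<^sup>2) at_top"
    by (intro tendsto_intros cross D2 ED) real_asymp
  then have "((\<lambda>s. (1/2 + 1 / (4 * s)) + 2 * ?E s (\<lambda>x. A s x * D s x) + ?E s (\<lambda>x. (D s x)\<^sup>2) - (?E s (D s))\<^sup>2)
      \<longlongrightarrow> 1/2) at_top" by simp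
  then show ?thesis
  proof (rule Lim_transform_eventually)
    show "\<forall>\<^sub>F s in at_top. (1/2 + 1 / (4 * s)) + 2 * ?E s (\<lambda>x. A s x * D s x) + ?E s (\<lambda>x. (D s x)\<^sup>2) - (?E s (D s))\<^sup>2 = varentropy w s"
      using eventually_gt_at_top[of 0] by eventually_elim (simp add: split)
  qed
qed

text \<open>The asymptotics of a concave function may be differentiated. Over the interval between \<open>s\<close> and \<open>r s\<close> the
  entropy grows by \<open>ln r / 2 + o(1)\<close>, which bounds \<open>s * entropy' w s\<close> from above for \<open>r < 1\<close> and from below for
  \<open>r > 1\<close>. Both bounds tend to \<open>1 / 2\<close> as \<open>r\<close> tends to 1.\<close>

lemma entropy'_large: "((\<lambda>s. s * entropy' w s) \<longlongrightarrow> 1 / 2) at_top"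
proof -
  let ?g = "\<lambda>s. entropy w s - (ln (2 * pi * s) / 2 + 1 / 2)"
  have lim: "((\<lambda>s. entropy w (r * s) - entropy w s) \<longlongrightarrow> ln r / 2) at_top" if r: "r > 0" for r
  proof -
    have "filterlim (\<lambda>s. r * s) at_top at_top" using r by real_asymp
    from filterlim_compose[OF entropy_large this]
    have "((\<lambda>s. ?g (r * s) - ?g s + ln r / 2) \<longlongrightarrow> 0 - 0 + ln r / 2) at_top"
      by (intro tendsto_intros entropy_large)
    moreover have "\<forall>\<^sub>F s in at_top. ?g (r * s) - ?g s + ln r / 2 = entropy w (r * s) - entropy w s"
      using eventually_gt_at_top[of 0]
      by eventually_elim (use r in \<open>simp add: ln_mult field_simps\<close>)
    ultimately show ?thesis by (simp add: Lim_transform_eventually)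
  qed
  have up: "\<forall>\<^sub>F s in at_top. s * entropy' w s < b" if b: "b > 1/2" for b
  proof -
    obtain r where r: "0 < r" "r < 1" "1 / (2 * r) < b"
    proof -
      define r where "r = (1 + 1 / (2 * b)) / 2"
      have r: "1 / (2 * b) < r" "r < 1" "0 < r" using b by (auto simp: r_def field_simps add_pos_pos)
      have "1 < r * (2 * b)" using r(1) b by (simp add: divide_less_eq)
      then have "1 / (2 * r) < b" using r(3) by (simp add: divide_less_eq mult_ac)
      with r show thesis by (intro that[of r])
    qed
    have "- ln r \<le> (1 - r) / r"
      using ln_le_minus_one[of "1 / r"] r by (simp add: ln_div field_simps)
    then have "- (ln r / 2) \<le> ((1 - r) / r) / 2"
      by (metis (no_types) divide_right_mono minus_divide_left zero_le_numeral)
    also have "\<dots> = (1 - r) * (1 / (2 * r))" by simp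
    also have "\<dots> < (1 - r) * b" using r by (intro mult_strict_left_mono) auto
    finally have "- ((1 - r) * b) < ln r / 2" by (subst minus_less_iff)
    from order_tendstoD(1)[OF lim[OF r(1)] this] show ?thesis
      using eventually_gt_at_top[of 0]
    proof eventually_elim
      case (elim s)
      have "entropy' w s * (s - r * s) \<le> entropy w s - entropy w (r * s)"
        using r elim by (intro entropy_diff_bounds) auto
      then have "(1 - r) * (s * entropy' w s) < (1 - r) * b" using elim by (simp add: algebra_simps)
      then show ?case using r by simp
    qed
  qed
  have low: "\<forall>\<^sub>F s in at_top. a < s * entropy' w s" if "a < 1/2" for a
  proof -
    obtain r where r: "1 < r" "a < 1 / (2 * r)"
    proof (cases "a \<le> 0")
      case True
      then show ?thesis by (intro that[of 2]) auto
    next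
      case False
      define r where "r = (1 + 1 / (2 * a)) / 2"
      have "1 < r" "r < 1 / (2 * a)" using False \<open>a < 1/2\<close> by (auto simp: r_def field_simps)
      then show ?thesis using False by (intro that[of r]) (auto simp: field_simps)
    qed
    have "ln r \<ge> (r - 1) / r"
      using ln_le_minus_one[of "1 / r"] r by (simp add: ln_div field_simps)
    then have "(r - 1) * (1 / (2 * r)) \<le> ln r / 2" using r by (simp add: field_simps)
    moreover have "(r - 1) * a < (r - 1) * (1 / (2 * r))" using r by (intro mult_strict_left_mono) auto
    ultimately have "(r - 1) * a < ln r / 2" by linarith
    have r0: "r > 0" using r by simp
    from order_tendstoD(1)[OF lim[OF r0] \<open>(r - 1) * a < ln r / 2\<close>] show ?thesis
      using eventually_gt_at_top[of 0]
    proof eventually_elim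
      case (elim s)
      have "entropy w (r * s) - entropy w s \<le> entropy' w s * (r * s - s)"
        using r elim by (intro entropy_diff_bounds) auto
      then have "(r - 1) * a < (r - 1) * (s * entropy' w s)" using elim r by (simp add: algebra_simps)
      then show ?case using r by simp
    qed
  qed
  show ?thesis by (rule order_tendstoI) (use up low in auto)
qed

section \<open>Entropy and varentropy at small times\<close>

text \<open>Two or more jumps have probability at most \<open>s\<^sup>2\<close>.\<close>

lemma heat_first_order:
  assumes "s \<ge> 0"
  shows "exp (-s) * (chain_pmf w 0 x + s * chain_pmf w 1 x) \<le> heat w s x"
    "heat w s x \<le> exp (-s) * (chain_pmf w 0 x + s * chain_pmf w 1 x) + s\<^sup>2"
proof -
  let ?a = "\<lambda>m. exp (-s) * s ^ m / fact m"
  let ?f = "\<lambda>m. ?a m * chain_pmf w m x"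
  have sa: "?a sums 1"
  proof -
    have "(\<lambda>m. exp (-s) * (s ^ m / fact m)) sums (exp (-s) * exp s)"
      using exp_converges[of s] by (intro sums_mult) (simp add: field_simps)
    then show ?thesis by (simp add: exp_minus)
  qed
  have 1: "(\<lambda>m. ?f (m + 2)) sums (heat w s x - (\<Sum>m<2. ?f m))"
    using heat_sums[OF assms, of w x] by (rule sums_split_initial_segment)
  have 2: "(\<lambda>m. ?a (m + 2)) sums (1 - (\<Sum>m<2. ?a m))"
    using sa by (rule sums_split_initial_segment)
  have "heat w s x - (\<Sum>m<2. ?f m) \<ge> 0"
    by (rule sums_le[OF _ sums_zero 1]) (use assms in auto)
  moreover have "heat w s x - (\<Sum>m<2. ?f m) \<le> 1 - (\<Sum>m<2. ?a m)"
    by (rule sums_le[OF _ 1 2], intro mult_right_le_one_le) (use assms in auto)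
  moreover have "(\<Sum>m<2. ?f m) = exp (-s) * (chain_pmf w 0 x + s * chain_pmf w 1 x)"
    by (simp add: numeral_2_eq_2 One_nat_def algebra_simps)
  moreover have "(\<Sum>m<2. ?a m) = exp (-s) * (1 + s)"
    by (simp add: numeral_2_eq_2 algebra_simps)
  moreover have "1 - exp (-s) * (1 + s) \<le> s\<^sup>2"
  proof -
    have "1 - s \<le> exp (-s)" using exp_ge_add_one_self[of "-s"] by simp
    then have "(1 - s) * (1 + s) \<le> exp (-s) * (1 + s)" using assms by (intro mult_right_mono) auto
    then show ?thesis by (simp add: power2_eq_square algebra_simps)
  qed
  ultimately show "exp (-s) * (chain_pmf w 0 x + s * chain_pmf w 1 x) \<le> heat w s x"
    "heat w s x \<le> exp (-s) * (chain_pmf w 0 x + s * chain_pmf w 1 x) + s\<^sup>2" by linarith+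
qed

lemma zero_notin_steps [simp]: "0 \<notin> steps w"
  by (cases w) (auto simp: steps_def)

lemma chain_pmf_1: "chain_pmf w 1 x = (if x \<in> steps w then 1 / card (steps w) else 0)"
proof -
  have "(\<Sum>d\<in>steps w. (if x - d = 0 then 1 else 0)) = (\<Sum>d\<in>steps w. (if d = x then 1 else 0 :: real))"
    by (intro sum.cong) auto
  then show ?thesis by (simp add: One_nat_def chain_pmf_Suc step_mean_def chain_pmf_0)
qed

lemma heat_small_bounds:
  assumes "s \<ge> 0"
  shows "exp (-s) \<le> heat w s 0" "heat w s 0 \<le> exp (-s) + s\<^sup>2"
    "d \<in> steps w \<Longrightarrow> exp (-s) \<le> heat w s d * card (steps w) / s \<or> s = 0"
    "d \<in> steps w \<Longrightarrow> heat w s d * card (steps w) / s \<le> exp (-s) + 2 * s"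
proof -
  show "exp (-s) \<le> heat w s 0" "heat w s 0 \<le> exp (-s) + s\<^sup>2"
    using heat_first_order[OF assms, of w 0] by (simp_all add: chain_pmf_0 chain_pmf_1)
  assume d: "d \<in> steps w"
  then have d0: "d \<noteq> 0" by auto
  let ?n = "real (card (steps w))"
  have n: "?n > 0" "?n \<le> 2" by (cases w; simp add: steps_def)+
  note b = heat_first_order[OF assms, of w d]
  have b1: "exp (-s) * s / ?n \<le> heat w s d" "heat w s d \<le> exp (-s) * s / ?n + s\<^sup>2"
    using b d d0 by (simp_all add: chain_pmf_0 chain_pmf_1)
  show "exp (-s) \<le> heat w s d * ?n / s \<or> s = 0"
    using b1(1) n assms by (auto simp: field_simps)
  show "heat w s d * ?n / s \<le> exp (-s) + 2 * s"
  proof (cases "s = 0")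
    case False
    have "heat w s d * ?n \<le> (exp (-s) * s / ?n + s\<^sup>2) * ?n" using b1(2) n by (intro mult_right_mono) auto
    also have "\<dots> = exp (-s) * s + s\<^sup>2 * ?n" using n by (simp add: field_simps)
    also have "\<dots> \<le> exp (-s) * s + s\<^sup>2 * 2" using n by (intro add_left_mono mult_left_mono) auto
    finally show ?thesis using False assms by (simp add: field_simps power2_eq_square)
  qed simp
qed

text \<open>At distance 2 the heat kernel has order \<open>s\<^sup>2\<close>. The square root in \<open>u_ln_le_sqrt\<close> would leave an error of
  order \<open>s\<close> there, as large as the main terms; the power \<open>3 / 4\<close> makes it negligible.\<close>

lemma u_ln_le_root:
  fixes u :: real
  assumes "0 \<le> u" "u \<le> 1"
  shows "u * (ln u)\<^sup>2 \<le> 65 * sqrt (sqrt u) ^ 3" "u * \<bar>ln u\<bar> \<le> 65 * sqrt (sqrt u) ^ 3"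
proof -
  define v where "v = sqrt (sqrt u)"
  have v: "0 \<le> v" "v \<le> 1" using assms by (auto simp: v_def)
  have "v ^ 4 = (v\<^sup>2)\<^sup>2" by (simp flip: power_mult)
  then have v4: "u = v ^ 4" using assms by (simp add: v_def)
  have "v * (ln v)\<^sup>2 \<le> 4"
  proof (cases "v = 0")
    case False
    then have "(ln (1 / v))\<^sup>2 \<le> 4 * (1 / v)" using v by (intro ln_sq_le) auto
    then show ?thesis using False v by (simp add: ln_div field_simps)
  qed simp
  then have "v ^ 3 * (16 * (v * (ln v)\<^sup>2)) \<le> v ^ 3 * 64" using v by (intro mult_left_mono) auto
  moreover have "u * (ln u)\<^sup>2 = v ^ 3 * (16 * (v * (ln v)\<^sup>2))"
  proof (cases "v = 0")
    case False
    then have "ln u = 4 * ln v" using v by (simp add: v4 ln_realpow)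
    then show ?thesis unfolding v4 by (simp add: power2_eq_square power3_eq_cube power4_eq_xxxx)
  qed (simp add: v4)
  ultimately have 1: "u * (ln u)\<^sup>2 \<le> 64 * v ^ 3" by simp
  have "\<bar>ln u\<bar> \<le> 1 + (ln u)\<^sup>2"
    using zero_le_power2[of "\<bar>ln u\<bar> - 1"] zero_le_power2[of "ln u"] by (simp add: power2_diff)
  then have "u * \<bar>ln u\<bar> \<le> u * (1 + (ln u)\<^sup>2)" using assms by (intro mult_left_mono) auto
  moreover have "u \<le> v ^ 3" unfolding v4 using v by (intro power_decreasing) auto
  ultimately show "u * \<bar>ln u\<bar> \<le> 65 * sqrt (sqrt u) ^ 3" using 1 by (simp add: v_def algebra_simps)
  show "u * (ln u)\<^sup>2 \<le> 65 * sqrt (sqrt u) ^ 3" using 1 zero_le_power[OF v(1), of 3] unfolding v_def[symmetric] by linarith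
qed

lemma heat_tail_root:
  assumes s: "0 < s" "s \<le> 1/16" and x: "\<bar>x\<bar> \<ge> 2"
  shows "sqrt (sqrt (heat w s x)) ^ 3 \<le> 16 * sqrt (sqrt s) ^ 5 * (1/2) ^ nat \<bar>x\<bar>"
proof -
  define k where "k = nat \<bar>x\<bar>"
  have k: "k \<ge> 2" using x by (simp add: k_def)
  define r where "r = sqrt (sqrt s)"
  have r0: "r > 0" using s by (simp add: r_def)
  have r2: "r \<le> 1/2"
  proof -
    have "sqrt (sqrt s) \<le> sqrt (sqrt (1/16))" using s by (intro real_sqrt_le_mono) auto
    also have "sqrt (1/16) = (1/4::real)" by (rule real_sqrt_unique) (auto simp: power2_eq_square)
    also have "sqrt (1/4) = (1/2::real)" by (rule real_sqrt_unique) (auto simp: power2_eq_square)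
    finally show ?thesis by (simp add: r_def)
  qed
  have "r ^ 4 = (r\<^sup>2)\<^sup>2" by (simp flip: power_mult)
  then have r4: "s = r ^ 4" using s by (simp add: r_def)
  have "heat w s x \<le> exp (s * (1 / s - 1)) / (1 / s) ^ k"
    unfolding k_def by (rule heat_le) (use s in auto)
  also have "s * (1 / s - 1) = 1 - s" using s by (simp add: field_simps)
  also have "exp (1 - s) / (1 / s) ^ k = exp (1 - s) * s ^ k" using s by (simp add: power_one_over)
  also have "\<dots> \<le> 3 * s ^ k"
  proof -
    have "exp (1 - s) \<le> exp 1" using s by simp
    also have "\<dots> \<le> 3" by (rule exp_le)
    finally show ?thesis using s by (intro mult_right_mono) auto
  qed
  also have "\<dots> \<le> (2 * r ^ k) ^ 4"
  proof -
    have "(r ^ 4) ^ k = r ^ (4 * k)" "(r ^ k) ^ 4 = r ^ (k * 4)" by (rule power_mult[symmetric])+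
    then have e: "(r ^ 4) ^ k = (r ^ k) ^ 4" by (simp only: mult.commute)
    show ?thesis unfolding r4 e power_mult_distrib using r0 by (intro mult_right_mono) auto
  qed
  also have "(2 * r ^ k) ^ 4 = ((2 * r ^ k)\<^sup>2)\<^sup>2"
    by (simp only: power2_eq_square power4_eq_xxxx mult.assoc)
  finally have "sqrt (sqrt (heat w s x)) \<le> sqrt (sqrt (((2 * r ^ k)\<^sup>2)\<^sup>2))"
    by (intro real_sqrt_le_mono)
  also have "\<dots> = 2 * r ^ k"
  proof -
    have "2 * r ^ k \<ge> 0" using r0 by simp
    then show ?thesis by (simp only: real_sqrt_abs abs_power2 abs_of_nonneg)
  qed
  finally have "sqrt (sqrt (heat w s x)) ^ 3 \<le> (2 * r ^ k) ^ 3" by (intro power_mono) auto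
  also have "\<dots> = 8 * r ^ (k * 3)" by (simp add: power_mult_distrib flip: power_mult)
  also have "k * 3 = 3 * k" by simp
  also have "r ^ (3 * k) = r ^ 5 * r ^ (3 * k - 5)" using k by (simp flip: power_add)
  also have "r ^ (3 * k - 5) \<le> (1/2) ^ (3 * k - 5)" using r0 r2 by (intro power_mono) auto
  also have "(1/2::real) ^ (3 * k - 5) \<le> (1/2) ^ (k - 1)" using k by (intro power_decreasing) auto
  also have "(1/2::real) ^ (k - 1) = 2 * (1/2) ^ k" using k by (cases k) auto
  finally show ?thesis using r0 by (simp add: r_def k_def mult_ac)
qed

text \<open>Only the origin and the points reached by a single jump contribute at order \<open>s\<close>; the rest is of order
  \<open>s ^ (5 / 4)\<close>.\<close>

lemma core_sum_error:
  fixes g :: "real \<Rightarrow> real"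
  obtains C where "\<And>g s. (\<And>u. 0 \<le> u \<Longrightarrow> u \<le> 1 \<Longrightarrow> \<bar>u * g u\<bar> \<le> 65 * sqrt (sqrt u) ^ 3) \<Longrightarrow> 0 < s \<Longrightarrow> s \<le> 1/16 \<Longrightarrow>
    summable (\<lambda>n. \<bar>heat w s (int_decode n) * g (heat w s (int_decode n))\<bar>) \<Longrightarrow>
    \<bar>(\<Sum>n. heat w s (int_decode n) * g (heat w s (int_decode n))) - heat w s 0 * g (heat w s 0) -
      (\<Sum>d\<in>steps w. heat w s d * g (heat w s d))\<bar> \<le> C * sqrt (sqrt s) ^ 5"
proof
  define K where "K = (\<Sum>n. (1/2::real) ^ nat \<bar>int_decode n\<bar>)"
  fix g :: "real \<Rightarrow> real" and s :: real
  assume g: "\<And>u. 0 \<le> u \<Longrightarrow> u \<le> 1 \<Longrightarrow> \<bar>u * g u\<bar> \<le> 65 * sqrt (sqrt u) ^ 3" and s: "0 < s" "s \<le> 1/16"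
    and sm: "summable (\<lambda>n. \<bar>heat w s (int_decode n) * g (heat w s (int_decode n))\<bar>)"
  let ?e = int_decode
  let ?f = "\<lambda>x. heat w s x * g (heat w s x)"
  define A where "A = insert 0 (steps w)"
  have "(\<lambda>n. if n \<in> int_encode ` A then ?f (?e n) else 0) sums (\<Sum>n\<in>int_encode ` A. ?f (?e n))"
    by (rule sums_If_finite_set) (simp add: A_def)
  also have "(\<Sum>n\<in>int_encode ` A. ?f (?e n)) = (\<Sum>x\<in>A. ?f x)"
    by (subst sum.reindex) (auto intro: inj_on_subset[OF inj_int_encode])
  also have "(\<Sum>x\<in>A. ?f x) = ?f 0 + (\<Sum>d\<in>steps w. ?f d)" by (simp add: A_def)
  finally have core: "(\<lambda>n. if n \<in> int_encode ` A then ?f (?e n) else 0) sums (?f 0 + (\<Sum>d\<in>steps w. ?f d))" .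
  have "(\<lambda>n. ?f (?e n)) sums (\<Sum>n. ?f (?e n))"
    by (rule summable_sums[OF summable_rabs_cancel[OF sm]])
  note rest = sums_diff[OF this core]
  have KS: "(\<lambda>n. 65 * (16 * sqrt (sqrt s) ^ 5) * (1/2) ^ nat \<bar>?e n\<bar>) sums (65 * (16 * sqrt (sqrt s) ^ 5) * K)"
    unfolding K_def by (intro sums_mult summable_sums summable_half_power_int)
  have bnd: "\<bar>?f (?e n) - (if n \<in> int_encode ` A then ?f (?e n) else 0)\<bar> \<le> 65 * (16 * sqrt (sqrt s) ^ 5) * (1/2) ^ nat \<bar>?e n\<bar>" for n
  proof (cases "n \<in> int_encode ` A")
    case False
    have xA: "?e n \<notin> A" using False by (metis imageI int_decode_inverse)
    show ?thesis
    proof (cases "\<bar>?e n\<bar> \<ge> 2")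
      case True
      have "\<bar>?f (?e n)\<bar> \<le> 65 * sqrt (sqrt (heat w s (?e n))) ^ 3" by (intro g) auto
      also have "\<dots> \<le> 65 * (16 * sqrt (sqrt s) ^ 5 * (1/2) ^ nat \<bar>?e n\<bar>)"
        by (intro mult_left_mono heat_tail_root s True) auto
      finally show ?thesis using False by simp
    next
      case small: False
      then have "\<bar>?e n\<bar> < 2" by simp
      then have "?e n = 0 \<or> ?e n = 1 \<or> ?e n = -1" by arith
      then have "\<not> reachable w (?e n)" using xA
        by (cases w) (auto simp: A_def steps_def reachable_def)
      then have "heat w s (?e n) = 0" using s by (intro heat_unreachable) auto
      then show ?thesis using s by simp
    qed
  qed (use s in simp)
  note bnd' = bnd[unfolded abs_le_iff]
  have "(\<Sum>n. ?f (?e n)) - (?f 0 + (\<Sum>d\<in>steps w. ?f d)) \<le> 65 * (16 * sqrt (sqrt s) ^ 5) * K"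
    by (rule sums_le[OF conjunct1[OF bnd'] rest KS])
  moreover have "- ((\<Sum>n. ?f (?e n)) - (?f 0 + (\<Sum>d\<in>steps w. ?f d))) \<le> 65 * (16 * sqrt (sqrt s) ^ 5) * K"
    by (rule sums_le[OF conjunct2[OF bnd'] sums_minus[OF rest] KS])
  ultimately show "\<bar>(\<Sum>n. ?f (?e n)) - ?f 0 - (\<Sum>d\<in>steps w. ?f d)\<bar> \<le> 65 * 16 * K * sqrt (sqrt s) ^ 5"
    unfolding abs_le_iff by (simp add: mult_ac)
qed

definition step_entropy :: "walk_type \<Rightarrow> real" where
  "step_entropy w = ln (card (steps w))"

lemma step_mean_tendsto_0:
  fixes f :: "int \<Rightarrow> real \<Rightarrow> real"
  assumes "\<And>d. d \<in> steps w \<Longrightarrow> (f d \<longlongrightarrow> 0) F"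
  shows "((\<lambda>s. step_mean w (\<lambda>d. f d s)) \<longlongrightarrow> 0) F"
  unfolding step_mean_def using assms
  by (intro tendsto_divide_zero tendsto_null_sum) auto

lemma step_mean_rescaled:
  fixes s :: real
  shows "step_mean w (\<lambda>d. real (card (steps w)) * f d / s - c) = (\<Sum>d\<in>steps w. f d) / s - c"
proof -
  have "(\<Sum>d\<in>steps w. real (card (steps w)) * f d / s) = real (card (steps w)) * ((\<Sum>d\<in>steps w. f d) / s)"
    by (simp add: sum_distrib_left sum_divide_distrib)
  then show ?thesis by (simp add: step_mean_def sum_subtractf diff_divide_distrib)
qed

lemma heat_step_ln:
  assumes s: "0 < s" "s \<le> 1/12" and d: "d \<in> steps w"
  defines "q \<equiv> heat w s d * card (steps w) / s"
  shows "\<bar>q - 1\<bar> \<le> 3 * s" "\<bar>ln q\<bar> \<le> 6 * s" "- ln (heat w s d) = - ln s + step_entropy w - ln q"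
    "heat w s d = s / card (steps w) * q" "q > 0"
proof -
  have s0: "s \<ge> 0" using s by simp
  have "exp (-s) \<le> q" "q \<le> exp (-s) + 2 * s"
    unfolding q_def using heat_small_bounds(3,4)[OF s0 d] s by auto
  moreover have "1 - s \<le> exp (-s)" "exp (-s) \<le> 1" using exp_ge_add_one_self[of "-s"] s by auto
  ultimately show q: "\<bar>q - 1\<bar> \<le> 3 * s" using s by linarith
  then show q0: "q > 0" using s by linarith
  have "\<bar>ln (1 + (q - 1)) - (q - 1)\<bar> \<le> 2 * (q - 1)\<^sup>2"
    using q s by (intro abs_ln_one_plus_x_minus_x_bound) linarith
  moreover have "2 * (q - 1)\<^sup>2 \<le> \<bar>q - 1\<bar>"
  proof -
    define t where "t = \<bar>q - 1\<bar>"
    have "0 \<le> t" "t \<le> 3 * s" using q by (auto simp: t_def)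
    then have "(2 * t) * t \<le> 1 * t" using s by (intro mult_right_mono) linarith+
    moreover have "(q - 1)\<^sup>2 = t * t" by (simp add: t_def power2_eq_square)
    ultimately show ?thesis by (simp add: t_def)
  qed
  ultimately show "\<bar>ln q\<bar> \<le> 6 * s" using q by simp
  show h: "heat w s d = s / card (steps w) * q" using s by (simp add: q_def)
  show "- ln (heat w s d) = - ln s + step_entropy w - ln q"
  proof -
    have n: "real (card (steps w)) > 0" by simp
    have "ln (s / card (steps w) * q) = ln (s / card (steps w)) + ln q"
      using s n q0 by (intro ln_mult_pos divide_pos_pos)
    also have "ln (s / card (steps w)) = ln s - ln (card (steps w))"
      using s n by (intro ln_divide_pos)
    finally show ?thesis unfolding h step_entropy_def by linarith
  qed
qed

lemma eventually_small_time: "\<forall>\<^sub>F s in at_right (0::real). 0 < s \<and> s \<le> 1/16"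
  by (auto simp: eventually_at_right_field intro!: exI[of _ "1/16"])

lemma step_entropy_nonneg: "step_entropy w \<ge> 0"
  by (cases w) (auto simp: step_entropy_def steps_def)

text \<open>The origin contributes the constant 1, since \<open>- ln (1 - s)\<close> is about \<open>s\<close>. Each of the points of \<open>steps w\<close> carries
  the mass \<open>s / card (steps w)\<close> up to a factor \<open>1 + O(s)\<close>, which adds \<open>- ln s + step_entropy w\<close>.\<close>

lemma entropy_small: "((\<lambda>s. entropy w s / s + ln s) \<longlongrightarrow> step_entropy w + 1) (at_right 0)"
proof -
  let ?c = "step_entropy w"
  obtain C where C: "\<And>g s. (\<And>u. 0 \<le> u \<Longrightarrow> u \<le> 1 \<Longrightarrow> \<bar>u * g u\<bar> \<le> 65 * sqrt (sqrt u) ^ 3) \<Longrightarrow> 0 < s \<Longrightarrow> s \<le> 1/16 \<Longrightarrow>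
    summable (\<lambda>n. \<bar>heat w s (int_decode n) * g (heat w s (int_decode n))\<bar>) \<Longrightarrow>
    \<bar>(\<Sum>n. heat w s (int_decode n) * g (heat w s (int_decode n))) - heat w s 0 * g (heat w s 0) -
      (\<Sum>d\<in>steps w. heat w s d * g (heat w s d))\<bar> \<le> C * sqrt (sqrt s) ^ 5"
    using core_sum_error by blast
  let ?T = "\<lambda>s x. heat w s x * - ln (heat w s x)"
  have rest: "((\<lambda>s. (entropy w s - ?T s 0 - (\<Sum>d\<in>steps w. ?T s d)) / s) \<longlongrightarrow> 0) (at_right 0)"
  proof (rule Lim_null_comparison)
    show "\<forall>\<^sub>F s in at_right 0. norm ((entropy w s - ?T s 0 - (\<Sum>d\<in>steps w. ?T s d)) / s) \<le> C * sqrt (sqrt s) ^ 5 / s"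
      using eventually_small_time
    proof eventually_elim
      case (elim s)
      have "\<bar>entropy w s - ?T s 0 - (\<Sum>d\<in>steps w. ?T s d)\<bar> \<le> C * sqrt (sqrt s) ^ 5"
        using C[of "\<lambda>u. - ln u" s] u_ln_le_root(2) elim entropy_series(3,5)[of s w] by (simp add: abs_mult)
      then show ?case using elim by (simp add: divide_right_mono)
    qed
    show "((\<lambda>s. C * sqrt (sqrt s) ^ 5 / s) \<longlongrightarrow> 0) (at_right 0)" by real_asymp
  qed
  have zero: "((\<lambda>s. ?T s 0 / s) \<longlongrightarrow> 1) (at_right 0)"
  proof -
    have h0: "((\<lambda>s. heat w s 0) \<longlongrightarrow> 1) (at_right 0)"
    proof (rule tendsto_sandwich)
      show "\<forall>\<^sub>F s in at_right 0. exp (-s) \<le> heat w s 0" "\<forall>\<^sub>F s in at_right 0. heat w s 0 \<le> exp (-s) + s\<^sup>2"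
        using eventually_small_time by (eventually_elim, auto intro: heat_small_bounds)+
    qed real_asymp+
    have "((\<lambda>s. - ln (heat w s 0) / s) \<longlongrightarrow> 1) (at_right 0)"
    proof (rule tendsto_sandwich)
      show "\<forall>\<^sub>F s in at_right 0. - ln (exp (-s) + s\<^sup>2) / s \<le> - ln (heat w s 0) / s"
        "\<forall>\<^sub>F s in at_right 0. - ln (heat w s 0) / s \<le> - ln (exp (- s)) / s"
        using eventually_small_time
      proof (eventually_elim)
        fix s :: real assume s: "0 < s \<and> s \<le> 1/16"
        have b: "exp (-s) \<le> heat w s 0" "heat w s 0 \<le> exp (-s) + s\<^sup>2" using heat_small_bounds s by auto
        have "ln (heat w s 0) \<le> ln (exp (-s) + s\<^sup>2)" using b order_less_le_trans[OF exp_gt_zero b(1)]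
          by (subst ln_le_cancel_iff) (auto simp: add_pos_nonneg)
        then show "- ln (exp (-s) + s\<^sup>2) / s \<le> - ln (heat w s 0) / s" using s by (intro divide_right_mono) auto
      next
        show "\<forall>\<^sub>F s in at_right 0. - ln (heat w s 0) / s \<le> - ln (exp (- s)) / s" using eventually_small_time
        proof eventually_elim
          fix s :: real assume s: "0 < s \<and> s \<le> 1/16"
          have b: "exp (-s) \<le> heat w s 0" using heat_small_bounds s by auto
          have "ln (exp (-s)) \<le> ln (heat w s 0)" using b order_less_le_trans[OF exp_gt_zero b(1)]
            by (subst ln_le_cancel_iff) auto
          then show "- ln (heat w s 0) / s \<le> - ln (exp (- s)) / s" using s by (intro divide_right_mono) auto
        qed
      qed
      show "((\<lambda>s::real. - ln (exp (- s)) / s) \<longlongrightarrow> 1) (at_right 0)" by real_asymp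
      show "((\<lambda>s::real. - ln (exp (- s) + s\<^sup>2) / s) \<longlongrightarrow> 1) (at_right 0)" by real_asymp
    qed
    from tendsto_mult[OF h0 this] show ?thesis by simp
  qed
  have steps0: "((\<lambda>s. step_mean w (\<lambda>d. real (card (steps w)) * ?T s d / s - (- ln s + ?c))) \<longlongrightarrow> 0) (at_right 0)"
  proof (rule step_mean_tendsto_0)
    fix d assume d: "d \<in> steps w"
    show "((\<lambda>s. real (card (steps w)) * ?T s d / s - (- ln s + ?c)) \<longlongrightarrow> 0) (at_right 0)"
    proof (rule Lim_null_comparison)
      show "\<forall>\<^sub>F s in at_right 0. norm (real (card (steps w)) * ?T s d / s - (- ln s + ?c)) \<le>
          3 * s * (- ln s + ?c + 6 * s) + 6 * s"
        using eventually_small_time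
      proof eventually_elim
        case (elim s)
        define q where "q = heat w s d * card (steps w) / s"
        define \<Lambda> where "\<Lambda> = - ln s + ?c"
        have s: "0 < s" "s \<le> 1/12" using elim by auto
        note q = heat_step_ln[OF s d, folded q_def]
        have "ln s \<le> 0" using s by simp
        then have \<Lambda>: "\<Lambda> \<ge> 0" using step_entropy_nonneg[of w] unfolding \<Lambda>_def by linarith
        have "real (card (steps w)) * ?T s d / s = q * (\<Lambda> - ln q)"
          unfolding q(3) \<Lambda>_def by (simp add: q_def)
        then have "real (card (steps w)) * ?T s d / s - \<Lambda> = (q - 1) * (\<Lambda> - ln q) - ln q"
          by (simp add: algebra_simps)
        also have "\<bar>\<dots>\<bar> \<le> \<bar>q - 1\<bar> * \<bar>\<Lambda> - ln q\<bar> + \<bar>ln q\<bar>"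
          by (rule order_trans[OF abs_triangle_ineq4]) (simp add: abs_mult)
        also have "\<dots> \<le> 3 * s * (\<Lambda> + 6 * s) + 6 * s"
          using q \<Lambda> s by (intro add_mono mult_mono) linarith+
        finally show ?case by (simp add: \<Lambda>_def)
      qed
      show "((\<lambda>s. 3 * s * (- ln s + ?c + 6 * s) + 6 * s) \<longlongrightarrow> 0) (at_right 0)" by real_asymp
    qed
  qed
  have "((\<lambda>s. (entropy w s - ?T s 0 - (\<Sum>d\<in>steps w. ?T s d)) / s + ?T s 0 / s +
     step_mean w (\<lambda>d. real (card (steps w)) * ?T s d / s - (- ln s + ?c)) + ?c) \<longlongrightarrow> 0 + 1 + 0 + ?c) (at_right 0)"
    by (intro tendsto_add rest zero steps0 tendsto_const)
  moreover have "(entropy w s - ?T s 0 - (\<Sum>d\<in>steps w. ?T s d)) / s + ?T s 0 / s +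
     step_mean w (\<lambda>d. real (card (steps w)) * ?T s d / s - (- ln s + ?c)) + ?c = entropy w s / s + ln s" for s
    unfolding step_mean_rescaled by (simp add: diff_divide_distrib add_divide_distrib)
  ultimately show ?thesis by (simp add: add.commute)
qed

lemma sq_info_small: "((\<lambda>s. sq_info w s / s - (- ln s + step_entropy w)\<^sup>2) \<longlongrightarrow> 0) (at_right 0)"
proof -
  let ?c = "step_entropy w"
  obtain C where C: "\<And>g s. (\<And>u. 0 \<le> u \<Longrightarrow> u \<le> 1 \<Longrightarrow> \<bar>u * g u\<bar> \<le> 65 * sqrt (sqrt u) ^ 3) \<Longrightarrow> 0 < s \<Longrightarrow> s \<le> 1/16 \<Longrightarrow>
    summable (\<lambda>n. \<bar>heat w s (int_decode n) * g (heat w s (int_decode n))\<bar>) \<Longrightarrow>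
    \<bar>(\<Sum>n. heat w s (int_decode n) * g (heat w s (int_decode n))) - heat w s 0 * g (heat w s 0) -
      (\<Sum>d\<in>steps w. heat w s d * g (heat w s d))\<bar> \<le> C * sqrt (sqrt s) ^ 5"
    using core_sum_error by blast
  let ?T = "\<lambda>s x. heat w s x * (ln (heat w s x))\<^sup>2"
  have rest: "((\<lambda>s. (sq_info w s - ?T s 0 - (\<Sum>d\<in>steps w. ?T s d)) / s) \<longlongrightarrow> 0) (at_right 0)"
  proof (rule Lim_null_comparison)
    show "\<forall>\<^sub>F s in at_right 0. norm ((sq_info w s - ?T s 0 - (\<Sum>d\<in>steps w. ?T s d)) / s) \<le> C * sqrt (sqrt s) ^ 5 / s"
      using eventually_small_time
    proof eventually_elim
      case (elim s)
      have b: "\<bar>u * (ln u)\<^sup>2\<bar> \<le> 65 * sqrt (sqrt u) ^ 3" if "0 \<le> u" "u \<le> 1" for u :: real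
        using u_ln_le_root(1)[OF that] that by simp
      have b2: "\<bar>u * (ln u)\<^sup>2\<bar> \<le> 17 * sqrt u" if "0 \<le> u" "u \<le> 1" for u :: real
      proof -
        have "\<bar>u * (ln u)\<^sup>2\<bar> = u * (ln u)\<^sup>2" using that by (simp add: abs_mult)
        then show ?thesis using u_ln_le_sqrt(1)[OF that] real_sqrt_ge_zero[OF that(1)] by linarith
      qed
      have sm: "summable (\<lambda>n. \<bar>heat w s (int_decode n) * (ln (heat w s (int_decode n)))\<^sup>2\<bar>)"
        using elim by (intro summable_heat b2) auto
      have "\<bar>sq_info w s - ?T s 0 - (\<Sum>d\<in>steps w. ?T s d)\<bar> \<le> C * sqrt (sqrt s) ^ 5"
        using C[of "\<lambda>u. (ln u)\<^sup>2" s, OF b _ _ sm] elim entropy_series(4)[of s w] by simp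
      then show ?case using elim by (simp add: divide_right_mono)
    qed
    show "((\<lambda>s. C * sqrt (sqrt s) ^ 5 / s) \<longlongrightarrow> 0) (at_right 0)" by real_asymp
  qed
  have zero: "((\<lambda>s. ?T s 0 / s) \<longlongrightarrow> 0) (at_right 0)"
  proof (rule Lim_null_comparison)
    show "\<forall>\<^sub>F s in at_right 0. norm (?T s 0 / s) \<le> s" using eventually_small_time
    proof eventually_elim
      case (elim s)
      have b: "exp (-s) \<le> heat w s 0" using heat_small_bounds elim by auto
      have "ln (exp (-s)) \<le> ln (heat w s 0)" using b order_less_le_trans[OF exp_gt_zero b(1)]
        by (subst ln_le_cancel_iff) auto
      moreover have "ln (heat w s 0) \<le> 0" using order_less_le_trans[OF exp_gt_zero b(1)] by simp
      ultimately have "\<bar>ln (heat w s 0)\<bar>\<^sup>2 \<le> s\<^sup>2" by (intro power_mono) auto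
      then have "?T s 0 \<le> 1 * s\<^sup>2" by (intro mult_mono) auto
      then show ?case using elim by (simp add: power2_eq_square divide_le_eq)
    qed
  qed real_asymp
  have steps0: "((\<lambda>s. step_mean w (\<lambda>d. real (card (steps w)) * ?T s d / s - (- ln s + ?c)\<^sup>2)) \<longlongrightarrow> 0) (at_right 0)"
  proof (rule step_mean_tendsto_0)
    fix d assume d: "d \<in> steps w"
    show "((\<lambda>s. real (card (steps w)) * ?T s d / s - (- ln s + ?c)\<^sup>2) \<longlongrightarrow> 0) (at_right 0)"
    proof (rule Lim_null_comparison)
      show "\<forall>\<^sub>F s in at_right 0. norm (real (card (steps w)) * ?T s d / s - (- ln s + ?c)\<^sup>2) \<le>
          3 * s * (- ln s + ?c + 6 * s)\<^sup>2 + (2 * (- ln s + ?c) + 6 * s) * (6 * s)"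
        using eventually_small_time
      proof eventually_elim
        case (elim s)
        define q where "q = heat w s d * card (steps w) / s"
        define \<Lambda> where "\<Lambda> = - ln s + ?c"
        have s: "0 < s" "s \<le> 1/12" using elim by auto
        note q = heat_step_ln[OF s d, folded q_def]
        have "ln s \<le> 0" using s by simp
        then have \<Lambda>: "\<Lambda> \<ge> 0" using step_entropy_nonneg[of w] unfolding \<Lambda>_def by linarith
        have l: "(ln (heat w s d))\<^sup>2 = (\<Lambda> - ln q)\<^sup>2"
          unfolding q(3)[folded \<Lambda>_def, symmetric] by simp
        have "real (card (steps w)) * ?T s d / s = q * (\<Lambda> - ln q)\<^sup>2"
          unfolding l by (simp add: q_def)
        then have "real (card (steps w)) * ?T s d / s - \<Lambda>\<^sup>2 = (q - 1) * (\<Lambda> - ln q)\<^sup>2 - (2 * \<Lambda> - ln q) * ln q"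
          by (simp add: algebra_simps power2_eq_square)
        also have "\<bar>\<dots>\<bar> \<le> \<bar>q - 1\<bar> * \<bar>\<Lambda> - ln q\<bar>\<^sup>2 + \<bar>2 * \<Lambda> - ln q\<bar> * \<bar>ln q\<bar>"
          by (rule order_trans[OF abs_triangle_ineq4]) (simp add: abs_mult)
        also have "\<dots> \<le> 3 * s * (\<Lambda> + 6 * s)\<^sup>2 + (2 * \<Lambda> + 6 * s) * (6 * s)"
          using q \<Lambda> s by (intro add_mono mult_mono power_mono) (linarith | simp)+
        finally show ?case by (simp add: \<Lambda>_def)
      qed
      show "((\<lambda>s. 3 * s * (- ln s + ?c + 6 * s)\<^sup>2 + (2 * (- ln s + ?c) + 6 * s) * (6 * s)) \<longlongrightarrow> 0) (at_right 0)" by real_asymp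
    qed
  qed
  have "((\<lambda>s. (sq_info w s - ?T s 0 - (\<Sum>d\<in>steps w. ?T s d)) / s + ?T s 0 / s +
     step_mean w (\<lambda>d. real (card (steps w)) * ?T s d / s - (- ln s + ?c)\<^sup>2)) \<longlongrightarrow> 0 + 0 + 0) (at_right 0)"
    by (intro tendsto_add rest zero steps0 tendsto_const)
  moreover have "(sq_info w s - ?T s 0 - (\<Sum>d\<in>steps w. ?T s d)) / s + ?T s 0 / s +
     step_mean w (\<lambda>d. real (card (steps w)) * ?T s d / s - (- ln s + ?c)\<^sup>2) = sq_info w s / s - (- ln s + ?c)\<^sup>2" for s
    unfolding step_mean_rescaled by (simp add: diff_divide_distrib add_divide_distrib)
  ultimately show ?thesis by simp
qed

lemma varentropy_small: "((\<lambda>s. varentropy w s / s - (- ln s + step_entropy w)\<^sup>2) \<longlongrightarrow> 0) (at_right 0)"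
proof -
  have "((\<lambda>s::real. sqrt s) \<longlongrightarrow> 0) (at_right 0)" "((\<lambda>s::real. sqrt s * - ln s) \<longlongrightarrow> 0) (at_right 0)"
    by real_asymp+
  from tendsto_add[OF tendsto_mult[OF this(1) entropy_small[of w]] this(2)]
  have "((\<lambda>s. sqrt s * (entropy w s / s + ln s) + sqrt s * - ln s) \<longlongrightarrow> 0 * (step_entropy w + 1) + 0) (at_right 0)" .
  then have lim: "((\<lambda>s. sqrt s * (entropy w s / s) + sqrt s * ln s + sqrt s * - ln s) \<longlongrightarrow> 0) (at_right 0)"
    by (simp only: distrib_left mult_zero_left add_0_left)
  have "((\<lambda>s. (sqrt s * (entropy w s / s))\<^sup>2) \<longlongrightarrow> 0\<^sup>2) (at_right 0)"
  proof (rule tendsto_power)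
    show "((\<lambda>s. sqrt s * (entropy w s / s)) \<longlongrightarrow> 0) (at_right 0)" using lim by simp
  qed
  from tendsto_diff[OF sq_info_small[of w] this]
  have "((\<lambda>s. sq_info w s / s - (- ln s + step_entropy w)\<^sup>2 - (sqrt s * (entropy w s / s))\<^sup>2) \<longlongrightarrow> 0) (at_right 0)" by simp
  then show ?thesis
  proof (rule Lim_transform_eventually)
    show "\<forall>\<^sub>F s in at_right 0. sq_info w s / s - (- ln s + step_entropy w)\<^sup>2 - (sqrt s * (entropy w s / s))\<^sup>2
        = varentropy w s / s - (- ln s + step_entropy w)\<^sup>2"
      using eventually_small_time
    proof eventually_elim
      case (elim s)
      then have "(sqrt s * (entropy w s / s))\<^sup>2 = (entropy w s)\<^sup>2 / s"
        by (simp add: power_mult_distrib power_divide) (simp add: power2_eq_square)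
      then show ?case by (simp add: varentropy_def diff_divide_distrib)
    qed
  qed
qed

text \<open>As for large times, the difference quotients over the interval between \<open>s\<close> and \<open>r s\<close> bound the derivative.
  They equal \<open>- ln s + step_entropy w\<close> up to a constant that vanishes as \<open>r\<close> tends to 1.\<close>

lemma entropy'_small: "((\<lambda>s. entropy' w s + ln s) \<longlongrightarrow> step_entropy w) (at_right 0)"
proof -
  let ?c = "step_entropy w"
  let ?A = "\<lambda>s. entropy w s / s + ln s"
  have comp: "((\<lambda>s. ?A (r * s)) \<longlongrightarrow> ?c + 1) (at_right 0)" if "r > 0" for r
  proof -
    have "filterlim (\<lambda>s. r * s) (at_right 0) (at_right 0)" using that by real_asymp
    from filterlim_compose[OF entropy_small this] show ?thesis .
  qed
  have increment: "entropy w (r * s) - entropy w s = s * (r * ?A (r * s) - ?A s - r * ln r - (r - 1) * ln s)"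
    if "r > 0" "s > 0" for r s
  proof -
    have "s * (r * (entropy w (r * s) / (r * s))) = entropy w (r * s)" "s * (entropy w s / s) = entropy w s"
      "ln (r * s) = ln r + ln s"
      using that by (auto simp: ln_mult)
    moreover have "s * (r * ?A (r * s) - ?A s - r * ln r - (r - 1) * ln s) =
      s * (r * (entropy w (r * s) / (r * s))) - s * (entropy w s / s) + s * (r * (ln (r * s) - ln r - ln s))"
      by (simp only: right_diff_distrib distrib_left left_diff_distrib)
    ultimately show ?thesis by simp
  qed
  have up: "\<forall>\<^sub>F s in at_right 0. entropy' w s + ln s < b" if b: "b > ?c" for b
  proof -
    define r where "r = max (1/2) (1 - (b - ?c) / 2)"
    have "1/2 \<le> r" "1 - (b - ?c) / 2 \<le> r" "r < 1" using b by (auto simp: r_def)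
    moreover have "(b - ?c) / 2 < b - ?c" using b by simp
    ultimately have r: "0 < r" "r < 1" "?c + 1 - r < b" by linarith+
    have "((\<lambda>s. (?A s - r * ?A (r * s) + r * ln r) / (1 - r)) \<longlongrightarrow> (?c + 1 - r * (?c + 1) + r * ln r) / (1 - r)) (at_right 0)"
      using r by (intro tendsto_intros comp entropy_small) auto
    moreover have "(?c + 1 - r * (?c + 1) + r * ln r) / (1 - r) < b"
    proof -
      have "r * ln r \<le> r * (r - 1)" using ln_le_minus_one[of r] r by (intro mult_left_mono) auto
      then have "?c + 1 - r * (?c + 1) + r * ln r \<le> (1 - r) * (?c + 1 - r)" by (simp add: algebra_simps)
      also have "\<dots> < (1 - r) * b" using r by (intro mult_strict_left_mono) auto
      finally show ?thesis using r by (simp add: divide_less_eq mult.commute)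
    qed
    ultimately have "\<forall>\<^sub>F s in at_right 0. (?A s - r * ?A (r * s) + r * ln r) / (1 - r) < b"
      by (rule order_tendstoD)
    then show ?thesis using eventually_small_time
    proof eventually_elim
      case (elim s)
      have "entropy' w s * (s - r * s) \<le> entropy w s - entropy w (r * s)"
        using r elim by (intro entropy_diff_bounds) auto
      also have "\<dots> = s * (?A s - r * ?A (r * s) + r * ln r - (1 - r) * ln s)"
        using increment[of r s] r elim by (simp add: algebra_simps)
      finally have "s * (entropy' w s * (1 - r)) \<le> s * (?A s - r * ?A (r * s) + r * ln r - (1 - r) * ln s)"
        by (simp add: algebra_simps)
      then have "entropy' w s * (1 - r) \<le> ?A s - r * ?A (r * s) + r * ln r - (1 - r) * ln s" using elim by simp
      then have "(entropy' w s + ln s) * (1 - r) \<le> ?A s - r * ?A (r * s) + r * ln r" by (simp add: algebra_simps)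
      then have "entropy' w s + ln s \<le> (?A s - r * ?A (r * s) + r * ln r) / (1 - r)" using r by (simp add: le_divide_eq)
      then show ?case using elim by linarith
    qed
  qed
  have low: "\<forall>\<^sub>F s in at_right 0. a < entropy' w s + ln s" if a: "a < ?c" for a
  proof -
    define r where "r = 1 + (?c - a) / 2"
    have r: "1 < r" "a < ?c + 1 - r" using a by (auto simp: r_def field_simps)
    have "((\<lambda>s. (r * ?A (r * s) - ?A s - r * ln r) / (r - 1)) \<longlongrightarrow> (r * (?c + 1) - (?c + 1) - r * ln r) / (r - 1)) (at_right 0)"
      using r by (intro tendsto_intros comp entropy_small) auto
    moreover have "a < (r * (?c + 1) - (?c + 1) - r * ln r) / (r - 1)"
    proof -
      have "r * ln r \<le> r * (r - 1)" using ln_le_minus_one[of r] r by (intro mult_left_mono) auto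
      then have "(r - 1) * (?c + 1 - r) \<le> r * (?c + 1) - (?c + 1) - r * ln r" by (simp add: algebra_simps)
      moreover have "(r - 1) * a < (r - 1) * (?c + 1 - r)" using r by (intro mult_strict_left_mono) auto
      ultimately have "(r - 1) * a < r * (?c + 1) - (?c + 1) - r * ln r" by (rule order_less_le_trans[rotated])
      then show ?thesis using r by (subst pos_less_divide_eq) (simp_all add: mult.commute)
    qed
    ultimately have "\<forall>\<^sub>F s in at_right 0. a < (r * ?A (r * s) - ?A s - r * ln r) / (r - 1)"
      by (rule order_tendstoD)
    then show ?thesis using eventually_small_time
    proof eventually_elim
      case (elim s)
      have "s * (r * ?A (r * s) - ?A s - r * ln r - (r - 1) * ln s) = entropy w (r * s) - entropy w s"
        using increment[of r s] r elim by (simp add: algebra_simps)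
      also have "\<dots> \<le> entropy' w s * (r * s - s)"
        using r elim by (intro entropy_diff_bounds) auto
      finally have "s * (r * ?A (r * s) - ?A s - r * ln r - (r - 1) * ln s) \<le> s * (entropy' w s * (r - 1))"
        by (simp add: algebra_simps)
      then have "r * ?A (r * s) - ?A s - r * ln r - (r - 1) * ln s \<le> entropy' w s * (r - 1)" using elim by simp
      then have "r * ?A (r * s) - ?A s - r * ln r \<le> (entropy' w s + ln s) * (r - 1)" by (simp add: algebra_simps)
      then have "(r * ?A (r * s) - ?A s - r * ln r) / (r - 1) \<le> entropy' w s + ln s" using r by (simp add: divide_le_eq)
      then show ?case using elim by linarith
    qed
  qed
  show ?thesis by (rule order_tendstoI) (use up low in auto)
qed

section \<open>Entropic times and their perturbation\<close>

lemma law_of_first_coordinate: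
  assumes "k \<ge> 1" "t \<ge> 0"
  shows "mean_Q1 w k t = entropy w (t / real k)" "var_Q1 w k t = varentropy w (t / real k)"
proof -
  define s where "s = t / real k"
  have s: "s \<ge> 0" "s * real k = t" using assms by (auto simp: s_def)
  have law: "coord_law w k s = coord_law w 1 s" using assms s by (intro coord_law_indep) auto
  have E: "measure_pmf.expectation (walk_law w k t) (\<lambda>x. g (x 1)) = E_rw w s g" for g :: "int \<Rightarrow> real"
  proof -
    have "coord_law w 1 s = map_pmf (\<lambda>x. x 1) (walk_law w k t)"
      using law by (simp only: coord_law_def s(2))
    then show ?thesis by simp
  qed
  have Q: "Q w k 1 t = (\<lambda>x. - ln (heat w s (x 1)))"
    unfolding Q_def s_def[symmetric] law heat_def ..
  show m: "mean_Q1 w k t = entropy w (t / real k)"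
    unfolding mean_Q1_def Q E[of "\<lambda>y. - ln (heat w s y)"] entropy_def s_def[symmetric] ..
  have "var_Q1 w k t = measure_pmf.variance (coord_law w 1 s) (\<lambda>y. - ln (heat w s y))"
    unfolding var_Q1_def Q E[of "\<lambda>y. - ln (heat w s y)"] by (rule E)
  also have "\<dots> = varentropy w s"
    using entropy_series(1,2)[OF s(1), of w]
    by (subst measure_pmf.variance_eq) (auto simp: varentropy_def sq_info_def entropy_def)
  finally show "var_Q1 w k t = varentropy w (t / real k)" by (simp add: s_def)
qed

lemma entropy_nonneg: "entropy w s \<ge> 0"
proof -
  have "ln (heat w s x) \<le> 0" for x
  proof (cases "heat w s x = 0")
    case False
    then have "heat w s x > 0" using heat_nonneg[of w s x] by linarith
    then show ?thesis by simp
  qed simp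
  then show ?thesis unfolding entropy_def by (intro integral_nonneg_AE) auto
qed

lemma entropy_at_top: "filterlim (entropy w) at_top at_top"
proof -
  have "filterlim (\<lambda>s::real. ln (2 * pi * s) / 2 + 1 / 2) at_top at_top" by real_asymp
  from filterlim_tendsto_add_at_top[OF entropy_large[of w] this] show ?thesis by simp
qed

text \<open>A decreasing derivative that is not positive at one time is not positive later, and then the entropy would be
  bounded.\<close>

lemma entropy'_pos:
  assumes "s > 0"
  shows "entropy' w s > 0"
proof (rule ccontr)
  assume "\<not> entropy' w s > 0"
  then have le: "entropy w t \<le> entropy w s" if "t \<ge> s" for t
    using entropy_diff_bounds(2)[OF assms that, of w] that mult_nonpos_nonneg[of "entropy' w s" "t - s"] by simp
  have "\<forall>\<^sub>F t in at_top. entropy w t > entropy w s"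
    using entropy_at_top[of w] by (simp add: filterlim_at_top_dense)
  then have "\<forall>\<^sub>F t in at_top. t \<ge> s \<and> entropy w t > entropy w s"
    using eventually_ge_at_top[of s] by eventually_elim auto
  then obtain t where "t \<ge> s" "entropy w t > entropy w s"
    using eventually_happens'[OF trivial_limit_at_top_linorder] by blast
  then show False using le[of t] by simp
qed

lemma entropy_strict_mono:
  assumes "0 \<le> a" "a < b"
  shows "entropy w a < entropy w b"
proof -
  have pos: "entropy w a < entropy w b" if "0 < a" "a < b" for a b
  proof -
    have "0 < entropy' w b * (b - a)" using entropy'_pos[of b w] that by simp
    also have "\<dots> \<le> entropy w b - entropy w a" using that by (intro entropy_diff_bounds) auto
    finally show ?thesis by simp
  qed
  show ?thesis
  proof (cases "a = 0")
    case True
    have "entropy w a \<le> entropy w (b / 2)" using True entropy_nonneg by (simp add: entropy_0)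
    also have "\<dots> < entropy w b" using assms by (intro pos) auto
    finally show ?thesis .
  qed (use assms pos in auto)
qed

lemma entropy_le_iff: "0 \<le> a \<Longrightarrow> 0 \<le> b \<Longrightarrow> entropy w a \<le> entropy w b \<longleftrightarrow> a \<le> b"
  using entropy_strict_mono[of a b w] entropy_strict_mono[of b a w] by (cases a b rule: linorder_cases) auto

lemma entropy_less_iff: "0 \<le> a \<Longrightarrow> 0 \<le> b \<Longrightarrow> entropy w a < entropy w b \<longleftrightarrow> a < b"
  using entropy_le_iff[of b a w] by (simp add: not_le[symmetric])

lemma entropy_eq_iff: "0 \<le> a \<Longrightarrow> 0 \<le> b \<Longrightarrow> entropy w a = entropy w b \<longleftrightarrow> a = b"
  using entropy_le_iff[of a b w] entropy_le_iff[of b a w] by auto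

definition entropy_inv :: "walk_type \<Rightarrow> real \<Rightarrow> real" where
  "entropy_inv w y = (THE s. s \<ge> 0 \<and> entropy w s = y)"

lemma entropy_inv_entropy:
  assumes "s \<ge> 0"
  shows "entropy_inv w (entropy w s) = s"
  unfolding entropy_inv_def by (rule the_equality) (use assms in \<open>auto simp: entropy_eq_iff\<close>)

lemma entropy_inv:
  assumes "y \<ge> 0"
  shows "entropy_inv w y \<ge> 0" "entropy w (entropy_inv w y) = y"
proof -
  have "\<forall>\<^sub>F t in at_top. entropy w t \<ge> y" using entropy_at_top[of w] by (simp add: filterlim_at_top)
  then have "\<forall>\<^sub>F t in at_top. t \<ge> 0 \<and> entropy w t \<ge> y"
    using eventually_ge_at_top[of 0] by eventually_elim auto
  then obtain t where t: "t \<ge> 0" "entropy w t \<ge> y"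
    using eventually_happens'[OF trivial_limit_at_top_linorder] by blast
  have "\<exists>s\<ge>0. s \<le> t \<and> entropy w s = y"
    by (rule IVT') (use t assms continuous_on_subset[OF continuous_on_entropy] in \<open>auto simp: entropy_0\<close>)
  then obtain s where "s \<ge> 0" "entropy w s = y" by auto
  then show "entropy_inv w y \<ge> 0" "entropy w (entropy_inv w y) = y" using entropy_inv_entropy[of s w] by auto
qed

lemma entropy_inv_pos: "y > 0 \<Longrightarrow> entropy_inv w y > 0"
  using entropy_inv[of y w] entropy_0[of w] by (cases "entropy_inv w y = 0") auto

lemma entropy_inv_less: "0 \<le> y \<Longrightarrow> 0 \<le> s \<Longrightarrow> y < entropy w s \<Longrightarrow> entropy_inv w y < s"
  using entropy_less_iff[of "entropy_inv w y" s w] entropy_inv[of y w] by auto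

lemma less_entropy_inv: "0 \<le> y \<Longrightarrow> 0 \<le> s \<Longrightarrow> entropy w s < y \<Longrightarrow> s < entropy_inv w y"
  using entropy_less_iff[of s "entropy_inv w y" w] entropy_inv[of y w] by auto

lemma tendsto_entropy_inv:
  assumes "(Y \<longlongrightarrow> entropy w s) F" "\<forall>\<^sub>F x in F. Y x \<ge> 0" "s \<ge> 0"
  shows "((\<lambda>x. entropy_inv w (Y x)) \<longlongrightarrow> s) F"
proof (rule order_tendstoI)
  fix a assume a: "a < s"
  show "\<forall>\<^sub>F x in F. a < entropy_inv w (Y x)"
  proof (cases "a < 0")
    case True
    show ?thesis using assms(2) by eventually_elim (use True entropy_inv(1) order_less_le_trans in blast)
  next
    case False
    then have "entropy w a < entropy w s" using a by (intro entropy_strict_mono) auto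
    from order_tendstoD(1)[OF assms(1) this] assms(2) show ?thesis
      by eventually_elim (use False in \<open>auto intro: less_entropy_inv\<close>)
  qed
next
  fix b assume b: "s < b"
  then have "entropy w s < entropy w b" using assms by (intro entropy_strict_mono) auto
  from order_tendstoD(2)[OF assms(1) this] assms(2) show "\<forall>\<^sub>F x in F. entropy_inv w (Y x) < b"
    by eventually_elim (use b assms in \<open>auto intro: entropy_inv_less\<close>)
qed

lemma entropy_inv_at_top:
  assumes "filterlim Y at_top F"
  shows "filterlim (\<lambda>x. entropy_inv w (Y x)) at_top F"
  unfolding filterlim_at_top_dense
proof
  fix Z
  have 1: "\<forall>\<^sub>F x in F. Y x > entropy w (max 0 Z)"
    using assms by (simp add: filterlim_at_top_dense)
  then show "\<forall>\<^sub>F x in F. Z < entropy_inv w (Y x)"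
  proof eventually_elim
    case (elim x)
    then have "max 0 Z < entropy_inv w (Y x)" using entropy_nonneg[of w "max 0 Z"] by (intro less_entropy_inv) auto
    then show ?case by simp
  qed
qed

lemma continuous_on_entropy_inv: "continuous_on {0<..} (entropy_inv w)"
  unfolding continuous_on_def
proof
  fix y :: real assume "y \<in> {0<..}"
  then have y: "y > 0" by simp
  show "(entropy_inv w \<longlongrightarrow> entropy_inv w y) (at y within {0<..})"
  proof (rule tendsto_entropy_inv)
    show "((\<lambda>x. x) \<longlongrightarrow> entropy w (entropy_inv w y)) (at y within {0<..})"
      using entropy_inv(2)[of y w] y by (simp add: tendsto_ident_at)
    show "\<forall>\<^sub>F x in at y within {0<..}. (0::real) \<le> x" by (auto simp: eventually_at_filter)
  qed (use entropy_inv y in auto)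
qed

text \<open>Zero variance would make the mass function constant on its infinite support.\<close>

lemma varentropy_pos:
  assumes "s > 0"
  shows "varentropy w s > 0"
proof (rule ccontr)
  assume "\<not> varentropy w s > 0"
  then have v0: "varentropy w s = 0" using varentropy_nonneg[of s w] assms by simp
  have s0: "s \<ge> 0" using assms by simp
  note i = entropy_series(1,2)[OF s0, of w]
  let ?X = "\<lambda>x. ln (heat w s x)"
  let ?m = "E_rw w s ?X"
  have "E_rw w s (\<lambda>x. (?X x - ?m)\<^sup>2) = varentropy w s"
    using measure_pmf.variance_eq[OF i] by (simp add: varentropy_def sq_info_def entropy_def)
  moreover have "integrable (measure_pmf (coord_law w 1 s)) (\<lambda>x. (?X x - ?m)\<^sup>2)"
    using i by (auto simp: power2_diff)
  ultimately have "AE x in measure_pmf (coord_law w 1 s). (?X x - ?m)\<^sup>2 = 0"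
    using v0 integral_nonneg_eq_0_iff_AE[of "measure_pmf (coord_law w 1 s)" "\<lambda>x. (?X x - ?m)\<^sup>2"] by simp
  then have const: "?X x = ?m" if "heat w s x \<noteq> 0" for x
    using that by (auto simp: AE_measure_pmf_iff set_pmf_iff heat_def)
  have "heat w s (int n) = exp ?m" for n
  proof -
    have "heat w s (int n) > 0" using assms by (intro heat_pos) (auto simp: reachable_def)
    then show ?thesis using const[of "int n"] by (metis exp_ln less_irrefl)
  qed
  moreover have "(\<lambda>n. exp (s * 3) / 4 ^ n) \<longlonglongrightarrow> 0" by real_asymp
  then have "\<forall>\<^sub>F n in sequentially. exp (s * 3) / 4 ^ n < exp ?m"
    using order_tendstoD(2)[of _ 0 sequentially "exp ?m"] by simp
  then obtain n where "exp (s * 3) / 4 ^ n < exp ?m"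
    by (auto simp: eventually_sequentially)
  moreover have "heat w s (int n) \<le> exp (s * 3) / 4 ^ n" using heat_le[OF s0, of 4 w "int n"] by simp
  ultimately show False by simp
qed

lemma continuous_on_varentropy: "continuous_on {0..} (varentropy w)"
  unfolding varentropy_def[abs_def] by (intro continuous_intros continuous_on_sq_info continuous_on_entropy)

text \<open>By the linearised equation of the cutoff times, \<open>spread w s / sqrt k\<close> is the relative width of the window around
  \<open>s\<close>, in units of \<open>\<alpha>\<close>.\<close>

definition spread :: "walk_type \<Rightarrow> real \<Rightarrow> real" where
  "spread w s = sqrt (varentropy w s) / (s * entropy' w s)"

lemma spread_pos: "s > 0 \<Longrightarrow> spread w s > 0"
  by (simp add: spread_def varentropy_pos entropy'_pos)

lemma continuous_on_spread: "continuous_on {0<..} (spread w)"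
  unfolding spread_def[abs_def]
  by (intro continuous_intros continuous_on_subset[OF continuous_on_varentropy] continuous_on_entropy')
     (auto simp: less_imp_neq[OF entropy'_pos, symmetric])

text \<open>Write \<open>\<delta> = \<alpha> * spread / sqrt k\<close>; the entropy has to change by \<open>\<delta> * s * entropy' w s\<close>. As \<open>\<delta>\<close> tends to 0, concavity
  first confines the solution to \<open>[(1 - \<eta>) s, (1 + \<eta>) s]\<close> for every small \<open>\<eta>\<close>. On that interval the derivative
  differs from its value at \<open>s\<close> by factors close to \<open>\<rho> (1 - \<eta>)\<close> and \<open>\<rho> (1 + \<eta>)\<close>, so the displacement is
  \<open>\<delta> * s\<close> up to such factors, which tend to 1 with \<open>\<eta>\<close>.\<close>

lemma perturbation:
  fixes s k :: "nat \<Rightarrow> real" and \<alpha> :: real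
  assumes s: "\<forall>\<^sub>F n in sequentially. s n > 0" and k: "\<forall>\<^sub>F n in sequentially. k n > 0"
    and small: "(\<lambda>n. spread w (s n) / sqrt (k n)) \<longlonglongrightarrow> 0"
    and \<rho>: "\<And>r. r > 0 \<Longrightarrow> (\<lambda>n. entropy' w (r * s n) / entropy' w (s n)) \<longlonglongrightarrow> \<rho> r"
    and cont: "isCont \<rho> 1" "\<rho> 1 = 1"
  defines "y \<equiv> \<lambda>n. entropy w (s n) + \<alpha> * sqrt (varentropy w (s n) / k n)"
  shows "\<forall>\<^sub>F n in sequentially. y n \<ge> 0"
    and "(\<lambda>n. entropy_inv w (y n) / s n) \<longlonglongrightarrow> 1"
    and "(\<lambda>n. entropy_inv w (y n) - s n) \<sim>[sequentially] (\<lambda>n. spread w (s n) * \<alpha> * s n / sqrt (k n))"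
proof -
  define \<delta> where "\<delta> = (\<lambda>n. \<alpha> * (spread w (s n) / sqrt (k n)))"
  have \<delta>0: "\<delta> \<longlonglongrightarrow> 0" unfolding \<delta>_def using tendsto_mult[OF tendsto_const small, of \<alpha>] by simp
  have y: "\<forall>\<^sub>F n in sequentially. y n = entropy w (s n) + \<delta> n * s n * entropy' w (s n)"
    using s k
  proof eventually_elim
    case (elim n)
    have "spread w (s n) / sqrt (k n) * s n * entropy' w (s n) = sqrt (varentropy w (s n) / k n)"
      using elim entropy'_pos[OF elim(1), of w] by (simp add: spread_def real_sqrt_divide)
    then show ?case unfolding y_def \<delta>_def by (simp only: mult.assoc)
  qed
  have \<rho>_right: "((\<lambda>\<eta>. \<rho> (1 + \<eta>)) \<longlongrightarrow> 1) (at_right 0)" and \<rho>_left: "((\<lambda>\<eta>. \<rho> (1 - \<eta>)) \<longlongrightarrow> 1) (at_right 0)"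
  proof -
    have "((\<lambda>\<eta>. 1 + \<eta>) \<longlongrightarrow> (1::real)) (at_right 0)" "((\<lambda>\<eta>. 1 - \<eta>) \<longlongrightarrow> (1::real)) (at_right 0)"
      by real_asymp+
    from this[THEN isCont_tendsto_compose[OF cont(1)]] cont(2)
    show "((\<lambda>\<eta>. \<rho> (1 + \<eta>)) \<longlongrightarrow> 1) (at_right 0)" "((\<lambda>\<eta>. \<rho> (1 - \<eta>)) \<longlongrightarrow> 1) (at_right 0)"
      by simp_all
  qed
  have crude: "\<forall>\<^sub>F n in sequentially. y n \<ge> 0 \<and> (1 - \<eta>) * s n \<le> entropy_inv w (y n) \<and> entropy_inv w (y n) \<le> (1 + \<eta>) * s n"
    if \<eta>: "0 < \<eta>" "\<eta> < 1" "\<rho> (1 + \<eta>) > 1/2" for \<eta>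
  proof -
    have "\<forall>\<^sub>F n in sequentially. entropy' w ((1 + \<eta>) * s n) / entropy' w (s n) > 1/2"
      using order_tendstoD(1)[OF \<rho> \<eta>(3)] \<eta> by simp
    moreover have "\<forall>\<^sub>F n in sequentially. \<bar>\<delta> n\<bar> < \<eta> / 2"
      using order_tendstoD(2)[OF tendsto_rabs_zero[OF \<delta>0], of "\<eta> / 2"] \<eta> by simp
    ultimately show ?thesis using s y
    proof eventually_elim
      case (elim n)
      define S where "S = s n"
      define D where "D = entropy' w S"
      have S: "S > 0" using elim by (simp add: S_def)
      have D: "D > 0" using S by (simp add: D_def entropy'_pos)
      have yn: "y n = entropy w S + \<delta> n * S * D" using elim by (simp add: S_def D_def)
      have up: "1/2 * D \<le> entropy' w ((1 + \<eta>) * S)"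
        using elim(1) D by (simp add: S_def D_def field_simps)
      have "\<delta> n * S * D \<le> \<bar>\<delta> n\<bar> * (S * D)" using S D by (simp add: mult.assoc mult_right_mono)
      also have "\<dots> \<le> \<eta> / 2 * (S * D)" using elim(2) S D by (intro mult_right_mono) auto
      also have "\<dots> = (1/2 * D) * ((1 + \<eta>) * S - S)" by (simp add: algebra_simps)
      also have "\<dots> \<le> entropy' w ((1 + \<eta>) * S) * ((1 + \<eta>) * S - S)"
        using up S \<eta> by (intro mult_right_mono) (auto simp: algebra_simps)
      also have "\<dots> \<le> entropy w ((1 + \<eta>) * S) - entropy w S"
        using S \<eta> by (intro entropy_diff_bounds) (auto simp: algebra_simps)
      finally have hi: "y n \<le> entropy w ((1 + \<eta>) * S)" unfolding yn by simp
      have "- (\<delta> n * S * D) \<le> \<bar>\<delta> n\<bar> * (S * D)"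
        using S D by (metis abs_ge_minus_self abs_mult abs_of_pos mult.assoc mult_pos_pos)
      also have "\<dots> \<le> \<eta> * (S * D)" using elim(2) S D \<eta> by (intro mult_right_mono) auto
      also have "\<dots> = D * (S - (1 - \<eta>) * S)" by (simp add: algebra_simps)
      also have "\<dots> \<le> entropy w S - entropy w ((1 - \<eta>) * S)"
        unfolding D_def using S \<eta> by (intro entropy_diff_bounds) (auto simp: algebra_simps)
      finally have lo: "entropy w ((1 - \<eta>) * S) \<le> y n" unfolding yn by simp
      have y0: "y n \<ge> 0" using lo entropy_nonneg[of w "(1 - \<eta>) * S"] by linarith
      have nn: "(1 - \<eta>) * S \<ge> 0" "(1 + \<eta>) * S \<ge> 0" using S \<eta> by auto
      have "(1 - \<eta>) * S \<le> entropy_inv w (y n)" "entropy_inv w (y n) \<le> (1 + \<eta>) * S"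
        using hi lo entropy_le_iff[OF nn(1) entropy_inv(1)[OF y0, of w], of w] entropy_le_iff[OF entropy_inv(1)[OF y0, of w] nn(2), of w]
        by (simp_all add: entropy_inv(2)[OF y0])
      then show ?case using y0 by (simp add: S_def)
    qed
  qed
  have ev\<eta>: "\<forall>\<^sub>F \<eta> in at_right 0. 0 < \<eta> \<and> \<eta> < 1 \<and> \<rho> (1 + \<eta>) > 1/2"
  proof -
    have "\<forall>\<^sub>F \<eta> in at_right 0. \<rho> (1 + \<eta>) > 1/2" using order_tendstoD(1)[OF \<rho>_right, of "1/2"] by simp
    moreover have "\<forall>\<^sub>F \<eta> in at_right (0::real). 0 < \<eta> \<and> \<eta> < 1"
      by (auto simp: eventually_at_right_field intro!: exI[of _ 1])
    ultimately show ?thesis by eventually_elim auto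
  qed
  obtain \<eta>0 where "0 < \<eta>0" "\<eta>0 < 1" "\<rho> (1 + \<eta>0) > 1/2"
    using eventually_happens'[OF trivial_limit_at_right_real ev\<eta>] by blast
  from crude[OF this] show y0: "\<forall>\<^sub>F n in sequentially. y n \<ge> 0" by eventually_elim auto
  show "(\<lambda>n. entropy_inv w (y n) / s n) \<longlonglongrightarrow> 1"
  proof (rule tendstoI)
    fix e :: real assume e: "e > 0"
    have "\<forall>\<^sub>F \<eta> in at_right 0. \<eta> < e" using e by (auto simp: eventually_at_right_field)
    with ev\<eta> have "\<forall>\<^sub>F \<eta> in at_right 0. (0 < \<eta> \<and> \<eta> < 1 \<and> \<rho> (1 + \<eta>) > 1/2) \<and> \<eta> < e" by eventually_elim auto
    then obtain \<eta> where \<eta>: "0 < \<eta>" "\<eta> < 1" "\<rho> (1 + \<eta>) > 1/2" "\<eta> < e"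
      using eventually_happens'[OF trivial_limit_at_right_real] by blast
    from crude[OF \<eta>(1-3)] s show "\<forall>\<^sub>F n in sequentially. dist (entropy_inv w (y n) / s n) 1 < e"
    proof eventually_elim
      case (elim n)
      then have "1 - \<eta> \<le> entropy_inv w (y n) / s n" "entropy_inv w (y n) / s n \<le> 1 + \<eta>"
        by (auto simp: le_divide_eq divide_le_eq)
      then show ?case using \<eta>(4) by (simp add: dist_real_def abs_less_iff)
    qed
  qed
  show "(\<lambda>n. entropy_inv w (y n) - s n) \<sim>[sequentially] (\<lambda>n. spread w (s n) * \<alpha> * s n / sqrt (k n))"
  proof (cases "\<alpha> = 0")
    case True
    have "\<forall>\<^sub>F n in sequentially. entropy_inv w (y n) - s n = 0"
      using s by eventually_elim (simp add: y_def True entropy_inv_entropy)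
    then show ?thesis using True by (simp add: asymp_equiv_cong[OF _ always_eventually] asymp_equiv_refl_ev)
  next
    case False
    define T where "T = (\<lambda>n. (entropy_inv w (y n) - s n) / (\<delta> n * s n))"
    have \<delta>s: "\<forall>\<^sub>F n in sequentially. \<delta> n \<noteq> 0 \<and> (\<alpha> > 0 \<longrightarrow> \<delta> n > 0) \<and> (\<alpha> < 0 \<longrightarrow> \<delta> n < 0)"
      using s k
    proof eventually_elim
      case (elim n)
      then have c: "spread w (s n) / sqrt (k n) > 0" using spread_pos by simp
      show ?case using False mult_pos_pos[OF _ c, of \<alpha>] mult_neg_pos[OF _ c, of \<alpha>]
        unfolding \<delta>_def by linarith
    qed
    have bound: "\<forall>\<^sub>F n in sequentially. min 1 (entropy' w (s n) / entropy' w ((1 - \<eta>) * s n)) \<le> T n \<and>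
        T n \<le> max 1 (entropy' w (s n) / entropy' w ((1 + \<eta>) * s n))"
      if \<eta>: "0 < \<eta>" "\<eta> < 1" "\<rho> (1 + \<eta>) > 1/2" for \<eta>
      using crude[OF \<eta>] s y \<delta>s
    proof eventually_elim
      case (elim n)
      define S where "S = s n"
      define S' where "S' = entropy_inv w (y n)"
      define D where "D = entropy' w S"
      have S: "S > 0" using elim by (simp add: S_def)
      have D: "D > 0" using S by (simp add: D_def entropy'_pos)
      have S'b: "(1 - \<eta>) * S \<le> S'" "S' \<le> (1 + \<eta>) * S" using elim by (auto simp: S_def S'_def)
      then have S': "S' > 0" using S \<eta> by (meson less_le_trans mult_pos_pos diff_gt_0_iff_gt)
      have diff: "entropy w S' - entropy w S = \<delta> n * S * D"
        using elim entropy_inv(2)[of "y n" w] by (simp add: S_def S'_def D_def)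
      have T: "T n = (S' - S) / (\<delta> n * S)" by (simp add: T_def S_def S'_def)
      have pos: "(1 - \<eta>) * S > 0" "(1 + \<eta>) * S > 0" using S \<eta> by auto
      have goal: "min 1 (D / entropy' w ((1 - \<eta>) * S)) \<le> T n \<and> T n \<le> max 1 (D / entropy' w ((1 + \<eta>) * S))"
      proof (cases "\<delta> n > 0")
        case True
        then have "entropy w S < entropy w S'" using diff S D by (metis diff_gt_0_iff_gt mult_pos_pos)
        then have SS': "S < S'" using entropy_less_iff[of S S' w] S S' by simp
        note b = entropy_diff_bounds[OF S less_imp_le[OF SS'], of w, unfolded diff]
        have "\<delta> n * S * D \<le> (S' - S) * D" using b(2) by (simp add: D_def mult.commute)
        then have "\<delta> n * S \<le> S' - S" using D by simp
        then have T1: "1 \<le> T n" unfolding T using True S by (simp add: le_divide_eq)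
        have e: "entropy' w ((1 + \<eta>) * S) \<le> entropy' w S'" using S' S'b by (intro entropy'_antimono) auto
        have "entropy' w ((1 + \<eta>) * S) * (S' - S) \<le> entropy' w S' * (S' - S)"
          using e SS' by (intro mult_right_mono) auto
        also have "\<dots> \<le> D * (\<delta> n * S)" using b(1) by (simp add: mult.commute)
        finally have "T n \<le> D / entropy' w ((1 + \<eta>) * S)"
          unfolding T using True S entropy'_pos[OF pos(2), of w] by (simp add: divide_le_eq le_divide_eq mult_ac)
        then show ?thesis using T1 by (auto simp: min_le_iff_disj le_max_iff_disj)
      next
        case False
        then have neg: "\<delta> n < 0" using elim by auto
        then have "\<delta> n * S * D < 0" using S D by (simp add: mult_neg_pos)
        then have "entropy w S' < entropy w S" using diff by linarith
        then have SS': "S' < S" using entropy_less_iff[of S' S w] S S' by simp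
        note b = entropy_diff_bounds[OF S' less_imp_le[OF SS'], of w]
        have diff': "entropy w S - entropy w S' = (- \<delta> n * S) * D" using diff by simp
        have T': "T n = (S - S') / (- \<delta> n * S)" unfolding T by (simp add: minus_divide_right[symmetric] minus_divide_left)
        have "D * (S - S') \<le> D * (- \<delta> n * S)" using b(1) unfolding diff' by (simp add: D_def mult.commute)
        then have "S - S' \<le> - \<delta> n * S" using D by (simp only: mult_le_cancel_left_pos)
        moreover have \<delta>S: "- \<delta> n * S > 0" using neg S by (simp add: mult_neg_pos)
        ultimately have T1: "T n \<le> 1" unfolding T' by (subst pos_divide_le_eq) (simp_all only: mult_1)
        have e: "entropy' w S' \<le> entropy' w ((1 - \<eta>) * S)" using pos S'b by (intro entropy'_antimono) auto
        have "D * (- \<delta> n * S) \<le> entropy' w S' * (S - S')" using b(2) unfolding diff' by (simp add: mult.commute)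
        also have "\<dots> \<le> entropy' w ((1 - \<eta>) * S) * (S - S')" using e SS' by (intro mult_right_mono) auto
        finally have "D \<le> entropy' w ((1 - \<eta>) * S) * (S - S') / (- \<delta> n * S)"
          by (subst pos_le_divide_eq[OF \<delta>S])
        then have "D \<le> T n * entropy' w ((1 - \<eta>) * S)" unfolding T' by (simp add: mult.commute)
        then have "D / entropy' w ((1 - \<eta>) * S) \<le> T n" using entropy'_pos[OF pos(1), of w] by (simp add: divide_le_eq)
        then show ?thesis using T1 by (auto simp: min_le_iff_disj le_max_iff_disj)
      qed
      then show ?case by (simp add: S_def D_def)
    qed
    have inv_lim: "(\<lambda>n. entropy' w (s n) / entropy' w (r * s n)) \<longlonglongrightarrow> 1 / \<rho> r" if "r > 0" "\<rho> r \<noteq> 0" for r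
      using tendsto_divide[OF tendsto_const \<rho>[OF that(1)] that(2), of 1] by simp
    have "T \<longlonglongrightarrow> 1"
    proof (rule order_tendstoI)
      fix b :: real assume b: "1 < b"
      have "((\<lambda>\<eta>. 1 / \<rho> (1 + \<eta>)) \<longlongrightarrow> 1 / 1) (at_right 0)" by (intro tendsto_intros \<rho>_right) auto
      then have "\<forall>\<^sub>F \<eta> in at_right 0. 1 / \<rho> (1 + \<eta>) < b" using order_tendstoD(2) b by fastforce
      with ev\<eta> have "\<forall>\<^sub>F \<eta> in at_right 0. (0 < \<eta> \<and> \<eta> < 1 \<and> \<rho> (1 + \<eta>) > 1/2) \<and> 1 / \<rho> (1 + \<eta>) < b" by eventually_elim auto
      then obtain \<eta> where \<eta>: "0 < \<eta>" "\<eta> < 1" "\<rho> (1 + \<eta>) > 1/2" "1 / \<rho> (1 + \<eta>) < b"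
        using eventually_happens'[OF trivial_limit_at_right_real] by blast
      have "(\<lambda>n. entropy' w (s n) / entropy' w ((1 + \<eta>) * s n)) \<longlonglongrightarrow> 1 / \<rho> (1 + \<eta>)"
        using \<eta> by (intro inv_lim) auto
      from order_tendstoD(2)[OF this \<eta>(4)] bound[OF \<eta>(1-3)]
      show "\<forall>\<^sub>F n in sequentially. T n < b" by eventually_elim (use b in \<open>auto simp: max_def split: if_splits\<close>)
    next
      fix a :: real assume a: "a < 1"
      have l: "((\<lambda>\<eta>. 1 / \<rho> (1 - \<eta>)) \<longlongrightarrow> 1 / 1) (at_right 0)" by (intro tendsto_intros \<rho>_left) auto
      have "\<forall>\<^sub>F \<eta> in at_right 0. a < 1 / \<rho> (1 - \<eta>)" using order_tendstoD(1)[OF l, of a] a by simp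
      moreover have "\<forall>\<^sub>F \<eta> in at_right 0. 0 < \<rho> (1 - \<eta>)" using order_tendstoD(1)[OF \<rho>_left, of 0] by simp
      ultimately have "\<forall>\<^sub>F \<eta> in at_right 0. (0 < \<eta> \<and> \<eta> < 1 \<and> \<rho> (1 + \<eta>) > 1/2) \<and> a < 1 / \<rho> (1 - \<eta>) \<and> 0 < \<rho> (1 - \<eta>)"
        using ev\<eta> by eventually_elim auto
      then obtain \<eta> where \<eta>: "0 < \<eta>" "\<eta> < 1" "\<rho> (1 + \<eta>) > 1/2" "a < 1 / \<rho> (1 - \<eta>)" "0 < \<rho> (1 - \<eta>)"
        using eventually_happens'[OF trivial_limit_at_right_real] by blast
      have "(\<lambda>n. entropy' w (s n) / entropy' w ((1 - \<eta>) * s n)) \<longlonglongrightarrow> 1 / \<rho> (1 - \<eta>)"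
        using \<eta> by (intro inv_lim) auto
      from order_tendstoD(1)[OF this \<eta>(4)] bound[OF \<eta>(1-3)]
      show "\<forall>\<^sub>F n in sequentially. a < T n" by eventually_elim (use a in \<open>auto simp: min_def split: if_splits\<close>)
    qed
    moreover have "T = (\<lambda>n. (entropy_inv w (y n) - s n) / (spread w (s n) * \<alpha> * s n / sqrt (k n)))"
      by (simp add: T_def \<delta>_def mult_ac)
    ultimately show ?thesis by (intro asymp_equivI') (simp only:)
  qed
qed

section \<open>The window scale at extreme times\<close>

lemma varentropy_small_sqrt: "((\<lambda>s. sqrt (varentropy w s / s) - (- ln s + step_entropy w)) \<longlongrightarrow> 0) (at_right 0)"
proof (rule Lim_null_comparison)
  let ?\<Lambda> = "\<lambda>s. - ln s + step_entropy w"
  show "((\<lambda>s. \<bar>varentropy w s / s - (?\<Lambda> s)\<^sup>2\<bar>) \<longlongrightarrow> 0) (at_right 0)"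
    using varentropy_small by (rule tendsto_rabs_zero)
  have "\<forall>\<^sub>F s in at_right (0::real). - ln s \<ge> 1" by real_asymp
  then show "\<forall>\<^sub>F s in at_right 0. norm (sqrt (varentropy w s / s) - ?\<Lambda> s) \<le> \<bar>varentropy w s / s - (?\<Lambda> s)\<^sup>2\<bar>"
    using eventually_small_time
  proof eventually_elim
    case (elim s)
    define r where "r = sqrt (varentropy w s / s)"
    have v: "varentropy w s \<ge> 0" using elim by (intro varentropy_nonneg) auto
    then have r: "r \<ge> 0" "r\<^sup>2 = varentropy w s / s" using elim by (auto simp: r_def)
    have \<Lambda>: "?\<Lambda> s \<ge> 1" using elim step_entropy_nonneg[of w] by linarith
    have "\<bar>r - ?\<Lambda> s\<bar> * 1 \<le> \<bar>r - ?\<Lambda> s\<bar> * \<bar>r + ?\<Lambda> s\<bar>" using r \<Lambda> by (intro mult_left_mono) auto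
    also have "\<dots> = \<bar>r\<^sup>2 - (?\<Lambda> s)\<^sup>2\<bar>" by (simp add: abs_mult[symmetric] power2_eq_square algebra_simps)
    finally show ?case by (simp add: r(2) r_def[symmetric])
  qed
qed

lemma entropy'_over_ln: "((\<lambda>s. entropy' w s / - ln s) \<longlongrightarrow> 1) (at_right 0)"
proof -
  have i: "((\<lambda>s::real. 1 / - ln s) \<longlongrightarrow> 0) (at_right 0)" by real_asymp
  have "((\<lambda>s. (entropy' w s + ln s) * (1 / - ln s) + 1) \<longlongrightarrow> step_entropy w * 0 + 1) (at_right 0)"
    by (intro tendsto_intros entropy'_small i)
  then have "((\<lambda>s. (entropy' w s + ln s) * (1 / - ln s) + 1) \<longlongrightarrow> 1) (at_right 0)" by simp
  then show ?thesis
  proof (rule Lim_transform_eventually)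
    show "\<forall>\<^sub>F s in at_right 0. (entropy' w s + ln s) * (1 / - ln s) + 1 = entropy' w s / - ln s"
      using eventually_small_time by eventually_elim (simp add: field_simps)
  qed
qed

text \<open>The rate, and not only the limit, is needed to separate the two walks. The constant \<open>step_entropy w\<close> enters the
  square root of the varentropy and the derivative of the entropy alike, so it cancels to this order.\<close>

lemma spread_small_rate: "((\<lambda>s. - ln s * (sqrt s * spread w s - 1)) \<longlongrightarrow> 0) (at_right 0)"
proof -
  have a: "((\<lambda>s. sqrt (varentropy w s / s) - entropy' w s) \<longlongrightarrow> 0) (at_right 0)"
    using tendsto_diff[OF varentropy_small_sqrt[of w] tendsto_diff[OF entropy'_small[of w] tendsto_const[of "step_entropy w"]]]
    by (simp add: algebra_simps)
  have b: "((\<lambda>s. 1 / (entropy' w s / - ln s)) \<longlongrightarrow> 1 / 1) (at_right 0)"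
    by (intro tendsto_intros entropy'_over_ln) auto
  have "((\<lambda>s. 1 / (entropy' w s / - ln s) * (sqrt (varentropy w s / s) - entropy' w s)) \<longlongrightarrow> 1 / 1 * 0) (at_right 0)"
    by (rule tendsto_mult[OF b a])
  then have "((\<lambda>s. 1 / (entropy' w s / - ln s) * (sqrt (varentropy w s / s) - entropy' w s)) \<longlongrightarrow> 0) (at_right 0)" by simp
  then show ?thesis
  proof (rule Lim_transform_eventually)
    show "\<forall>\<^sub>F s in at_right 0. 1 / (entropy' w s / - ln s) * (sqrt (varentropy w s / s) - entropy' w s) = - ln s * (sqrt s * spread w s - 1)"
      using eventually_small_time
    proof eventually_elim
      case (elim s)
      have e: "entropy' w s > 0" using elim by (intro entropy'_pos) auto
      have "sqrt s * spread w s = sqrt (varentropy w s / s) / entropy' w s"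
      proof -
        have "sqrt s * sqrt s = s" using elim by simp
        then have "sqrt s / s = 1 / sqrt s" using elim by (simp add: field_simps)
        then show ?thesis by (simp add: spread_def real_sqrt_divide) (metis (no_types, lifting) divide_divide_eq_left mult.commute times_divide_eq_left times_divide_eq_right mult_1)
      qed
      then show ?case using e by (simp add: field_simps)
    qed
  qed
qed

lemma sqrt_mult_spread_tendsto_1: "((\<lambda>s. sqrt s * spread w s) \<longlongrightarrow> 1) (at_right 0)"
proof -
  have i: "((\<lambda>s::real. 1 / - ln s) \<longlongrightarrow> 0) (at_right 0)" by real_asymp
  have "((\<lambda>s. - ln s * (sqrt s * spread w s - 1) * (1 / - ln s) + 1) \<longlongrightarrow> 0 * 0 + 1) (at_right 0)"
    by (intro tendsto_intros spread_small_rate i)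
  then have "((\<lambda>s. - ln s * (sqrt s * spread w s - 1) * (1 / - ln s) + 1) \<longlongrightarrow> 1) (at_right 0)" by simp
  then show ?thesis
  proof (rule Lim_transform_eventually)
    show "\<forall>\<^sub>F s in at_right 0. - ln s * (sqrt s * spread w s - 1) * (1 / - ln s) + 1 = sqrt s * spread w s"
      using eventually_small_time
    proof eventually_elim
      case (elim s)
      then have "ln s < 0" by simp
      then show ?case by simp
    qed
  qed
qed

lemma spread_large: "(spread w \<longlongrightarrow> sqrt 2) at_top"
proof -
  have "((\<lambda>s. sqrt (varentropy w s) / (s * entropy' w s)) \<longlongrightarrow> sqrt (1/2) / (1/2)) at_top"
    by (intro tendsto_intros varentropy_large entropy'_large) auto
  moreover have "sqrt (1/2) / (1/2) = sqrt (2::real)"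
    by (simp add: real_sqrt_divide field_simps)
  ultimately show ?thesis by (simp add: spread_def[abs_def])
qed

text \<open>The equation \<open>entropy w s = y\<close> for small \<open>y\<close> is solved by \<open>s = y / ln (1 / y)\<close> to first order: \<open>entropy w s / s\<close>
  grows like \<open>- ln s\<close>, so the logarithms of \<open>s\<close> and of \<open>entropy w s\<close> are equivalent.\<close>

lemma entropy_time_small: "((\<lambda>s. - ln (entropy w s) * s / entropy w s) \<longlongrightarrow> 1) (at_right 0)"
proof -
  define B where "B = (\<lambda>s. entropy w s / s)"
  define L where "L = (\<lambda>s::real. - ln s)"
  have Ltop: "filterlim L at_top (at_right 0)" unfolding L_def by real_asymp
  have BL0: "((\<lambda>s. B s - L s) \<longlongrightarrow> step_entropy w + 1) (at_right 0)"
    using entropy_small[of w] by (simp add: B_def L_def)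
  have Btop: "filterlim B at_top (at_right 0)"
    using filterlim_tendsto_add_at_top[OF BL0 Ltop] by simp
  have iB: "((\<lambda>s. 1 / B s) \<longlongrightarrow> 0) (at_right 0)"
    using tendsto_inverse_0_at_top[OF Btop] by (simp add: divide_inverse)
  have lB: "((\<lambda>s. ln (B s) / B s) \<longlongrightarrow> 0) (at_right 0)"
  proof -
    have "((\<lambda>x::real. ln x / x) \<longlongrightarrow> 0) at_top" by real_asymp
    from filterlim_compose[OF this Btop] show ?thesis .
  qed
  have "((\<lambda>s. 1 - (B s - L s) * (1 / B s) - ln (B s) / B s) \<longlongrightarrow> 1 - (step_entropy w + 1) * 0 - 0) (at_right 0)"
    by (intro tendsto_intros BL0 iB lB)
  then have "((\<lambda>s. 1 - (B s - L s) * (1 / B s) - ln (B s) / B s) \<longlongrightarrow> 1) (at_right 0)" by simp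
  then show ?thesis
  proof (rule Lim_transform_eventually)
    show "\<forall>\<^sub>F s in at_right 0. 1 - (B s - L s) * (1 / B s) - ln (B s) / B s = - ln (entropy w s) * s / entropy w s"
      using eventually_small_time
    proof eventually_elim
      case (elim s)
      have e: "entropy w s > 0" using entropy_strict_mono[of 0 s w] elim by (simp add: entropy_0)
      then have B: "B s > 0" using elim by (simp add: B_def)
      have "entropy w s = s * B s" using elim by (simp add: B_def)
      then have "ln (entropy w s) = ln s + ln (B s)" using elim B by (simp add: ln_mult)
      moreover have "s / entropy w s = 1 / B s" by (simp add: B_def)
      ultimately have "- ln (entropy w s) * s / entropy w s = (L s - ln (B s)) * (1 / B s)"
        by (metis L_def add_uminus_conv_diff minus_add_distrib times_divide_eq_right)
      also have "\<dots> = 1 - (B s - L s) * (1 / B s) - ln (B s) / B s"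
        using B by (simp add: field_simps)
      finally show ?case ..
    qed
  qed
qed

lemma entropy'_ratio_small:
  assumes "r > 0"
  shows "((\<lambda>s. entropy' w (r * s) / entropy' w s) \<longlongrightarrow> 1) (at_right 0)"
proof -
  have f: "filterlim (\<lambda>s. r * s) (at_right 0) (at_right 0)" using assms by real_asymp
  have 1: "((\<lambda>s. entropy' w (r * s) / - ln (r * s)) \<longlongrightarrow> 1) (at_right 0)"
    using filterlim_compose[OF entropy'_over_ln f] .
  have 2: "((\<lambda>s. ln (r * s) / ln s) \<longlongrightarrow> 1) (at_right 0)" using assms by real_asymp
  have "((\<lambda>s. (entropy' w (r * s) / - ln (r * s)) / (entropy' w s / - ln s) * (ln (r * s) / ln s)) \<longlongrightarrow> 1 / 1 * 1) (at_right 0)"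
    by (intro tendsto_intros 1 2 entropy'_over_ln) auto
  then have "((\<lambda>s. (entropy' w (r * s) / - ln (r * s)) / (entropy' w s / - ln s) * (ln (r * s) / ln s)) \<longlongrightarrow> 1) (at_right 0)" by simp
  then show ?thesis
  proof (rule Lim_transform_eventually)
    have "\<forall>\<^sub>F s in at_right 0. ln (r * s) < 0" using assms by real_asymp
    then show "\<forall>\<^sub>F s in at_right 0. (entropy' w (r * s) / - ln (r * s)) / (entropy' w s / - ln s) * (ln (r * s) / ln s) = entropy' w (r * s) / entropy' w s"
      using eventually_small_time
    proof eventually_elim
      case (elim s)
      then have "ln s < 0" "entropy' w s > 0" by (auto intro: entropy'_pos)
      then show ?case using elim(1) by (simp add: field_simps)
    qed
  qed
qed

lemma entropy'_ratio_large:
  assumes "r > 0"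
  shows "((\<lambda>s. entropy' w (r * s) / entropy' w s) \<longlongrightarrow> 1 / r) at_top"
proof -
  have f: "filterlim (\<lambda>s. r * s) at_top at_top" using assms by real_asymp
  have 1: "((\<lambda>s. (r * s) * entropy' w (r * s)) \<longlongrightarrow> 1/2) at_top"
    using filterlim_compose[OF entropy'_large f] .
  have "((\<lambda>s. ((r * s) * entropy' w (r * s)) / (s * entropy' w s) / r) \<longlongrightarrow> (1/2) / (1/2) / r) at_top"
    using assms by (intro tendsto_intros 1 entropy'_large) auto
  then have "((\<lambda>s. ((r * s) * entropy' w (r * s)) / (s * entropy' w s) / r) \<longlongrightarrow> 1 / r) at_top" by simp
  then show ?thesis
  proof (rule Lim_transform_eventually)
    show "\<forall>\<^sub>F s in at_top. ((r * s) * entropy' w (r * s)) / (s * entropy' w s) / r = entropy' w (r * s) / entropy' w s"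
      using eventually_gt_at_top[of 0] by eventually_elim (use assms in simp)
  qed
qed

section \<open>Entropic and cutoff times through the inverse of the entropy\<close>

lemma entropic_time_eq:
  assumes "k \<ge> 1" "n \<ge> 1"
  shows "entropic_time w k n = real k * entropy_inv w (ln (real n) / real k)"
proof -
  define y where "y = ln (real n) / real k"
  have y: "y \<ge> 0" using assms by (simp add: y_def)
  have "(THE t. t \<ge> 0 \<and> mean_Q1 w k t = y) = real k * entropy_inv w y"
  proof (rule the_equality)
    show "real k * entropy_inv w y \<ge> 0 \<and> mean_Q1 w k (real k * entropy_inv w y) = y"
      using entropy_inv[OF y, of w] assms by (simp add: law_of_first_coordinate)
    fix t assume t: "t \<ge> 0 \<and> mean_Q1 w k t = y"
    then have "entropy w (t / real k) = y" using assms law_of_first_coordinate(1)[of k t w] by simp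
    then have "entropy_inv w y = t / real k" using entropy_inv_entropy[of "t / real k" w] t by auto
    then show "t = real k * entropy_inv w y" using assms by simp
  qed
  then show ?thesis by (simp add: entropic_time_def y_def)
qed

lemma cutoff_time_eq:
  fixes w :: walk_type and k n :: nat and \<alpha> :: real
  assumes "k \<ge> 1" "n \<ge> 1"
  defines "s \<equiv> entropy_inv w (ln (real n) / real k)"
  defines "y \<equiv> entropy w s + \<alpha> * sqrt (varentropy w s / real k)"
  assumes y: "y \<ge> 0"
  shows "cutoff_time w k n \<alpha> = real k * entropy_inv w y"
proof -
  have s: "s \<ge> 0" "entropy w s = ln (real n) / real k"
    using entropy_inv[of "ln (real n) / real k" w] assms(1,2) by (auto simp: s_def)
  have v: "var_Q1 w k (entropic_time w k n) = varentropy w s"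
    using entropic_time_eq[OF assms(1,2), of w] s(1) assms(1)
    by (simp add: law_of_first_coordinate s_def[symmetric])
  have k: "real k > 0" using assms(1) by simp
  have "sqrt (varentropy w s * real k) / real k = sqrt (varentropy w s / real k)"
    using k by (simp add: real_sqrt_mult real_sqrt_divide field_simps)
  then have rhs: "(ln (real n) + \<alpha> * sqrt (var_Q1 w k (entropic_time w k n) * real k)) / real k = y"
    by (simp only: v y_def s(2) add_divide_distrib times_divide_eq_right[symmetric])
  have "(THE t. t \<ge> 0 \<and> mean_Q1 w k t = y) = real k * entropy_inv w y"
  proof (rule the_equality)
    show "real k * entropy_inv w y \<ge> 0 \<and> mean_Q1 w k (real k * entropy_inv w y) = y"
      using entropy_inv[OF y, of w] assms(1) by (simp add: law_of_first_coordinate)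
    fix t assume t: "t \<ge> 0 \<and> mean_Q1 w k t = y"
    then have "entropy w (t / real k) = y" using assms(1) law_of_first_coordinate(1)[of k t w] by simp
    then have "entropy_inv w y = t / real k" using entropy_inv_entropy[of "t / real k" w] t by auto
    then show "t = real k * entropy_inv w y" using assms(1) by simp
  qed
  then show ?thesis by (simp add: cutoff_time_def rhs)
qed

section \<open>The profiles of the critical regime\<close>

definition time_profile :: "walk_type \<Rightarrow> real \<Rightarrow> real" where
  "time_profile w lam = entropy_inv w (1 / lam)"

definition window_profile :: "walk_type \<Rightarrow> real \<Rightarrow> real" where
  "window_profile w lam = spread w (time_profile w lam)"

lemma time_profile_pos: "lam > 0 \<Longrightarrow> time_profile w lam > 0"
  by (simp add: time_profile_def entropy_inv_pos)

lemma continuous_on_time_profile: "continuous_on {0<..} (time_profile w)"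
  unfolding time_profile_def[abs_def]
  by (rule continuous_on_compose2[OF continuous_on_entropy_inv]) (auto intro!: continuous_intros)

lemma continuous_on_window_profile: "continuous_on {0<..} (window_profile w)"
  unfolding window_profile_def[abs_def]
  by (rule continuous_on_compose2[OF continuous_on_spread continuous_on_time_profile]) (auto simp: time_profile_pos)

lemma time_profile_entropy: "s > 0 \<Longrightarrow> time_profile w (1 / entropy w s) = s"
  by (simp add: time_profile_def entropy_inv_entropy)

lemma entropy_pos: "s > 0 \<Longrightarrow> entropy w s > 0"
  using entropy_strict_mono[of 0 s w] by (simp add: entropy_0)

lemma step_entropy_values: "step_entropy Simple = ln 2" "step_entropy Directed = 0"
  by (auto simp: step_entropy_def steps_def)

text \<open>Equal profiles would give both walks the same entropy at all times, and then the same constant in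
  \<open>entropy_small\<close>.\<close>

lemma time_profiles_differ: "\<exists>lam>0. time_profile Simple lam \<noteq> time_profile Directed lam"
proof (rule ccontr)
  assume "\<not> ?thesis"
  then have eq: "time_profile Simple lam = time_profile Directed lam" if "lam > 0" for lam
    using that by auto
  have same: "entropy Simple s = entropy Directed s" if s: "s > 0" for s
  proof -
    have "time_profile Directed (1 / entropy Simple s) = s"
      using eq[of "1 / entropy Simple s"] time_profile_entropy[OF s] entropy_pos[OF s, of Simple] by simp
    then show ?thesis
      using entropy_inv(2)[of "entropy Simple s" Directed] entropy_pos[OF s, of Simple] by (simp add: time_profile_def)
  qed
  have "((\<lambda>s. entropy Simple s / s + ln s) \<longlongrightarrow> step_entropy Directed + 1) (at_right 0)"
    by (rule Lim_transform_eventually[OF entropy_small[of Directed]])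
       (use eventually_small_time in eventually_elim, simp add: same)
  from tendsto_unique[OF trivial_limit_at_right_real this entropy_small[of Simple]]
  show False by (simp add: step_entropy_values)
qed

text \<open>Let \<open>\<sigma> s\<close> be the time at which the simple walk has the entropy of the directed walk at time \<open>s\<close>. If the window
  profiles agree, so do the spreads at \<open>\<sigma> s\<close> and \<open>s\<close>, and \<open>spread_small_rate\<close> yields \<open>\<sigma> s / s = 1 + o(1 / ln (1 / s))\<close>.
  This is too close to 1 to compensate the difference \<open>ln 2\<close> between the expansions of the two entropies.\<close>

lemma window_profiles_differ: "\<exists>lam>0. window_profile Simple lam \<noteq> window_profile Directed lam"
proof (rule ccontr)
  assume "\<not> ?thesis"
  then have eq: "window_profile Simple lam = window_profile Directed lam" if "lam > 0" for lam
    using that by auto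
  define \<sigma> where "\<sigma> = (\<lambda>s. entropy_inv Simple (entropy Directed s))"
  have \<sigma>pos: "\<sigma> s > 0" if "s > 0" for s
    using that by (simp add: \<sigma>_def entropy_inv_pos entropy_pos)
  have ent: "entropy Simple (\<sigma> s) = entropy Directed s" for s
    by (simp add: \<sigma>_def entropy_inv entropy_nonneg)
  have spr: "spread Simple (\<sigma> s) = spread Directed s" if s: "s > 0" for s
    using eq[of "1 / entropy Directed s"] entropy_pos[OF s, of Directed]
    by (simp add: window_profile_def time_profile_entropy[OF s]) (simp add: time_profile_def \<sigma>_def)
  let ?F = "at_right (0::real)"
  have evpos: "\<forall>\<^sub>F s in ?F. s > 0" using eventually_small_time by eventually_elim auto
  have ent0: "((\<lambda>s. entropy Directed s) \<longlongrightarrow> entropy Simple 0) ?F"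
  proof -
    have "(entropy Directed \<longlongrightarrow> entropy Directed 0) (at 0 within {0..})"
      using continuous_on_entropy[of Directed] by (auto simp: continuous_on_def)
    then have "(entropy Directed \<longlongrightarrow> entropy Directed 0) ?F"
      by (rule tendsto_within_subset) auto
    then show ?thesis by (simp add: entropy_0)
  qed
  have \<sigma>0: "filterlim \<sigma> (at_right 0) ?F"
  proof (rule tendsto_imp_filterlim_at_right)
    show "(\<sigma> \<longlongrightarrow> 0) ?F" unfolding \<sigma>_def
      by (rule tendsto_entropy_inv[OF ent0]) (auto simp: entropy_nonneg)
    show "\<forall>\<^sub>F s in ?F. \<sigma> s > 0" using evpos by eventually_elim (rule \<sigma>pos)
  qed
  define L where "L = (\<lambda>s::real. - ln s)"
  define a where "a = (\<lambda>s. sqrt (\<sigma> s) * spread Simple (\<sigma> s))"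
  define b where "b = (\<lambda>s. sqrt s * spread Directed s)"
  define q where "q = (\<lambda>s. sqrt (\<sigma> s / s))"
  have a1: "(a \<longlongrightarrow> 1) ?F" using filterlim_compose[OF sqrt_mult_spread_tendsto_1 \<sigma>0] by (simp add: a_def)
  have b1: "(b \<longlongrightarrow> 1) ?F" using sqrt_mult_spread_tendsto_1 by (simp add: b_def)
  have La: "((\<lambda>s. L (\<sigma> s) * (a s - 1)) \<longlongrightarrow> 0) ?F"
    using filterlim_compose[OF spread_small_rate \<sigma>0] by (simp add: a_def L_def)
  have Lb: "((\<lambda>s. L s * (b s - 1)) \<longlongrightarrow> 0) ?F" using spread_small_rate by (simp add: b_def L_def)
  have qab: "\<forall>\<^sub>F s in ?F. q s = a s / b s"
    using evpos
  proof eventually_elim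
    case (elim s)
    then show ?case using spread_pos[OF elim, of Directed]
      by (simp add: q_def a_def b_def spr real_sqrt_divide)
  qed
  have q1: "(q \<longlongrightarrow> 1) ?F"
    by (rule Lim_transform_eventually[of "\<lambda>s. a s / b s"])
       (use tendsto_divide[OF a1 b1] qab in \<open>auto simp: eq_commute\<close>)
  \<comment> \<open>Since \<open>q\<^sup>2 = \<sigma> s / s\<close>, convergence of \<open>q\<close> to 1 makes the two logarithms asymptotically equal.\<close>
  have lnq: "((\<lambda>s. L (\<sigma> s) - L s) \<longlongrightarrow> 0) ?F"
  proof (rule Lim_transform_eventually)
    have "((\<lambda>s. -2 * ln (q s)) \<longlongrightarrow> -2 * ln 1) ?F" by (intro tendsto_intros q1) auto
    then show "((\<lambda>s. -2 * ln (q s)) \<longlongrightarrow> 0) ?F" by simp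
    show "\<forall>\<^sub>F s in ?F. -2 * ln (q s) = L (\<sigma> s) - L s"
      using evpos
    proof eventually_elim
      case (elim s)
      have "\<sigma> s > 0" using \<sigma>pos[OF elim] .
      then have "ln (\<sigma> s / s) = ln (\<sigma> s) - ln s" "\<sigma> s / s > 0" using elim by (auto simp: ln_divide_pos)
      then show ?case by (simp add: q_def L_def ln_sqrt)
    qed
  qed
  have Linv: "((\<lambda>s. 1 / L s) \<longlongrightarrow> 0) ?F" unfolding L_def by real_asymp
  have Linv': "((\<lambda>s. 1 / L (\<sigma> s)) \<longlongrightarrow> 0) ?F" using filterlim_compose[OF Linv \<sigma>0] .
  have Lnz: "\<forall>\<^sub>F s in ?F. L s > 0" using eventually_small_time by eventually_elim (simp add: L_def)
  have Lnz': "\<forall>\<^sub>F s in ?F. L (\<sigma> s) > 0"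
    by (rule eventually_compose_filterlim[OF Lnz \<sigma>0])
  have La': "((\<lambda>s. L s * (a s - 1)) \<longlongrightarrow> 0) ?F"
  proof (rule Lim_transform_eventually)
    have "((\<lambda>s. (1 - (L (\<sigma> s) - L s) * (1 / L (\<sigma> s))) * (L (\<sigma> s) * (a s - 1))) \<longlongrightarrow> (1 - 0 * 0) * 0) ?F"
      by (intro tendsto_intros lnq Linv' La)
    then show "((\<lambda>s. (1 - (L (\<sigma> s) - L s) * (1 / L (\<sigma> s))) * (L (\<sigma> s) * (a s - 1))) \<longlongrightarrow> 0) ?F" by simp
    show "\<forall>\<^sub>F s in ?F. (1 - (L (\<sigma> s) - L s) * (1 / L (\<sigma> s))) * (L (\<sigma> s) * (a s - 1)) = L s * (a s - 1)"
      using Lnz'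
    proof eventually_elim
      case (elim s)
      then have "1 - (L (\<sigma> s) - L s) * (1 / L (\<sigma> s)) = L s / L (\<sigma> s)" by (simp add: field_simps)
      then show ?case using elim by simp
    qed
  qed
  have Lq: "((\<lambda>s. L s * (q s - 1)) \<longlongrightarrow> 0) ?F"
  proof (rule Lim_transform_eventually)
    have "((\<lambda>s. (L s * (a s - 1) - L s * (b s - 1)) / b s) \<longlongrightarrow> (0 - 0) / 1) ?F"
      by (intro tendsto_intros La' Lb b1) auto
    then show "((\<lambda>s. (L s * (a s - 1) - L s * (b s - 1)) / b s) \<longlongrightarrow> 0) ?F" by simp
    have "\<forall>\<^sub>F s in ?F. b s > 0" using order_tendstoD(1)[OF b1, of 0] by simp
    then show "\<forall>\<^sub>F s in ?F. (L s * (a s - 1) - L s * (b s - 1)) / b s = L s * (q s - 1)"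
      using qab by eventually_elim (simp add: field_simps)
  qed
  have Lqq: "((\<lambda>s. L s * ((q s)\<^sup>2 - 1)) \<longlongrightarrow> 0) ?F"
  proof -
    have "((\<lambda>s. L s * (q s - 1) * (q s + 1)) \<longlongrightarrow> 0 * (1 + 1)) ?F" by (intro tendsto_intros Lq q1)
    then show ?thesis by (simp add: power2_eq_square algebra_simps)
  qed
  let ?h = "\<lambda>s. entropy Simple (\<sigma> s) / \<sigma> s + ln (\<sigma> s)" and ?h' = "\<lambda>s. entropy Directed s / s + ln s"
  have hS: "(?h \<longlongrightarrow> ln 2 + 1) ?F"
    using filterlim_compose[OF entropy_small[of Simple] \<sigma>0] by (simp add: step_entropy_values)
  have hD: "(?h' \<longlongrightarrow> 0 + 1) ?F" using entropy_small[of Directed] by (simp only: step_entropy_values)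
  have "((\<lambda>s. (q s)\<^sup>2 * ?h s + L s * ((q s)\<^sup>2 - 1) + (q s)\<^sup>2 * (L (\<sigma> s) - L s) - ?h' s)
      \<longlongrightarrow> 1\<^sup>2 * (ln 2 + 1) + 0 + 1\<^sup>2 * 0 - (0 + 1)) ?F"
    by (intro tendsto_intros q1 hS Lqq lnq hD)
  moreover have "\<forall>\<^sub>F s in ?F. (q s)\<^sup>2 * ?h s + L s * ((q s)\<^sup>2 - 1) + (q s)\<^sup>2 * (L (\<sigma> s) - L s) - ?h' s = 0"
    using evpos
  proof eventually_elim
    case (elim s)
    have \<sigma>s: "\<sigma> s > 0" using \<sigma>pos[OF elim] .
    then have q2: "(q s)\<^sup>2 = \<sigma> s / s" using elim by (simp add: q_def)
    have "(q s)\<^sup>2 * (entropy Simple (\<sigma> s) / \<sigma> s) = entropy Directed s / s"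
      unfolding q2 ent using \<sigma>s by simp
    moreover have "(q s)\<^sup>2 * ?h s + L s * ((q s)\<^sup>2 - 1) + (q s)\<^sup>2 * (L (\<sigma> s) - L s) - ?h' s =
       (q s)\<^sup>2 * (entropy Simple (\<sigma> s) / \<sigma> s) - entropy Directed s / s"
      by (simp only: L_def ring_distribs) simp
    ultimately show ?case by simp
  qed
  ultimately have "((\<lambda>s::real. 0::real) \<longlongrightarrow> ln 2) ?F"
    using Lim_transform_eventually by fastforce
  then have "(0::real) = ln 2" by (simp add: tendsto_const_iff)
  then show False by simp
qed

section \<open>The three regimes\<close>

lemma eventually_dimension_ge_1:
  assumes "filterlim (\<lambda>n. real (k n)) at_top sequentially"
  shows "\<forall>\<^sub>F n in sequentially. k n \<ge> 1 \<and> n \<ge> 2"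
proof -
  have "\<forall>\<^sub>F n in sequentially. real (k n) \<ge> 1" using assms unfolding filterlim_at_top by blast
  then show ?thesis using eventually_ge_at_top[of 2] by eventually_elim auto
qed

text \<open>The common part of the three regimes. They differ in the limit \<open>\<rho>\<close> of the ratios of derivatives and in the
  equivalent \<open>G\<close> of the spread.\<close>

lemma cutoff_window:
  fixes k :: "nat \<Rightarrow> nat" and w :: walk_type and \<alpha> :: real
  defines "s \<equiv> \<lambda>n. entropy_inv w (ln (real n) / real (k n))"
  assumes k: "filterlim (\<lambda>n. real (k n)) at_top sequentially"
    and small: "(\<lambda>n. spread w (s n) / sqrt (real (k n))) \<longlonglongrightarrow> 0"
    and \<rho>: "\<And>r. r > 0 \<Longrightarrow> (\<lambda>n. entropy' w (r * s n) / entropy' w (s n)) \<longlonglongrightarrow> \<rho> r"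
      "isCont \<rho> 1" "\<rho> 1 = 1"
    and G: "(\<lambda>n. spread w (s n)) \<sim>[sequentially] G"
  shows "(\<lambda>n. cutoff_time w (k n) n \<alpha> - entropic_time w (k n) n) \<sim>[sequentially]
      (\<lambda>n. G n * \<alpha> * entropic_time w (k n) n / sqrt (real (k n)))"
    and "(\<lambda>n. cutoff_time w (k n) n \<alpha>) \<sim>[sequentially] (\<lambda>n. entropic_time w (k n) n)"
proof -
  define y where "y = (\<lambda>n. entropy w (s n) + \<alpha> * sqrt (varentropy w (s n) / real (k n)))"
  note ev = eventually_dimension_ge_1[OF k]
  have spos: "\<forall>\<^sub>F n in sequentially. s n > 0" using ev
    by eventually_elim (auto simp: s_def intro!: entropy_inv_pos divide_pos_pos)
  have kpos: "\<forall>\<^sub>F n in sequentially. real (k n) > 0" using ev by eventually_elim auto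
  have P: "\<forall>\<^sub>F n in sequentially. y n \<ge> 0" "(\<lambda>n. entropy_inv w (y n) / s n) \<longlonglongrightarrow> 1"
    "(\<lambda>n. entropy_inv w (y n) - s n) \<sim>[sequentially] (\<lambda>n. spread w (s n) * \<alpha> * s n / sqrt (real (k n)))"
    unfolding y_def by (rule perturbation[OF spos kpos small \<rho>]; assumption)+
  have t0: "\<forall>\<^sub>F n in sequentially. entropic_time w (k n) n = real (k n) * s n"
    using ev by eventually_elim (simp add: entropic_time_eq s_def)
  have t: "\<forall>\<^sub>F n in sequentially. cutoff_time w (k n) n \<alpha> = real (k n) * entropy_inv w (y n)"
    using ev P(1) by eventually_elim (auto simp: y_def s_def intro!: cutoff_time_eq)
  have "(\<lambda>n. real (k n) * (entropy_inv w (y n) - s n)) \<sim>[sequentially]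
      (\<lambda>n. real (k n) * (spread w (s n) * \<alpha> * s n / sqrt (real (k n))))"
    by (intro asymp_equiv_intros P(3))
  also have "(\<lambda>n. real (k n) * (spread w (s n) * \<alpha> * s n / sqrt (real (k n)))) \<sim>[sequentially]
      (\<lambda>n. real (k n) * (G n * \<alpha> * s n / sqrt (real (k n))))"
    by (intro asymp_equiv_intros G)
  finally have main: "(\<lambda>n. real (k n) * (entropy_inv w (y n) - s n)) \<sim>[sequentially]
      (\<lambda>n. real (k n) * (G n * \<alpha> * s n / sqrt (real (k n))))" .
  have e1: "\<forall>\<^sub>F n in sequentially. real (k n) * (entropy_inv w (y n) - s n) = cutoff_time w (k n) n \<alpha> - entropic_time w (k n) n"
    using t0 t by eventually_elim (simp add: right_diff_distrib)
  have e2: "\<forall>\<^sub>F n in sequentially. real (k n) * (G n * \<alpha> * s n / sqrt (real (k n))) = G n * \<alpha> * entropic_time w (k n) n / sqrt (real (k n))"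
    using t0 by eventually_elim simp
  show "(\<lambda>n. cutoff_time w (k n) n \<alpha> - entropic_time w (k n) n) \<sim>[sequentially]
      (\<lambda>n. G n * \<alpha> * entropic_time w (k n) n / sqrt (real (k n)))"
    using main asymp_equiv_cong[OF e1 e2] by simp
  show "(\<lambda>n. cutoff_time w (k n) n \<alpha>) \<sim>[sequentially] (\<lambda>n. entropic_time w (k n) n)"
  proof (rule asymp_equivI')
    show "(\<lambda>n. cutoff_time w (k n) n \<alpha> / entropic_time w (k n) n) \<longlonglongrightarrow> 1"
      by (rule Lim_transform_eventually[OF P(2)])
         (use t0 t kpos in eventually_elim, simp)
  qed
qed

lemma small_regime:
  fixes k :: "nat \<Rightarrow> nat" and w :: walk_type and \<alpha> :: real
  assumes k: "filterlim (\<lambda>n. real (k n)) at_top sequentially"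
    and regime: "(\<lambda>n. real (k n)) \<in> o[sequentially](\<lambda>n. ln (real n))"
  shows "(\<lambda>n. entropic_time w (k n) n) \<sim>[sequentially] (\<lambda>n. real (k n) * real n powr (2 / real (k n)) / (2 * pi * exp 1))"
    and "(\<lambda>n. cutoff_time w (k n) n \<alpha> - entropic_time w (k n) n) \<sim>[sequentially]
      (\<lambda>n. sqrt 2 * \<alpha> * entropic_time w (k n) n / sqrt (real (k n)))"
    and "(\<lambda>n. cutoff_time w (k n) n \<alpha>) \<sim>[sequentially] (\<lambda>n. entropic_time w (k n) n)"
proof -
  define s where "s = (\<lambda>n. entropy_inv w (ln (real n) / real (k n)))"
  note ev = eventually_dimension_ge_1[OF k]
  have "filterlim (\<lambda>n. ln (real n) / real (k n)) at_top sequentially"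
    unfolding filterlim_at_top_gt[of _ _ 0]
  proof (intro allI impI)
    fix Z :: real assume Z: "Z > 0"
    from landau_o.smallD[OF regime, of "1 / Z"] Z
    have "\<forall>\<^sub>F n in sequentially. real (k n) \<le> 1 / Z * \<bar>ln (real n)\<bar>" by simp
    then show "\<forall>\<^sub>F n in sequentially. Z \<le> ln (real n) / real (k n)"
      using ev by eventually_elim (use Z in \<open>auto simp: field_simps\<close>)
  qed
  then have stop: "filterlim s at_top sequentially" unfolding s_def by (rule entropy_inv_at_top)
  have G: "(\<lambda>n. spread w (s n)) \<longlonglongrightarrow> sqrt 2" using filterlim_compose[OF spread_large stop] .
  then have G': "(\<lambda>n. spread w (s n)) \<sim>[sequentially] (\<lambda>_. sqrt 2)"
    by (intro asymp_equivI') (auto intro!: tendsto_eq_intros)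
  have ksqrt: "filterlim (\<lambda>n. sqrt (real (k n))) at_top sequentially"
    using filterlim_compose[OF sqrt_at_top k] .
  have small: "(\<lambda>n. spread w (s n) / sqrt (real (k n))) \<longlonglongrightarrow> 0"
    by (rule real_tendsto_divide_at_top[OF G ksqrt])
  have \<rho>: "(\<lambda>n. entropy' w (r * s n) / entropy' w (s n)) \<longlonglongrightarrow> 1 / r" if "r > 0" for r
    using filterlim_compose[OF entropy'_ratio_large[OF that] stop] .
  have "isCont (\<lambda>r::real. 1 / r) 1" by (intro continuous_intros) auto
  note W = cutoff_window[OF k small[unfolded s_def] \<rho>[unfolded s_def] this _ G'[unfolded s_def]]
  show "(\<lambda>n. cutoff_time w (k n) n \<alpha> - entropic_time w (k n) n) \<sim>[sequentially]
      (\<lambda>n. sqrt 2 * \<alpha> * entropic_time w (k n) n / sqrt (real (k n)))"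
    "(\<lambda>n. cutoff_time w (k n) n \<alpha>) \<sim>[sequentially] (\<lambda>n. entropic_time w (k n) n)"
    by (rule W; simp)+
  let ?e = "\<lambda>s. entropy w s - (ln (2 * pi * s) / 2 + 1 / 2)"
  have "(\<lambda>n. exp (-2 * ?e (s n))) \<longlonglongrightarrow> exp (-2 * 0)"
    by (intro tendsto_intros filterlim_compose[OF entropy_large stop])
  then have lim: "(\<lambda>n. exp (-2 * ?e (s n))) \<longlonglongrightarrow> 1" by simp
  show "(\<lambda>n. entropic_time w (k n) n) \<sim>[sequentially] (\<lambda>n. real (k n) * real n powr (2 / real (k n)) / (2 * pi * exp 1))"
  proof (rule asymp_equivI', rule Lim_transform_eventually[OF lim])
    show "\<forall>\<^sub>F n in sequentially. exp (-2 * ?e (s n)) = entropic_time w (k n) n / (real (k n) * real n powr (2 / real (k n)) / (2 * pi * exp 1))"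
      using ev
    proof eventually_elim
      case (elim n)
      define y where "y = ln (real n) / real (k n)"
      have y: "y > 0" using elim by (simp add: y_def)
      have sn: "s n > 0" "entropy w (s n) = y" using y by (auto simp: s_def y_def[symmetric] entropy_inv_pos entropy_inv)
      have t0: "entropic_time w (k n) n = real (k n) * s n" using elim by (simp add: entropic_time_eq s_def)
      have pw: "real n powr (2 / real (k n)) = exp (2 * y)" using elim by (simp add: powr_def y_def)
      have "exp (-2 * ?e (s n)) = exp (ln (2 * pi * s n) + 1 - 2 * y)"
        by (rule arg_cong[where f = exp]) (simp add: sn(2) algebra_simps)
      also have "\<dots> = exp (ln (2 * pi * s n)) * exp 1 / exp (2 * y)" by (simp add: exp_add exp_diff)
      also have "exp (ln (2 * pi * s n)) = 2 * pi * s n" using sn by simp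
      finally show ?case unfolding t0 pw using elim by (simp add: field_simps)
    qed
  qed
qed

lemma critical_regime:
  fixes k :: "nat \<Rightarrow> nat" and w :: walk_type and \<alpha> lam :: real
  assumes k: "filterlim (\<lambda>n. real (k n)) at_top sequentially" and lam: "lam > 0"
    and regime: "(\<lambda>n. real (k n)) \<sim>[sequentially] (\<lambda>n. lam * ln (real n))"
  shows "(\<lambda>n. entropic_time w (k n) n) \<sim>[sequentially] (\<lambda>n. real (k n) * time_profile w lam)"
    and "(\<lambda>n. cutoff_time w (k n) n \<alpha> - entropic_time w (k n) n) \<sim>[sequentially]
      (\<lambda>n. window_profile w lam * \<alpha> * entropic_time w (k n) n / sqrt (real (k n)))"
    and "(\<lambda>n. cutoff_time w (k n) n \<alpha>) \<sim>[sequentially] (\<lambda>n. entropic_time w (k n) n)"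
proof -
  define s where "s = (\<lambda>n. entropy_inv w (ln (real n) / real (k n)))"
  define a where "a = time_profile w lam"
  have a: "a > 0" "entropy w a = 1 / lam" using lam by (auto simp: a_def time_profile_pos) (simp add: time_profile_def entropy_inv)
  note ev = eventually_dimension_ge_1[OF k]
  have "(\<lambda>n. real (k n) / (lam * ln (real n))) \<longlonglongrightarrow> 1"
  proof (rule Lim_transform_eventually)
    show "(\<lambda>n. if real (k n) = 0 \<and> lam * ln (real n) = 0 then 1 else real (k n) / (lam * ln (real n))) \<longlonglongrightarrow> 1"
      using regime by (simp add: asymp_equiv_def)
    show "\<forall>\<^sub>F n in sequentially. (if real (k n) = 0 \<and> lam * ln (real n) = 0 then 1 else real (k n) / (lam * ln (real n))) = real (k n) / (lam * ln (real n))"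
      using ev by eventually_elim auto
  qed
  then have "(\<lambda>n. 1 / (real (k n) / (lam * ln (real n))) / lam) \<longlonglongrightarrow> 1 / 1 / lam"
    using lam by (intro tendsto_intros) auto
  then have y: "(\<lambda>n. ln (real n) / real (k n)) \<longlonglongrightarrow> entropy w a"
    using lam by (simp add: a)
  have slim: "s \<longlonglongrightarrow> a" unfolding s_def
    by (rule tendsto_entropy_inv[OF y]) (use a ev in \<open>auto elim!: eventually_mono\<close>)
  have cs: "isCont (spread w) a" and ce: "isCont (entropy' w) x" if "x > 0" for x
    using continuous_on_interior[OF continuous_on_spread, of a w] continuous_on_interior[OF continuous_on_entropy', of x w] a that
    by (auto simp: interior_open)
  have G: "(\<lambda>n. spread w (s n)) \<longlonglongrightarrow> window_profile w lam"
    using isCont_tendsto_compose[OF cs[OF zero_less_one] slim] by (simp add: window_profile_def a_def)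
  have Gpos: "window_profile w lam > 0" using a by (simp add: window_profile_def a_def[symmetric] spread_pos)
  then have G': "(\<lambda>n. spread w (s n)) \<sim>[sequentially] (\<lambda>_. window_profile w lam)"
    by (intro asymp_equivI') (use tendsto_divide[OF G tendsto_const[of "window_profile w lam"]] in simp)
  have ksqrt: "filterlim (\<lambda>n. sqrt (real (k n))) at_top sequentially"
    using filterlim_compose[OF sqrt_at_top k] .
  have small: "(\<lambda>n. spread w (s n) / sqrt (real (k n))) \<longlonglongrightarrow> 0"
    by (rule real_tendsto_divide_at_top[OF G ksqrt])
  have ea: "entropy' w a > 0" using a by (simp add: entropy'_pos)
  have \<rho>: "(\<lambda>n. entropy' w (r * s n) / entropy' w (s n)) \<longlonglongrightarrow> entropy' w (r * a) / entropy' w a" if r: "r > 0" for r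
  proof (rule tendsto_divide)
    show "(\<lambda>n. entropy' w (r * s n)) \<longlonglongrightarrow> entropy' w (r * a)"
      by (rule isCont_tendsto_compose[OF ce]) (use a r slim in \<open>auto intro: tendsto_intros\<close>)
    show "(\<lambda>n. entropy' w (s n)) \<longlonglongrightarrow> entropy' w a" by (rule isCont_tendsto_compose[OF ce[OF a(1)] slim])
  qed (use ea in simp)
  have "isCont (\<lambda>r. entropy' w (r * a)) 1"
    by (rule isCont_o2[of _ "\<lambda>r. r * a"]) (use ce[of "1 * a"] a in auto)
  then have "isCont (\<lambda>r. entropy' w (r * a) / entropy' w a) 1"
    using ea by (intro continuous_intros) auto
  note W = cutoff_window[OF k small[unfolded s_def] \<rho>[unfolded s_def] this _ G'[unfolded s_def]]
  show "(\<lambda>n. cutoff_time w (k n) n \<alpha> - entropic_time w (k n) n) \<sim>[sequentially]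
      (\<lambda>n. window_profile w lam * \<alpha> * entropic_time w (k n) n / sqrt (real (k n)))"
    "(\<lambda>n. cutoff_time w (k n) n \<alpha>) \<sim>[sequentially] (\<lambda>n. entropic_time w (k n) n)"
    by (rule W; use ea in simp)+
  have lim: "(\<lambda>n. s n / a) \<longlonglongrightarrow> 1" using tendsto_divide[OF slim tendsto_const[of a]] a by simp
  show "(\<lambda>n. entropic_time w (k n) n) \<sim>[sequentially] (\<lambda>n. real (k n) * time_profile w lam)"
    by (rule asymp_equivI', rule Lim_transform_eventually[OF lim])
       (use ev in eventually_elim, simp add: entropic_time_eq s_def a_def)
qed

text \<open>The hypothesis \<open>ln k = o(ln n)\<close> enters through \<open>(spread / sqrt k)\<^sup>2 \<sim> ln \<kappa> / ln n\<close> and \<open>\<kappa> \<le> k\<close>.\<close>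

lemma large_regime:
  fixes k :: "nat \<Rightarrow> nat" and w :: walk_type and \<alpha> :: real
  defines "\<kappa> \<equiv> \<lambda>n. real (k n) / ln (real n)"
  assumes k: "filterlim (\<lambda>n. real (k n)) at_top sequentially"
    and sub: "(\<lambda>n. ln (real (k n))) \<in> o[sequentially](\<lambda>n. ln (real n))"
    and regime: "(\<lambda>n. ln (real n)) \<in> o[sequentially](\<lambda>n. real (k n))"
  shows "(\<lambda>n. entropic_time w (k n) n) \<sim>[sequentially] (\<lambda>n. real (k n) / (\<kappa> n * ln (\<kappa> n)))"
    and "(\<lambda>n. cutoff_time w (k n) n \<alpha> - entropic_time w (k n) n) \<sim>[sequentially]
      (\<lambda>n. sqrt (\<kappa> n * ln (\<kappa> n)) * \<alpha> * entropic_time w (k n) n / sqrt (real (k n)))"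
    and "(\<lambda>n. cutoff_time w (k n) n \<alpha>) \<sim>[sequentially] (\<lambda>n. entropic_time w (k n) n)"
proof -
  define s where "s = (\<lambda>n. entropy_inv w (ln (real n) / real (k n)))"
  have ev: "\<forall>\<^sub>F n in sequentially. k n \<ge> 1 \<and> ln (real n) \<ge> 1 \<and> n \<ge> 2"
  proof -
    have "\<forall>\<^sub>F n in sequentially. ln (real n) \<ge> 1" by real_asymp
    then show ?thesis using eventually_dimension_ge_1[OF k] by eventually_elim auto
  qed
  have y: "(\<lambda>n. ln (real n) / real (k n)) \<longlonglongrightarrow> 0" by (rule smalloD_tendsto[OF regime])
  have spos: "\<forall>\<^sub>F n in sequentially. s n > 0" using ev
    by eventually_elim (auto simp: s_def intro!: entropy_inv_pos divide_pos_pos)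
  have s0: "filterlim s (at_right 0) sequentially"
  proof (rule tendsto_imp_filterlim_at_right[OF _ spos])
    show "s \<longlonglongrightarrow> 0" unfolding s_def
      by (rule tendsto_entropy_inv) (use y ev in \<open>auto simp: entropy_0 elim!: eventually_mono\<close>)
  qed
  have \<kappa>1: "\<forall>\<^sub>F n in sequentially. \<kappa> n > 1"
    using order_tendstoD(2)[OF y zero_less_one] ev
    by eventually_elim (auto simp: \<kappa>_def field_simps)
  have time: "(\<lambda>n. s n * (\<kappa> n * ln (\<kappa> n))) \<longlonglongrightarrow> 1"
  proof (rule Lim_transform_eventually[OF filterlim_compose[OF entropy_time_small s0]])
    show "\<forall>\<^sub>F n in sequentially. - ln (entropy w (s n)) * s n / entropy w (s n) = s n * (\<kappa> n * ln (\<kappa> n))"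
      using ev
    proof eventually_elim
      case (elim n)
      define y where "y = ln (real n) / real (k n)"
      have y: "y > 0" using elim by (simp add: y_def)
      have e: "entropy w (s n) = y" using y by (simp add: s_def y_def[symmetric] entropy_inv)
      have "\<kappa> n = 1 / y" by (simp add: \<kappa>_def y_def)
      then show ?case unfolding e using y by (simp add: ln_div)
    qed
  qed
  have G: "(\<lambda>n. spread w (s n) / sqrt (\<kappa> n * ln (\<kappa> n))) \<longlonglongrightarrow> 1"
  proof (rule Lim_transform_eventually)
    have "(\<lambda>n. sqrt (s n) * spread w (s n) / sqrt (s n * (\<kappa> n * ln (\<kappa> n)))) \<longlonglongrightarrow> 1 / sqrt 1"
      by (intro tendsto_intros filterlim_compose[OF sqrt_mult_spread_tendsto_1 s0] time) auto
    then show "(\<lambda>n. sqrt (s n) * spread w (s n) / sqrt (s n * (\<kappa> n * ln (\<kappa> n)))) \<longlonglongrightarrow> 1" by simp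
    show "\<forall>\<^sub>F n in sequentially. sqrt (s n) * spread w (s n) / sqrt (s n * (\<kappa> n * ln (\<kappa> n))) = spread w (s n) / sqrt (\<kappa> n * ln (\<kappa> n))"
      using spos by eventually_elim (simp add: real_sqrt_mult)
  qed
  then have G': "(\<lambda>n. spread w (s n)) \<sim>[sequentially] (\<lambda>n. sqrt (\<kappa> n * ln (\<kappa> n)))"
    by (rule asymp_equivI')
  have "(\<lambda>n. ln (\<kappa> n) / ln (real n)) \<longlonglongrightarrow> 0"
  proof (rule tendsto_sandwich[OF _ _ tendsto_const smalloD_tendsto[OF sub]])
    show "\<forall>\<^sub>F n in sequentially. 0 \<le> ln (\<kappa> n) / ln (real n)"
      using \<kappa>1 ev by eventually_elim auto
    show "\<forall>\<^sub>F n in sequentially. ln (\<kappa> n) / ln (real n) \<le> ln (real (k n)) / ln (real n)"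
      using \<kappa>1 ev
    proof eventually_elim
      case (elim n)
      have "\<kappa> n \<le> real (k n) / 1" unfolding \<kappa>_def using elim by (intro divide_left_mono) auto
      then have "ln (\<kappa> n) \<le> ln (real (k n))" using elim by (subst ln_le_cancel_iff) auto
      then show ?case using elim by (intro divide_right_mono) auto
    qed
  qed
  then have "(\<lambda>n. sqrt (ln (\<kappa> n) / ln (real n))) \<longlonglongrightarrow> sqrt 0" by (rule tendsto_real_sqrt)
  from tendsto_mult[OF G this]
  have lim0: "(\<lambda>n. spread w (s n) / sqrt (\<kappa> n * ln (\<kappa> n)) * sqrt (ln (\<kappa> n) / ln (real n))) \<longlonglongrightarrow> 0" by simp
  have small: "(\<lambda>n. spread w (s n) / sqrt (real (k n))) \<longlonglongrightarrow> 0"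
  proof (rule Lim_transform_eventually[OF lim0])
    show "\<forall>\<^sub>F n in sequentially. spread w (s n) / sqrt (\<kappa> n * ln (\<kappa> n)) * sqrt (ln (\<kappa> n) / ln (real n)) = spread w (s n) / sqrt (real (k n))"
      using \<kappa>1 ev
    proof eventually_elim
      case (elim n)
      then have l: "ln (\<kappa> n) > 0" by simp
      have "ln (\<kappa> n) / ln (real n) = (\<kappa> n * ln (\<kappa> n)) / real (k n)"
        using elim by (simp add: \<kappa>_def)
      then have "sqrt (ln (\<kappa> n) / ln (real n)) = sqrt (\<kappa> n * ln (\<kappa> n)) / sqrt (real (k n))"
        by (simp add: real_sqrt_divide)
      then show ?case using elim l by simp
    qed
  qed
  have \<rho>: "(\<lambda>n. entropy' w (r * s n) / entropy' w (s n)) \<longlonglongrightarrow> 1" if "r > 0" for r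
    using filterlim_compose[OF entropy'_ratio_small[OF that] s0] .
  note W = cutoff_window[OF k small[unfolded s_def] \<rho>[unfolded s_def] continuous_const refl G'[unfolded s_def]]
  show "(\<lambda>n. cutoff_time w (k n) n \<alpha> - entropic_time w (k n) n) \<sim>[sequentially]
      (\<lambda>n. sqrt (\<kappa> n * ln (\<kappa> n)) * \<alpha> * entropic_time w (k n) n / sqrt (real (k n)))"
    "(\<lambda>n. cutoff_time w (k n) n \<alpha>) \<sim>[sequentially] (\<lambda>n. entropic_time w (k n) n)"
    by (rule W; simp)+
  show "(\<lambda>n. entropic_time w (k n) n) \<sim>[sequentially] (\<lambda>n. real (k n) / (\<kappa> n * ln (\<kappa> n)))"
    by (rule asymp_equivI', rule Lim_transform_eventually[OF time])
       (use ev in eventually_elim, simp add: entropic_time_eq s_def)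
qed

lemma dimension_at_top:
  assumes "(\<lambda>n. 1) \<in> o[sequentially](\<lambda>n. ln (real (k n)))"
  shows "filterlim (\<lambda>n. real (k n)) at_top sequentially"
  unfolding filterlim_at_top_gt[of _ _ 0]
proof (intro allI impI)
  fix Z :: real assume Z: "Z > 0"
  from landau_o.smallD[OF assms, of "1 / Z"] Z
  have "\<forall>\<^sub>F n in sequentially. 1 \<le> 1 / Z * \<bar>ln (real (k n))\<bar>" by simp
  then show "\<forall>\<^sub>F n in sequentially. Z \<le> real (k n)"
  proof eventually_elim
    case (elim n)
    then have "Z \<le> \<bar>ln (real (k n))\<bar>" using Z by (simp add: field_simps)
    moreover have "k n > 0" using calculation Z by (cases "k n = 0") auto
    ultimately show ?case using ln_bound[of "real (k n)"] by simp
  qed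
qed

theorem propositionA2:
  shows "\<exists>f g :: walk_type \<Rightarrow> real \<Rightarrow> real.
    (\<forall>w. continuous_on {0<..} (f w) \<and> continuous_on {0<..} (g w) \<and>
         (\<forall>lam>0. f w lam > 0 \<and> g w lam > 0)) \<and>
    (\<exists>lam>0. f Simple lam \<noteq> f Directed lam) \<and>
    (\<exists>lam>0. g Simple lam \<noteq> g Directed lam) \<and>
    (\<forall>(w :: walk_type) (k :: nat \<Rightarrow> nat).
       (\<lambda>n. 1) \<in> o[sequentially](\<lambda>n. ln (real (k n))) \<longrightarrow>
       (\<lambda>n. ln (real (k n))) \<in> o[sequentially](\<lambda>n. ln (real n)) \<longrightarrow>
       (let \<kappa> = (\<lambda>n. real (k n) / ln (real n));
            t\<^sub>0 = (\<lambda>n. entropic_time w (k n) n);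
            t = (\<lambda>\<alpha> n. cutoff_time w (k n) n \<alpha>);
            small = (\<lambda>n. real (k n)) \<in> o[sequentially](\<lambda>n. ln (real n));
            critical = (\<lambda>lam. (\<lambda>n. real (k n)) \<sim>[sequentially] (\<lambda>n. lam * ln (real n)));
            large = (\<lambda>n. ln (real n)) \<in> o[sequentially](\<lambda>n. real (k n))
        in \<forall>(\<alpha> :: real) (lam :: real). lam > 0 \<longrightarrow>
          (small \<longrightarrow>
             t\<^sub>0 \<sim>[sequentially] (\<lambda>n. real (k n) * real n powr (2 / real (k n)) / (2 * pi * exp 1)) \<and>
             (\<lambda>n. t \<alpha> n - t\<^sub>0 n) \<sim>[sequentially] (\<lambda>n. sqrt 2 * \<alpha> * t\<^sub>0 n / sqrt (real (k n)))) \<and>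
          (critical lam \<longrightarrow>
             t\<^sub>0 \<sim>[sequentially] (\<lambda>n. real (k n) * f w lam) \<and>
             (\<lambda>n. t \<alpha> n - t\<^sub>0 n) \<sim>[sequentially] (\<lambda>n. g w lam * \<alpha> * t\<^sub>0 n / sqrt (real (k n)))) \<and>
          (large \<longrightarrow>
             t\<^sub>0 \<sim>[sequentially] (\<lambda>n. real (k n) / (\<kappa> n * ln (\<kappa> n))) \<and>
             (\<lambda>n. t \<alpha> n - t\<^sub>0 n) \<sim>[sequentially]
               (\<lambda>n. sqrt (\<kappa> n * ln (\<kappa> n)) * \<alpha> * t\<^sub>0 n / sqrt (real (k n)))) \<and>
          (small \<or> critical lam \<or> large \<longrightarrow> t \<alpha> \<sim>[sequentially] t\<^sub>0)))"
proof (rule exI[of _ time_profile], rule exI[of _ window_profile], intro conjI allI impI, goal_cases)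
  case (3 w lam)
  then show ?case by (rule time_profile_pos)
next
  case (4 w lam)
  then show ?case by (simp add: window_profile_def time_profile_pos spread_pos)
next
  case (7 w k)
  note k = dimension_at_top[OF 7(1)]
  show ?case
    unfolding Let_def
    by (intro allI impI conjI; (elim disjE)?;
        rule small_regime[OF k] critical_regime[OF k] large_regime[OF k 7(2)]; assumption)
qed (rule continuous_on_time_profile continuous_on_window_profile time_profiles_differ window_profiles_differ)+

end
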